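(* Let $L=(L_t)_{t\in[0,T)}$ be a càdlàg martingale with $L_t\in L_2$ for all $t\in[0,T)$ and let $\theta\in(0,1]$. Then the following assertions are equivalent: (1) $\displaystyle \sup_{\tau\in\mathcal T}\|\tau\|_\theta^{-1}\,\|[L;\tau]\|_{\mathrm{BMO}_1([0,T))}<\infty$. (2) One has $\mathcal I^{\frac{1-\theta}{2}}L-L_0\in \mathrm{bmo}_2([0,T))$, and there is a constant $c>0$ such that $$|L_a-L_s|\le c\,\frac{(T-s)^{\theta/2}}{(T-a)^{1/2}}\quad\text{a.s. for all } 0\le s<a<T.$$
   Context: Fix $T\in(0,\infty)$ and a complete probability space $(\Omega,\mathcal F,\mathbb P)$ with a right-continuous filtration $(\mathcal F_t)_{t\in[0,T]}$ such that $\mathcal F_0$ is generated by the $\mathbb P$-null sets and $\mathcal F=\mathcal F_T$. $\mathbb E^{\mathcal G}[\cdot]$ denotes conditional expectation given $\mathcal G$ (extended conditional expectation for non-negative random variables). Riemann–Liouville type operators: for a càdlàg $K:[0,T)\to\mathbb R$ (applied path-wise to processes), $\alpha>0$ and $t\in[0,T)$, $\mathcal I^\alpha_tK:=\frac{\alpha}{T^\alpha}\int_0^T(T-u)^{\alpha-1}K_{u\wedge t}\,du$, $\mathcal I^0_tK:=K_t$, and $\mathcal I^\alpha K:=(\mathcal I^\alpha_tK)_{t\in[0,T)}$. Time-nets: $\mathcal T$ is the set of all deterministic $\tau=\{t_i\}_{i=0}^n$ with $0=t_0<t_1<\dots<t_n=T$, $n\in\mathbb N$, and $\|\tau\|_\theta:=\sup_{i=1,\dots,n}\frac{t_i-t_{i-1}}{(T-t_{i-1})^{1-\theta}}$.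 For $a\in[0,T)$, $[L;\tau]_a:=\int_0^a\big|L_u-\sum_{i=1}^nL_{t_{i-1}}\mathbf 1_{(t_{i-1},t_i]}(u)\big|^2du$, and $[L;\tau]$ is the process $([L;\tau]_a)_{a\in[0,T)}$. For an adapted càdlàg process $Y=(Y_t)_{t\in[0,T)}$ with $Y_0\equiv0$ and $p\in(0,\infty)$: $\|Y\|_{\mathrm{BMO}_p([0,T))}$ (resp. $\|Y\|_{\mathrm{bmo}_p([0,T))}$) is the infimum of all $c\in[0,\infty)$ such that $\mathbb E^{\mathcal F_\rho}[|Y_t-Y_{\rho-}|^p]\le c^p$ a.s. (resp. $\mathbb E^{\mathcal F_\rho}[|Y_t-Y_\rho|^p]\le c^p$ a.s.) for all $t\in[0,T)$ and all stopping times $\rho:\Omega\to[0,t]$, where $Y_{0-}:=Y_0$ and $\inf\emptyset:=\infty$. One writes $Y\in\mathrm{bmo}_p([0,T))$ if the quantity is finite. $\mathcal I^\alpha L-L_0$ means the process $(\mathcal I^\alpha_tL-L_0)_{t\in[0,T)}$. *)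

theory Defs
  imports "HOL-Probability.Probability"
begin

text \<open>
  The time interval is \<open>[0,T]\<close>, but the filtration is indexed by all reals, so that the library
  notions \<^const>\<open>stopping_time\<close> and \<open>filtration.pre_sigma\<close> apply. This is no restriction: a
  filtration on \<open>[0,T]\<close> extends constantly to the left and to the right. The members outside
  \<open>[0,T]\<close> have no influence below, since all stopping times take values in \<open>[0,t]\<close> with \<open>t < T\<close>,
  and then both being a stopping time and belonging to its sigma-algebra depend only on the
  members with index in \<open>[0,T]\<close>.
\<close>

locale stochastic_basis =
  prob_space M + complete_measure M + filtration "space M" F
  for M :: "'a measure" and F :: "real \<Rightarrow> 'a measure" and T :: real +
  assumes T_pos: "0 < T"
    and right_continuous: "\<And>t. 0 \<le> t \<Longrightarrow> t < T \<Longrightarrow> sets (F t) = (\<Inter>s\<in>{t<..T}. sets (F s))"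
    and sets_F_0: "sets (F 0) = sigma_sets (space M) (null_sets M)"
    and sets_F_T: "sets (F T) = sets M"

text \<open>
  Processes on \<open>[0,T)\<close> are functions \<open>real \<Rightarrow> 'a \<Rightarrow> real\<close>; only their values at times in
  \<open>[0,T)\<close> and at points of the underlying space are used.
\<close>

definition cadlag :: "real \<Rightarrow> (real \<Rightarrow> real) \<Rightarrow> bool" where
  "cadlag T f \<longleftrightarrow>
     (\<forall>t\<in>{0..<T}. (f \<longlongrightarrow> f t) (at_right t)) \<and>
     (\<forall>t\<in>{0<..<T}. \<exists>l. (f \<longlongrightarrow> l) (at_left t))"

definition cadlag_process :: "'a measure \<Rightarrow> real \<Rightarrow> (real \<Rightarrow> 'a \<Rightarrow> real) \<Rightarrow> bool" where
  "cadlag_process M T X \<longleftrightarrow> (\<forall>\<omega>\<in>space M. cadlag T (\<lambda>t. X t \<omega>))"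

definition adapted :: "(real \<Rightarrow> 'a measure) \<Rightarrow> real \<Rightarrow> (real \<Rightarrow> 'a \<Rightarrow> real) \<Rightarrow> bool" where
  "adapted F T X \<longleftrightarrow> (\<forall>t\<in>{0..<T}. X t \<in> borel_measurable (F t))"

definition martingale ::
  "'a measure \<Rightarrow> (real \<Rightarrow> 'a measure) \<Rightarrow> real \<Rightarrow> (real \<Rightarrow> 'a \<Rightarrow> real) \<Rightarrow> bool" where
  "martingale M F T X \<longleftrightarrow>
     adapted F T X \<and>
     (\<forall>t\<in>{0..<T}. integrable M (X t)) \<and>
     (\<forall>s t. 0 \<le> s \<longrightarrow> s \<le> t \<longrightarrow> t < T \<longrightarrow> (AE \<omega> in M. real_cond_exp M (F s) (X t) \<omega> = X s \<omega>))"

definition left_limit :: "(real \<Rightarrow> real) \<Rightarrow> real \<Rightarrow> real" where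
  "left_limit f t = (if t \<le> 0 then f 0 else Lim (at_left t) f)"

definition riemann_liouville :: "real \<Rightarrow> real \<Rightarrow> (real \<Rightarrow> real) \<Rightarrow> real \<Rightarrow> real" where
  "riemann_liouville T \<alpha> K t =
     (if \<alpha> = 0 then K t
      else \<alpha> / T powr \<alpha> * (LINT u:{0..T}|lborel. (T - u) powr (\<alpha> - 1) * K (min u t)))"

text \<open>A time-net is a pair \<open>(n, t)\<close>; the values of \<open>t\<close> beyond \<open>n\<close> are irrelevant.\<close>

definition time_nets :: "real \<Rightarrow> (nat \<times> (nat \<Rightarrow> real)) set" where
  "time_nets T = {(n, t). 1 \<le> n \<and> t 0 = 0 \<and> t n = T \<and> (\<forall>i\<in>{1..n}. t (i - 1) < t i)}"

definition net_size :: "real \<Rightarrow> real \<Rightarrow> nat \<times> (nat \<Rightarrow> real) \<Rightarrow> real" where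
  "net_size T \<theta> = (\<lambda>(n, t). SUP i\<in>{1..n}. (t i - t (i - 1)) / (T - t (i - 1)) powr (1 - \<theta>))"

definition square_error ::
  "(real \<Rightarrow> 'a \<Rightarrow> real) \<Rightarrow> nat \<times> (nat \<Rightarrow> real) \<Rightarrow> real \<Rightarrow> 'a \<Rightarrow> real" where
  "square_error L = (\<lambda>(n, t) a \<omega>.
     LINT u:{0..a}|lborel.
       \<bar>L u \<omega> - (\<Sum>i=1..n. L (t (i - 1)) \<omega> * indicator {t (i - 1)<..t i} u)\<bar>\<^sup>2)"

text \<open>
  The norms take values in \<open>[0,\<infinity>]\<close>, where the infimum of the empty set is \<open>\<infinity>\<close>.
  The processes concerned are adapted and cadlag, which makes the integrands
  \<open>M\<close>-measurable, as \<^const>\<open>nn_cond_exp\<close> requires.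
\<close>

definition BMO_norm ::
  "'a measure \<Rightarrow> (real \<Rightarrow> 'a measure) \<Rightarrow> real \<Rightarrow> real \<Rightarrow> (real \<Rightarrow> 'a \<Rightarrow> real) \<Rightarrow> ennreal" where
  "BMO_norm M F T p Y = Inf {ennreal c | c. 0 \<le> c \<and>
     (\<forall>t\<in>{0..<T}. \<forall>\<rho>. stopping_time F \<rho> \<and> \<rho> \<in> space M \<rightarrow> {0..t} \<longrightarrow>
        (AE \<omega> in M. nn_cond_exp M (filtration.pre_sigma (space M) F \<rho>)
             (\<lambda>\<omega>. ennreal (\<bar>Y t \<omega> - left_limit (\<lambda>s. Y s \<omega>) (\<rho> \<omega>)\<bar> powr p)) \<omega>
           \<le> ennreal (c powr p)))}"

definition bmo_norm ::
  "'a measure \<Rightarrow> (real \<Rightarrow> 'a measure) \<Rightarrow> real \<Rightarrow> real \<Rightarrow> (real \<Rightarrow> 'a \<Rightarrow> real) \<Rightarrow> ennreal" where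
  "bmo_norm M F T p Y = Inf {ennreal c | c. 0 \<le> c \<and>
     (\<forall>t\<in>{0..<T}. \<forall>\<rho>. stopping_time F \<rho> \<and> \<rho> \<in> space M \<rightarrow> {0..t} \<longrightarrow>
        (AE \<omega> in M. nn_cond_exp M (filtration.pre_sigma (space M) F \<rho>)
             (\<lambda>\<omega>. ennreal (\<bar>Y t \<omega> - Y (\<rho> \<omega>) \<omega>\<bar> powr p)) \<omega>
           \<le> ennreal (c powr p)))}"

definition bmo ::
  "'a measure \<Rightarrow> (real \<Rightarrow> 'a measure) \<Rightarrow> real \<Rightarrow> real \<Rightarrow> (real \<Rightarrow> 'a \<Rightarrow> real) set" where
  "bmo M F T p = {Y. adapted F T Y \<and> cadlag_process M T Y \<and> (\<forall>\<omega>\<in>space M. Y 0 \<omega> = 0) \<and>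
                     bmo_norm M F T p Y < \<infinity>}"

end

theory Submission
  imports Defs
begin

text \<open>Both conditions only involve stopping times through conditional expectations, and right-continuity
  together with Fatou's lemma reduces them to deterministic times \<open>s\<close> and events \<open>A \<in> F s\<close>. Everything is then
  expressed through the energies \<open>E 1\<^sub>A (X u - X s)\<^sup>2\<close>, which are additive in time for square-integrable
  martingales. With \<open>\<alpha> = (1 - \<theta>) / 2\<close> and \<open>w u = ((T - u) / T) powr \<alpha>\<close>, the Riemann-Liouville transform \<open>I\<close> of \<open>L\<close>
  is a martingale with \<open>dI = w dL\<close>; integrating by parts pathwise shows that the energy of \<open>I\<close> over
  \<open>[s, u]\<close> lies between \<open>(w u)\<^sup>2\<close> and \<open>(w s)\<^sup>2\<close> times that of \<open>L\<close>.

  If \<open>I\<close> is in bmo, the lower estimate and \<open>\<integral> (T - u) powr (\<theta> - 1) du \<le> \<theta>\<^sup>-\<^sup>1 (r - q) (T - q) powr (\<theta> - 1)\<close>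
  bound the error on each cell by the net size times the increment of the energy of \<open>I\<close>, and these
  increments telescope; the cell containing \<open>s\<close> is handled by the pointwise bound on \<open>L\<close>.
  Conversely, a net whose last cell is \<open>(s, T]\<close> yields the pointwise bound, and two interlaced nets with
  steps of order \<open>(T - t) powr (1 - \<theta>) / N\<close> detect all increments of the energy of \<open>L\<close>, hence
  of \<open>I\<close> by the upper estimate.\<close>

section \<open>Paths\<close>

text \<open>The exponent of the transform is matched to the net size: a cell starting at
  \<open>p\<close> has length at most the net size times (T - p) powr (1 - \<theta>), and this power
  is, up to a constant, the square of the weight. Hence the sum of cell length times energy of
  \<open>L\<close> should be the net size times the energy of the transform. Three obstacles shape
  the proof. If a cell reaches up to \<open>T\<close>, the power at \<open>u\<close> is not
  comparable to the power at the left end; integrating it over the cell removes this, since \<theta>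
  > 0. Conditioning at a time \<open>s\<close> inside a cell leaves the increment made since the
  last net point, which no energy after \<open>s\<close> controls; hence the pointwise bound. An
  energy increment near the right end of a cell is counted only for a short time, so a single net
  can miss it; hence two nets. Nothing is assumed about \<open>L\<close> at \<open>T\<close>, so all
  estimates live on [0,a] with a < T and have constants independent of \<open>a\<close>. Stochastic
  integrals and brackets do not occur: the martingale property enters only as orthogonality of
  increments in L2.\<close>

lemma set_integral_Icc_combine:
  fixes f :: "real \<Rightarrow> real"
  assumes "a \<le> b" "b \<le> c" and f: "set_integrable lborel {a..c} f"
  shows "(LINT u:{a..c}|lborel. f u) = (LINT u:{a..b}|lborel. f u) + (LINT u:{b..c}|lborel. f u)"
proof -
  have "{a..c} = {a..b} \<union> {b..c}" using assms by auto
  moreover have "(LINT u:{a..b} \<union> {b..c}|lborel. f u)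
    = (LINT u:{a..b}|lborel. f u) + (LINT u:{b..c}|lborel. f u)"
  proof (rule set_integral_Un_AE)
    have "AE u in lborel. u \<noteq> b" by (rule AE_lborel_singleton)
    then show "AE x in lborel. \<not> (x \<in> {a..b} \<and> x \<in> {b..c})" by eventually_elim auto
    show "set_integrable lborel {a..b} f" "set_integrable lborel {b..c} f"
      using f by (rule set_integrable_subset, use assms in auto)+
  qed auto
  ultimately show ?thesis by simp
qed

lemma set_integrable_bounded_Icc:
  fixes f :: "real \<Rightarrow> real"
  assumes [measurable]: "f \<in> borel_measurable borel" and B: "\<And>u. u \<in> {a..b} \<Longrightarrow> \<bar>f u\<bar> \<le> B"
  shows "set_integrable lborel {a..b} f"
  unfolding set_integrable_def
  by (rule integrableI_bounded_set[where A="{a..b}" and B=B])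
     (auto simp: emeasure_lborel_Icc_eq indicator_def split: if_splits intro!: B AE_I2)

text \<open>A process is a total function of time with arbitrary values outside [0,T). Clamping the
  time gives maps that are measurable on the whole line and involve only values of the process on
  [0,t].\<close>

definition clamp_time :: "real \<Rightarrow> real \<Rightarrow> real" where
  "clamp_time t u = max 0 (min u t)"

lemma clamp_time_in: "0 \<le> t \<Longrightarrow> clamp_time t u \<in> {0..t}"
  by (auto simp: clamp_time_def)

lemma clamp_time_id: "u \<in> {0..t} \<Longrightarrow> clamp_time t u = u"
  by (auto simp: clamp_time_def)

lemma cadlag_tendsto_right:
  assumes "cadlag T f" "c \<in> {0..<T}" "\<And>n. c \<le> s n" "s \<longlonglongrightarrow> c"
  shows "(\<lambda>n. f (s n)) \<longlonglongrightarrow> f c"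
proof -
  have "continuous (at c within {c..}) f"
    unfolding continuous_within using assms by (simp add: cadlag_def at_within_Ici_at_right)
  then show ?thesis
    by (rule continuous_within_tendsto_compose) (use assms in auto)
qed

text \<open>Boundedness passes to concatenated intervals and holds near every point because of the
  one-sided limits, so Bolzano's bisection argument applies.\<close>

lemma cadlag_bounded:
  assumes f: "cadlag T f" and b: "0 \<le> b" "b < T"
  obtains B where "\<And>u. u \<in> {0..b} \<Longrightarrow> \<bar>f u\<bar> \<le> B"
proof -
  \<comment> \<open>The intersection with \<open>{0..}\<close> matters near 0: the small intervals
    of the bisection may reach to the left of 0, where \<open>f\<close> is arbitrary.\<close>
  define P where "P = (\<lambda>x y. \<exists>B. \<forall>u\<in>{x..y} \<inter> {0..}. \<bar>f u\<bar> \<le> B)"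
  have "P 0 b"
  proof (rule Bolzano)
    show "P x z" if xy: "P x y" "P y z" "x \<le> y" "y \<le> z" for x y z
    proof -
      obtain B C where B: "\<And>u. u \<in> {x..y} \<inter> {0..} \<Longrightarrow> \<bar>f u\<bar> \<le> B"
        and C: "\<And>u. u \<in> {y..z} \<inter> {0..} \<Longrightarrow> \<bar>f u\<bar> \<le> C"
        using xy(1,2) unfolding P_def by blast
      have "\<bar>f u\<bar> \<le> max B C" if "u \<in> {x..z} \<inter> {0..}" for u
        using B[of u] C[of u] that by (cases "u \<le> y") auto
      then show ?thesis unfolding P_def by blast
    qed
    show "\<exists>d>0. \<forall>y z. y \<le> x \<and> x \<le> z \<and> z - y < d \<longrightarrow> P y z" if x: "0 \<le> x" "x \<le> b" for x
    proof -
      have "(f \<longlongrightarrow> f x) (at_right x)" using f x b by (auto simp: cadlag_def)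
      then have "\<forall>\<^sub>F u in at_right x. dist (f u) (f x) < 1" by (rule tendstoD) simp
      then obtain r where r: "r > x" "\<And>u. u > x \<Longrightarrow> u < r \<Longrightarrow> dist (f u) (f x) < 1"
        unfolding eventually_at_right_field by blast
      have "\<exists>l C. l < x \<and> (\<forall>u. l < u \<longrightarrow> u < x \<longrightarrow> 0 \<le> u \<longrightarrow> \<bar>f u\<bar> \<le> C)"
      proof (cases "x = 0")
        case True
        then show ?thesis by (intro exI[of _ "-1"]) auto
      next
        case False
        then obtain C where "(f \<longlongrightarrow> C) (at_left x)" using f x b by (force simp: cadlag_def)
        then have "\<forall>\<^sub>F u in at_left x. dist (f u) C < 1" by (rule tendstoD) simp
        then obtain l where "l < x" "\<And>u. u > l \<Longrightarrow> u < x \<Longrightarrow> dist (f u) C < 1"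
          unfolding eventually_at_left_field by blast
        then show ?thesis
          by (intro exI[of _ l] exI[of _ "\<bar>C\<bar> + 1"]) (fastforce simp: dist_real_def)
      qed
      then obtain l C where l: "l < x" "\<And>u. l < u \<Longrightarrow> u < x \<Longrightarrow> 0 \<le> u \<Longrightarrow> \<bar>f u\<bar> \<le> C"
        by blast
      show ?thesis
      proof (intro exI[of _ "min (r - x) (x - l)"] conjI allI impI)
        show "0 < min (r - x) (x - l)" using r l by simp
        show "P y z" if yz: "y \<le> x \<and> x \<le> z \<and> z - y < min (r - x) (x - l)" for y z
          unfolding P_def
        proof (intro exI[of _ "max C (\<bar>f x\<bar> + 1)"] ballI)
          fix u assume u: "u \<in> {y..z} \<inter> {0..}"
          consider "u < x" | "u = x" | "x < u" by linarith
          then show "\<bar>f u\<bar> \<le> max C (\<bar>f x\<bar> + 1)"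
          proof cases
            case 1
            then show ?thesis using l(2)[of u] u yz by auto
          next
            case 3
            then show ?thesis using r(2)[of u] u yz by (auto simp: dist_real_def)
          qed auto
        qed
      qed
    qed
  qed (use b in auto)
  then obtain B where "\<forall>u\<in>{0..b} \<inter> {0..}. \<bar>f u\<bar> \<le> B" unfolding P_def by blast
  then show thesis by (intro that[of B]) auto
qed

text \<open>The grid point of mesh 1 / (n + 1) that follows \<open>u\<close> approaches
  \<open>u\<close> from the right, the side on which cadlag paths are continuous. The same grid
  serves joint measurability and the discretisation of stopping times.\<close>

lemma clamp_time_tendsto_right:
  assumes "0 \<le> t"
  shows "(\<lambda>n. clamp_time t ((real_of_int \<lfloor>real (Suc n) * u\<rfloor> + 1) / real (Suc n))) \<longlonglongrightarrow> clamp_time t u"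
    and "clamp_time t u \<le> clamp_time t ((real_of_int \<lfloor>real (Suc n) * u\<rfloor> + 1) / real (Suc n))"
proof -
  define s where "s = (\<lambda>n. (real_of_int \<lfloor>real (Suc n) * u\<rfloor> + 1) / real (Suc n))"
  have s: "u \<le> s n" "s n \<le> u + 1 / real (Suc n)" for n
  proof -
    define m where "m = real (Suc n)"
    have m: "0 < m" by (simp add: m_def)
    have "u * m \<le> real_of_int \<lfloor>m * u\<rfloor> + 1" "real_of_int \<lfloor>m * u\<rfloor> \<le> u * m"
      by (simp_all add: mult.commute)
    with m have "u \<le> (real_of_int \<lfloor>m * u\<rfloor> + 1) / m" "real_of_int \<lfloor>m * u\<rfloor> / m \<le> u"
      by (simp_all add: pos_le_divide_eq pos_divide_le_eq)
    then show "u \<le> s n" "s n \<le> u + 1 / real (Suc n)"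
      unfolding s_def m_def by (simp_all only: add_divide_distrib)
  qed
  have "s \<longlonglongrightarrow> u"
  proof (rule tendsto_sandwich[where f="\<lambda>_. u"])
    have "(\<lambda>n. u + inverse (real (Suc n))) \<longlonglongrightarrow> u + 0"
      by (intro tendsto_intros LIMSEQ_inverse_real_of_nat)
    then show "(\<lambda>n. u + 1 / real (Suc n)) \<longlonglongrightarrow> u" by (simp add: inverse_eq_divide)
  qed (use s in auto)
  then show "(\<lambda>n. clamp_time t ((real_of_int \<lfloor>real (Suc n) * u\<rfloor> + 1) / real (Suc n))) \<longlonglongrightarrow> clamp_time t u"
    unfolding clamp_time_def s_def by (intro tendsto_intros)
  show "clamp_time t u \<le> clamp_time t ((real_of_int \<lfloor>real (Suc n) * u\<rfloor> + 1) / real (Suc n))"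
    using s(1)[of n] unfolding clamp_time_def s_def by linarith
qed

text \<open>By right continuity the process is a pointwise limit of processes that are constant in
  time between grid points, and each of those is a countable gluing of measurable maps. Since the
  grid is clamped at \<open>t\<close>, the case that \<open>N\<close> is \<open>F t\<close> is
  progressive measurability.\<close>

lemma cadlag_jointly_measurable:
  assumes t: "0 \<le> t" "t < T"
    and X: "\<And>u. u \<in> {0..t} \<Longrightarrow> X u \<in> borel_measurable N"
    and cad: "\<And>\<omega>. \<omega> \<in> space N \<Longrightarrow> cadlag T (\<lambda>u. X u \<omega>)"
  shows "(\<lambda>(\<omega>, u). X (clamp_time t u) \<omega>) \<in> borel_measurable (N \<Otimes>\<^sub>M lborel)"
proof (rule borel_measurable_LIMSEQ_real)
  define grid where "grid = (\<lambda>n (i::int). clamp_time t ((real_of_int i + 1) / real (Suc n)))"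
  show "(\<lambda>(\<omega>, u). X (grid n \<lfloor>real (Suc n) * u\<rfloor>) \<omega>) \<in> borel_measurable (N \<Otimes>\<^sub>M lborel)" for n
  proof -
    have X': "X (grid n i) \<in> borel_measurable N" for i
      unfolding grid_def by (intro X clamp_time_in t)
    have "(\<lambda>x. (\<lambda>i x. X (grid n i) (fst x)) \<lfloor>real (Suc n) * snd x\<rfloor> x)
        \<in> borel_measurable (N \<Otimes>\<^sub>M lborel)"
    proof (rule measurable_compose_countable)
      show "(\<lambda>x. X (grid n i) (fst x)) \<in> borel_measurable (N \<Otimes>\<^sub>M lborel)" for i
        by (rule measurable_compose[OF measurable_fst X'])
      have "(\<lambda>u. \<lfloor>real (Suc n) * u\<rfloor>) \<in> measurable lborel (count_space UNIV)"
        by (rule measurable_compose[OF _ measurable_real_floor]) simp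
      then show "(\<lambda>x. \<lfloor>real (Suc n) * snd x\<rfloor>) \<in> measurable (N \<Otimes>\<^sub>M lborel) (count_space UNIV)"
        by (rule measurable_compose[OF measurable_snd])
    qed
    then show ?thesis by (simp add: case_prod_beta)
  qed
  show "(\<lambda>n. (case x of (\<omega>, u) \<Rightarrow> X (grid n \<lfloor>real (Suc n) * u\<rfloor>) \<omega>))
      \<longlonglongrightarrow> (case x of (\<omega>, u) \<Rightarrow> X (clamp_time t u) \<omega>)"
    if x: "x \<in> space (N \<Otimes>\<^sub>M lborel)" for x
  proof -
    obtain \<omega> u where x': "x = (\<omega>, u)" "\<omega> \<in> space N" using x by (auto simp: space_pair_measure)
    show ?thesis
      unfolding x' grid_def prod.case
      by (rule cadlag_tendsto_right[OF cad[OF x'(2)]])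
         (use clamp_time_in[OF t(1), of u] t clamp_time_tendsto_right in auto)
  qed
qed

lemma cadlag_borel_measurable_clamp:
  assumes "cadlag T f" "0 \<le> t" "t < T"
  shows "(\<lambda>u. f (clamp_time t u)) \<in> borel_measurable borel"
proof -
  \<comment> \<open>A one-point sample space turns joint measurability into measurability of a
    single path.\<close>
  have "(\<lambda>(\<omega>, u). f (clamp_time t u)) \<in> borel_measurable (count_space {()} \<Otimes>\<^sub>M lborel)"
    using cadlag_jointly_measurable[of t T "\<lambda>u _. f u" "count_space {()}"] assms by simp
  from measurable_compose[OF measurable_Pair1'[of "()"] this] show ?thesis by simp
qed

lemma set_integrable_cadlag:
  assumes f: "cadlag T f" "0 \<le> a" "b < T" and k: "continuous_on {a..b} k"
  shows "set_integrable lborel {a..b} (\<lambda>u. k u * f u)"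
proof (cases "a \<le> b")
  case True
  obtain B where B: "\<And>u. u \<in> {0..b} \<Longrightarrow> \<bar>f u\<bar> \<le> B"
    using cadlag_bounded[OF f(1)] True f by (metis order_trans)
  have "bounded (k ` {a..b})"
    using k by (intro compact_imp_bounded compact_continuous_image) auto
  then obtain C where "\<forall>u\<in>{a..b}. \<bar>k u\<bar> \<le> C" by (auto simp: bounded_iff)
  then have C: "\<And>u. u \<in> {a..b} \<Longrightarrow> \<bar>k u\<bar> \<le> C" by blast
  have [measurable]: "(\<lambda>u. f (clamp_time b u)) \<in> borel_measurable borel"
    using True f by (intro cadlag_borel_measurable_clamp) auto
  have [measurable]: "(\<lambda>u. indicator {a..b} u *\<^sub>R k u) \<in> borel_measurable borel"
    by (rule borel_measurable_continuous_on_indicator[OF _ k]) simp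
  have "set_integrable lborel {a..b} (\<lambda>u. (indicator {a..b} u *\<^sub>R k u) * f (clamp_time b u))"
  proof (rule set_integrable_bounded_Icc)
    fix u assume "u \<in> {a..b}"
    then show "\<bar>indicator {a..b} u *\<^sub>R k u * f (clamp_time b u)\<bar> \<le> C * B"
      using B[of "clamp_time b u"] C[of u] clamp_time_in[of b u] f True
      by (auto simp: abs_mult clamp_time_id intro!: mult_mono)
  qed measurable
  then show ?thesis
    by (rule iffD1[OF set_integrable_cong, rotated 3]) (use f in \<open>auto simp: clamp_time_id\<close>)
qed (simp add: set_integrable_def)

section \<open>Riemann-Liouville transform\<close>

text \<open>For \<alpha> > 0 the transform averages the path stopped at \<open>t\<close> with
  respect to the probability density \<open>rl_density\<close> on [0,T], and
  \<open>rl_weight\<close> is the mass of [u,T]. For \<alpha> = 0 the density vanishes and the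
  weight is 1 before \<open>T\<close>, so the same formulas cover the identity transform.\<close>

definition rl_weight :: "real \<Rightarrow> real \<Rightarrow> real \<Rightarrow> real" where
  "rl_weight T \<alpha> u = (T - u) powr \<alpha> / T powr \<alpha>"

definition rl_density :: "real \<Rightarrow> real \<Rightarrow> real \<Rightarrow> real" where
  "rl_density T \<alpha> u = \<alpha> / T powr \<alpha> * (T - u) powr (\<alpha> - 1)"

lemma rl_density_nonneg: "0 \<le> \<alpha> \<Longrightarrow> 0 \<le> rl_density T \<alpha> u"
  by (simp add: rl_density_def)

lemma continuous_on_powr_diff: "b < T \<Longrightarrow> continuous_on {a..b} (\<lambda>u. (T - u) powr \<beta>)" for T :: real
  by (intro continuous_intros) auto

lemma continuous_on_rl_density: "b < T \<Longrightarrow> continuous_on {a..b} (rl_density T \<alpha>)"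
  unfolding rl_density_def by (intro continuous_on_mult_left continuous_on_powr_diff)

lemma rl_weight_pos: "0 < T \<Longrightarrow> u < T \<Longrightarrow> 0 < rl_weight T \<alpha> u"
  by (simp add: rl_weight_def)

lemma rl_weight_0: "0 < T \<Longrightarrow> rl_weight T \<alpha> 0 = 1"
  by (simp add: rl_weight_def)

lemma DERIV_powr_diff:
  fixes T :: real
  shows "u < T \<Longrightarrow> ((\<lambda>u. (T - u) powr \<beta>) has_real_derivative - (\<beta> * (T - u) powr (\<beta> - 1))) (at u within S)"
  by (rule derivative_eq_intros refl | simp)+

lemma set_integral_powr_diff:
  fixes T :: real
  assumes "b \<le> c" "c < T"
  shows "(LINT u:{b..c}|lborel. \<beta> * (T - u) powr (\<beta> - 1)) = (T - b) powr \<beta> - (T - c) powr \<beta>"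
proof -
  have "((\<lambda>u. - ((T - u) powr \<beta>)) has_vector_derivative \<beta> * (T - u) powr (\<beta> - 1)) (at u within {b..c})"
    if "b \<le> u" "u \<le> c" for u
    using DERIV_minus[OF DERIV_powr_diff[of u T \<beta> "{b..c}"]] that assms
    by (simp add: has_real_derivative_iff_has_vector_derivative)
  then show ?thesis
    unfolding set_lebesgue_integral_def
    by (subst integral_FTC_Icc[where F="\<lambda>u. - ((T - u) powr \<beta>)"])
       (use assms in \<open>auto intro!: continuous_on_mult_left continuous_on_powr_diff\<close>)
qed

lemma set_integral_rl_density:
  assumes "b \<le> c" "c < T"
  shows "(LINT u:{b..c}|lborel. rl_density T \<alpha> u) = rl_weight T \<alpha> b - rl_weight T \<alpha> c"
proof -
  have "(LINT u:{b..c}|lborel. rl_density T \<alpha> u)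
      = (LINT u:{b..c}|lborel. (1 / T powr \<alpha>) * (\<alpha> * (T - u) powr (\<alpha> - 1)))"
    by (simp add: rl_density_def)
  also have "\<dots> = (1 / T powr \<alpha>) * (LINT u:{b..c}|lborel. \<alpha> * (T - u) powr (\<alpha> - 1))"
    by (rule set_integral_mult_right)
  finally show ?thesis
    using assms by (simp only: set_integral_powr_diff) (simp add: rl_weight_def diff_divide_distrib)
qed

text \<open>For \<alpha> < 1 the integrand is unbounded at \<open>T\<close>. The fundamental theorem
  is therefore applied on the open interval, with a nonnegative integrand and the one-sided limits
  of the primitive.\<close>

lemma powr_diff_tail:
  fixes T :: real
  assumes \<alpha>: "0 < \<alpha>" and t: "t < T"
  shows "set_integrable lborel {t..T} (\<lambda>u. (T - u) powr (\<alpha> - 1))"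
    and "(LINT u:{t..T}|lborel. (T - u) powr (\<alpha> - 1)) = (T - t) powr \<alpha> / \<alpha>"
proof -
  define F where "F = (\<lambda>u. (- 1 / \<alpha>) * (T - u) powr \<alpha>)"
  have D: "DERIV F u :> (T - u) powr (\<alpha> - 1)" if "u < T" for u
    unfolding F_def
  proof (rule DERIV_cong[OF DERIV_cmult[OF DERIV_powr_diff[OF that]]])
    show "- 1 / \<alpha> * - (\<alpha> * (T - u) powr (\<alpha> - 1)) = (T - u) powr (\<alpha> - 1)"
      using \<alpha> by (simp add: field_simps)
  qed
  have "continuous_on {t..T} F"
    unfolding F_def using \<alpha> by (intro continuous_on_mult_left continuous_on_powr' continuous_intros) auto
  then have "(F \<longlongrightarrow> F t) (at t within {t..T})" "(F \<longlongrightarrow> F T) (at T within {t..T})"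
    using t by (auto simp: continuous_on_def)
  then have lims: "(F \<longlongrightarrow> F t) (at_right t)" "(F \<longlongrightarrow> F T) (at_left T)"
    using t by (auto simp: at_within_Icc_at_right at_within_Icc_at_left)
  have lim: "((F \<circ> real_of_ereal) \<longlongrightarrow> F t) (at_right (ereal t))"
    "((F \<circ> real_of_ereal) \<longlongrightarrow> F T) (at_left (ereal T))"
    unfolding ereal_tendsto_simps using lims .
  note * = interval_integral_FTC_nonneg[of "ereal t" "ereal T" F "\<lambda>u. (T - u) powr (\<alpha> - 1)", OF _ _ _ _ lim]
  have "set_integrable lborel (einterval (ereal t) (ereal T)) (\<lambda>u. (T - u) powr (\<alpha> - 1))"
    using t by (intro *) (auto intro!: D continuous_intros)
  then have i: "set_integrable lborel {t<..<T} (\<lambda>u. (T - u) powr (\<alpha> - 1))" by simp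
  have AE: "AE u in lborel. indicator {t<..<T} u *\<^sub>R (T - u) powr (\<alpha> - 1)
      = indicator {t..T} u *\<^sub>R (T - u) powr (\<alpha> - 1)"
    using AE_lborel_singleton[of t] AE_lborel_singleton[of T]
    by eventually_elim (auto simp: indicator_def)
  show "set_integrable lborel {t..T} (\<lambda>u. (T - u) powr (\<alpha> - 1))"
    using i unfolding set_integrable_def by (rule integrable_cong_AE_imp[OF _ _ AE]) measurable
  have "(LBINT u=ereal t..ereal T. (T - u) powr (\<alpha> - 1)) = F T - F t"
    using t by (intro *) (auto intro!: D continuous_intros)
  then show "(LINT u:{t..T}|lborel. (T - u) powr (\<alpha> - 1)) = (T - t) powr \<alpha> / \<alpha>"
    using t \<alpha> by (simp add: interval_integral_Icc F_def)
qed

text \<open>This is \<open>riemann_liouville\<close> with the integral split at \<open>t\<close>: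
  beyond \<open>t\<close> the stopped path is constant and contributes \<open>f t\<close> times the
  mass of [t,T]. The remaining integral stays away from the singularity at \<open>T\<close>.\<close>

definition rl_path :: "real \<Rightarrow> real \<Rightarrow> (real \<Rightarrow> real) \<Rightarrow> real \<Rightarrow> real" where
  "rl_path T \<alpha> f t = rl_weight T \<alpha> t * f t + (LINT u:{0..t}|lborel. rl_density T \<alpha> u * f u)"

lemma riemann_liouville_eq_rl_path:
  assumes f: "cadlag T f" and t: "0 \<le> t" "t < T" and \<alpha>: "0 \<le> \<alpha>"
  shows "riemann_liouville T \<alpha> f t = rl_path T \<alpha> f t"
proof (cases "\<alpha> = 0")
  case True
  then show ?thesis using t
    by (simp add: riemann_liouville_def rl_path_def rl_weight_def rl_density_def set_lebesgue_integral_def)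
next
  case False
  with \<alpha> have \<alpha>: "0 < \<alpha>" by simp
  let ?g = "\<lambda>u. (T - u) powr (\<alpha> - 1) * f (min u t)"
  have i1: "set_integrable lborel {0..t} ?g"
  proof (rule iffD1[OF set_integrable_cong])
    show "set_integrable lborel {0..t} (\<lambda>u. (T - u) powr (\<alpha> - 1) * f u)"
      using f t by (intro set_integrable_cadlag continuous_on_powr_diff) auto
  qed auto
  have i2: "set_integrable lborel {t..T} ?g"
  proof (rule iffD1[OF set_integrable_cong])
    show "set_integrable lborel {t..T} (\<lambda>u. (T - u) powr (\<alpha> - 1) * f t)"
      using powr_diff_tail(1)[OF \<alpha> t(2)] by (rule set_integrable_mult_left)
  qed auto
  have "set_integrable lborel ({0..t} \<union> {t..T}) ?g"
    by (rule set_integrable_Un[OF i1 i2]) auto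
  then have i: "set_integrable lborel {0..T} ?g" using t by (simp add: ivl_disj_un)
  have "(LINT u:{0..T}|lborel. ?g u) = (LINT u:{0..t}|lborel. ?g u) + (LINT u:{t..T}|lborel. ?g u)"
    using t i by (intro set_integral_Icc_combine) auto
  also have "(LINT u:{0..t}|lborel. ?g u) = (LINT u:{0..t}|lborel. (T - u) powr (\<alpha> - 1) * f u)"
    by (rule set_lebesgue_integral_cong) auto
  also have "(LINT u:{t..T}|lborel. ?g u) = (LINT u:{t..T}|lborel. (T - u) powr (\<alpha> - 1) * f t)"
    by (rule set_lebesgue_integral_cong) auto
  also have "\<dots> = (T - t) powr \<alpha> / \<alpha> * f t"
    by (simp add: powr_diff_tail(2)[OF \<alpha> t(2)])
  finally have 1: "(LINT u:{0..T}|lborel. ?g u)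
    = (LINT u:{0..t}|lborel. (T - u) powr (\<alpha> - 1) * f u) + (T - t) powr \<alpha> / \<alpha> * f t" .
  have 2: "(LINT u:{0..t}|lborel. rl_density T \<alpha> u * f u)
      = \<alpha> / T powr \<alpha> * (LINT u:{0..t}|lborel. (T - u) powr (\<alpha> - 1) * f u)"
    unfolding rl_density_def mult.assoc by simp
  have "riemann_liouville T \<alpha> f t = \<alpha> / T powr \<alpha> * (LINT u:{0..T}|lborel. ?g u)"
    using False by (simp add: riemann_liouville_def)
  then show ?thesis
    unfolding 1 2 rl_path_def rl_weight_def using \<alpha> by (simp add: distrib_left)
qed

lemma rl_path_0:
  assumes "0 < T" shows "rl_path T \<alpha> f 0 = f 0"
proof -
  have "(LINT u:{0..0}|lborel. rl_density T \<alpha> u * f u) = 0"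
    unfolding set_lebesgue_integral_def
    by (intro integral_eq_zero_AE eventually_mono[OF AE_lborel_singleton[of 0]]) (simp add: indicator_def)
  then show ?thesis using assms by (simp add: rl_path_def rl_weight_0)
qed

text \<open>Integration by parts, the density being minus the derivative of the weight. The
  increment of the transform is thus an integral of the increments of \<open>f\<close> since
  \<open>b\<close> against a positive measure: an atom of mass \<open>rl_weight T \<alpha> c\<close>
  at \<open>c\<close> plus the density on [b,c], of total mass
  \<open>rl_weight T \<alpha> b\<close>. Both energy estimates rest on this form.\<close>

lemma rl_path_increment:
  assumes f: "cadlag T f" and bc: "0 \<le> b" "b \<le> c" "c < T"
  shows "rl_path T \<alpha> f c - rl_path T \<alpha> f b
    = rl_weight T \<alpha> c * (f c - f b) + (LINT u:{b..c}|lborel. rl_density T \<alpha> u * (f u - f b))"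
proof -
  have i: "set_integrable lborel {x..c} (\<lambda>u. rl_density T \<alpha> u * f u)" if "0 \<le> x" for x
    using f that bc by (intro set_integrable_cadlag continuous_on_rl_density) auto
  have k: "set_integrable lborel {b..c} (rl_density T \<alpha>)"
    using bc by (intro borel_integrable_atLeastAtMost' continuous_on_rl_density)
  have "(LINT u:{0..c}|lborel. rl_density T \<alpha> u * f u)
      = (LINT u:{0..b}|lborel. rl_density T \<alpha> u * f u) + (LINT u:{b..c}|lborel. rl_density T \<alpha> u * f u)"
    using bc by (intro set_integral_Icc_combine i) auto
  moreover have "(LINT u:{b..c}|lborel. rl_density T \<alpha> u * (f u - f b))
      = (LINT u:{b..c}|lborel. rl_density T \<alpha> u * f u) - (LINT u:{b..c}|lborel. rl_density T \<alpha> u * f b)"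
    unfolding right_diff_distrib using bc i[of b] k by (intro set_integral_diff) auto
  moreover have "(LINT u:{b..c}|lborel. rl_density T \<alpha> u * f b) = (rl_weight T \<alpha> b - rl_weight T \<alpha> c) * f b"
    using bc by (simp add: set_integral_rl_density)
  ultimately show ?thesis by (simp add: rl_path_def algebra_simps)
qed

lemma indefinite_set_integral_continuous:
  fixes f :: "real \<Rightarrow> real"
  assumes f: "\<And>b. b < T \<Longrightarrow> set_integrable lborel {0..b} f" and t: "0 \<le> t" "t < T"
  shows "((\<lambda>s. LINT u:{0..s}|lborel. f u) \<longlongrightarrow> (LINT u:{0..t}|lborel. f u)) (at_right t)"
    and "0 < t \<Longrightarrow> ((\<lambda>s. LINT u:{0..s}|lborel. f u) \<longlongrightarrow> (LINT u:{0..t}|lborel. f u)) (at_left t)"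
proof -
  obtain b where b: "t < b" "b < T" using t dense by blast
  have eq: "(LINT u:{0..s}|lborel. f u) = integral {0..s} f" if "s \<in> {0..b}" for s
    using set_borel_integral_eq_integral(2)[OF f[of s]] that b by simp
  have "f integrable_on {0..b}"
    using set_borel_integral_eq_integral(1)[OF f[OF b(2)]] .
  then have "continuous_on {0..b} (\<lambda>s. integral {0..s} f)"
    by (rule indefinite_integral_continuous_1)
  then have "continuous_on {0..b} (\<lambda>s. LINT u:{0..s}|lborel. f u)"
    by (rule continuous_on_eq) (simp add: eq)
  then have *: "((\<lambda>s. LINT u:{0..s}|lborel. f u) \<longlongrightarrow> (LINT u:{0..t}|lborel. f u)) (at t within {0..b})"
    using t b by (simp add: continuous_on_def)
  show "((\<lambda>s. LINT u:{0..s}|lborel. f u) \<longlongrightarrow> (LINT u:{0..t}|lborel. f u)) (at_right t)"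
    using tendsto_within_subset[OF *, of "{t..b}"] t b by (simp add: at_within_Icc_at_right)
  show "((\<lambda>s. LINT u:{0..s}|lborel. f u) \<longlongrightarrow> (LINT u:{0..t}|lborel. f u)) (at_left t)" if "0 < t"
    using tendsto_within_subset[OF *, of "{0..t}"] that t b by (simp add: at_within_Icc_at_left)
qed

lemma cadlag_rl_path:
  assumes f: "cadlag T f" shows "cadlag T (rl_path T \<alpha> f)"
proof -
  have i: "set_integrable lborel {0..b} (\<lambda>u. rl_density T \<alpha> u * f u)" if "b < T" for b
    using f that by (intro set_integrable_cadlag continuous_on_rl_density) auto
  have w: "(rl_weight T \<alpha> \<longlongrightarrow> rl_weight T \<alpha> t) (at t within S)" if "t < T" for t S
    using DERIV_continuous[OF DERIV_powr_diff[OF that, of \<alpha> S]]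
    unfolding rl_weight_def divide_inverse continuous_within by (rule tendsto_mult_right)
  show ?thesis
    unfolding cadlag_def
  proof (intro conjI ballI)
    fix t assume t: "t \<in> {0..<T}"
    then show "(rl_path T \<alpha> f \<longlongrightarrow> rl_path T \<alpha> f t) (at_right t)"
      using f unfolding rl_path_def
      by (intro tendsto_add tendsto_mult w indefinite_set_integral_continuous[OF i]) (auto simp: cadlag_def)
  next
    fix t assume t: "t \<in> {0<..<T}"
    then obtain l where "(f \<longlongrightarrow> l) (at_left t)" using f unfolding cadlag_def by blast
    then show "\<exists>l. (rl_path T \<alpha> f \<longlongrightarrow> l) (at_left t)"
      using t unfolding rl_path_def
      by (intro exI) (rule tendsto_add tendsto_mult w indefinite_set_integral_continuous(2)[OF i] | simp)+
  qed
qed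

section \<open>Square-integrable martingales\<close>

context stochastic_basis
begin

lemma subalgebra_F: "t \<le> T \<Longrightarrow> subalgebra M (F t)"
  using sets_F_mono[of t T] sets_F_T by (auto simp: subalgebra_def space_F)

lemma measurable_F_imp_M: "f \<in> measurable (F t) N \<Longrightarrow> t \<le> T \<Longrightarrow> f \<in> measurable M N"
  using measurable_from_subalg[OF subalgebra_F] .

lemma measurable_F_mono: "f \<in> measurable (F s) N \<Longrightarrow> s \<le> t \<Longrightarrow> f \<in> measurable (F t) N"
  by (rule measurable_from_subalg) (auto simp: subalgebra_def space_F dest: sets_F_mono[THEN subsetD])

lemma sets_F_imp_M: "A \<in> sets (F t) \<Longrightarrow> t \<le> T \<Longrightarrow> A \<in> sets M"
  using subalgebra_F by (auto simp: subalgebra_def)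

lemma sets_F_le: "A \<in> sets (F s) \<Longrightarrow> s \<le> t \<Longrightarrow> A \<in> sets (F t)"
  using sets_F_mono by blast

definition L2 :: "('a \<Rightarrow> real) \<Rightarrow> bool" where
  "L2 f \<longleftrightarrow> f \<in> borel_measurable M \<and> integrable M (\<lambda>\<omega>. (f \<omega>)\<^sup>2)"

lemma L2_measurable: "L2 f \<Longrightarrow> f \<in> borel_measurable M"
  by (simp add: L2_def)

lemma abs_mult_le_squares: "\<bar>x * y\<bar> \<le> x\<^sup>2 + y\<^sup>2" for x y :: real
  using sum_squares_bound[of "\<bar>x\<bar>" "\<bar>y\<bar>"] mult_nonneg_nonneg[of "\<bar>x\<bar>" "\<bar>y\<bar>"]
  unfolding abs_mult power2_abs by linarith

lemma L2_mult_integrable: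
  assumes "L2 f" "L2 g" shows "integrable M (\<lambda>\<omega>. f \<omega> * g \<omega>)"
proof (rule Bochner_Integration.integrable_bound)
  show "integrable M (\<lambda>\<omega>. (f \<omega>)\<^sup>2 + (g \<omega>)\<^sup>2)" using assms by (auto simp: L2_def)
  show "(\<lambda>\<omega>. f \<omega> * g \<omega>) \<in> borel_measurable M" using assms by (auto simp: L2_def)
  show "AE \<omega> in M. norm (f \<omega> * g \<omega>) \<le> norm ((f \<omega>)\<^sup>2 + (g \<omega>)\<^sup>2)"
    using abs_mult_le_squares by simp
qed

lemma L2_cmult: "L2 f \<Longrightarrow> L2 (\<lambda>\<omega>. c * f \<omega>)"
  by (auto simp: L2_def power_mult_distrib)

lemma L2_add: "L2 f \<Longrightarrow> L2 g \<Longrightarrow> L2 (\<lambda>\<omega>. f \<omega> + g \<omega>)"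
  using L2_mult_integrable[of f g] by (auto simp: L2_def power2_sum mult.assoc)

lemma L2_diff: "L2 f \<Longrightarrow> L2 g \<Longrightarrow> L2 (\<lambda>\<omega>. f \<omega> - g \<omega>)"
  using L2_add[of f "\<lambda>\<omega>. (-1) * g \<omega>"] L2_cmult[of g "-1"] by simp

lemma L2_indicator:
  assumes "L2 f" "A \<in> sets M" shows "L2 (\<lambda>\<omega>. indicator A \<omega> * f \<omega>)"
proof -
  have "integrable M (\<lambda>\<omega>. (f \<omega>)\<^sup>2 * indicator A \<omega>)"
    using assms by (intro integrable_real_mult_indicator) (auto simp: L2_def)
  moreover have "(\<lambda>\<omega>. (indicator A \<omega> * f \<omega>)\<^sup>2) = (\<lambda>\<omega>. (f \<omega>)\<^sup>2 * indicator A \<omega>)"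
    by (auto simp: indicator_def)
  ultimately show ?thesis using assms by (auto simp: L2_def)
qed

text \<open>The martingale property is stated as orthogonality of increments to the
  square-integrable \<open>F s\<close>-measurable variables. In this form it passes through time
  integrals by Fubini's theorem, without conditional expectations.\<close>

definition l2_martingale :: "(real \<Rightarrow> 'a \<Rightarrow> real) \<Rightarrow> bool" where
  "l2_martingale X \<longleftrightarrow>
    (\<forall>t\<in>{0..<T}. X t \<in> borel_measurable (F t) \<and> L2 (X t)) \<and>
    (\<forall>s t Z. 0 \<le> s \<longrightarrow> s \<le> t \<longrightarrow> t < T \<longrightarrow> Z \<in> borel_measurable (F s) \<longrightarrow> L2 Z \<longrightarrow>
       (\<integral>\<omega>. Z \<omega> * (X t \<omega> - X s \<omega>) \<partial>M) = 0)"

lemma l2_martingaleD: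
  assumes "l2_martingale X"
  shows "0 \<le> t \<Longrightarrow> t < T \<Longrightarrow> X t \<in> borel_measurable (F t)"
    and "0 \<le> t \<Longrightarrow> t < T \<Longrightarrow> L2 (X t)"
    and "0 \<le> s \<Longrightarrow> s \<le> t \<Longrightarrow> t < T \<Longrightarrow> Z \<in> borel_measurable (F s) \<Longrightarrow> L2 Z
      \<Longrightarrow> (\<integral>\<omega>. Z \<omega> * (X t \<omega> - X s \<omega>) \<partial>M) = 0"
  using assms unfolding l2_martingale_def by auto

lemma martingale_imp_l2_martingale:
  assumes X: "martingale M F T X" and sq: "\<And>t. 0 \<le> t \<Longrightarrow> t < T \<Longrightarrow> integrable M (\<lambda>\<omega>. (X t \<omega>)\<^sup>2)"
  shows "l2_martingale X"
proof -
  have ad: "X t \<in> borel_measurable (F t)" if "0 \<le> t" "t < T" for t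
    using X that by (simp add: martingale_def adapted_def)
  have L2: "L2 (X t)" if "0 \<le> t" "t < T" for t
    using ad[OF that] sq[OF that] that by (auto simp: L2_def intro: measurable_F_imp_M)
  have "(\<integral>\<omega>. Z \<omega> * (X t \<omega> - X s \<omega>) \<partial>M) = 0"
    if st: "0 \<le> s" "s \<le> t" "t < T" and Z: "Z \<in> borel_measurable (F s)" "L2 Z" for s t Z
  proof -
    interpret S: sigma_finite_subalgebra M "F s"
      using st by (intro finite_measure_subalgebra_is_sigma_finite finite_measure_subalgebra.intro
        finite_measure_subalgebra_axioms.intro subalgebra_F) (auto intro: finite_measure_axioms)
    have i: "integrable M (\<lambda>\<omega>. Z \<omega> * X u \<omega>)" if "0 \<le> u" "u < T" for u
      using L2_mult_integrable[OF Z(2) L2[OF that]] .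
    have "AE \<omega> in M. real_cond_exp M (F s) (X t) \<omega> = X s \<omega>"
      using X st unfolding martingale_def by blast
    then have "(\<integral>\<omega>. Z \<omega> * real_cond_exp M (F s) (X t) \<omega> \<partial>M) = (\<integral>\<omega>. Z \<omega> * X s \<omega> \<partial>M)"
      using L2_measurable[OF Z(2)] L2_measurable[OF L2, of s] st
      by (intro integral_cong_AE) (auto intro!: borel_measurable_times borel_measurable_cond_exp2)
    moreover have "(\<integral>\<omega>. Z \<omega> * real_cond_exp M (F s) (X t) \<omega> \<partial>M) = (\<integral>\<omega>. Z \<omega> * X t \<omega> \<partial>M)"
      using st Z by (intro S.real_cond_exp_intg i L2_measurable[OF L2]) auto
    ultimately show ?thesis
      using i[of s] i[of t] st by (simp add: right_diff_distrib)
  qed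
  with ad L2 show ?thesis by (auto simp: l2_martingale_def)
qed

definition energy :: "(real \<Rightarrow> 'a \<Rightarrow> real) \<Rightarrow> 'a set \<Rightarrow> real \<Rightarrow> real \<Rightarrow> real" where
  "energy X A s u = (\<integral>\<omega>. indicator A \<omega> * (X u \<omega> - X s \<omega>)\<^sup>2 \<partial>M)"

lemma energy_nonneg [simp]: "0 \<le> energy X A s u"
  by (simp add: energy_def)

lemma energy_refl [simp]: "energy X A s s = 0"
  by (simp add: energy_def)

context
  fixes X assumes X: "l2_martingale X"
begin

lemma L2_increment: "0 \<le> s \<Longrightarrow> s < T \<Longrightarrow> 0 \<le> t \<Longrightarrow> t < T \<Longrightarrow> L2 (\<lambda>\<omega>. X t \<omega> - X s \<omega>)"
  by (intro L2_diff l2_martingaleD[OF X])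

lemma energy_integrable:
  assumes "A \<in> sets M" "0 \<le> s" "s < T" "0 \<le> t" "t < T"
  shows "integrable M (\<lambda>\<omega>. indicator A \<omega> * (X t \<omega> - X s \<omega>)\<^sup>2)"
  using L2_mult_integrable[OF L2_indicator[OF L2_increment assms(1)] L2_increment] assms
  by (simp add: power2_eq_square mult.assoc)

lemma energy_nn_integral:
  assumes "A \<in> sets M" "0 \<le> s" "s < T" "0 \<le> t" "t < T"
  shows "(\<integral>\<^sup>+\<omega>. indicator A \<omega> * ennreal ((X t \<omega> - X s \<omega>)\<^sup>2) \<partial>M) = ennreal (energy X A s t)"
proof -
  have "(\<integral>\<^sup>+\<omega>. indicator A \<omega> * ennreal ((X t \<omega> - X s \<omega>)\<^sup>2) \<partial>M)
      = (\<integral>\<^sup>+\<omega>. ennreal (indicator A \<omega> * (X t \<omega> - X s \<omega>)\<^sup>2) \<partial>M)"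
    by (intro nn_integral_cong) (auto simp: indicator_def)
  also have "\<dots> = ennreal (energy X A s t)"
    unfolding energy_def by (rule nn_integral_eq_integral[OF energy_integrable[OF assms]]) simp
  finally show ?thesis .
qed

lemma increment_orthogonal:
  assumes "0 \<le> s" "s \<le> b" "b \<le> c" "c < T" and A: "A \<in> sets (F b)"
  shows "(\<integral>\<omega>. indicator A \<omega> * (X b \<omega> - X s \<omega>) * (X c \<omega> - X b \<omega>) \<partial>M) = 0"
proof (rule l2_martingaleD(3)[OF X])
  have "X s \<in> borel_measurable (F b)" "X b \<in> borel_measurable (F b)"
    using assms by (auto intro!: measurable_F_mono[OF l2_martingaleD(1)[OF X]])
  then show "(\<lambda>\<omega>. indicator A \<omega> * (X b \<omega> - X s \<omega>)) \<in> borel_measurable (F b)"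
    using A by measurable
  show "L2 (\<lambda>\<omega>. indicator A \<omega> * (X b \<omega> - X s \<omega>))"
    using assms by (intro L2_indicator L2_increment sets_F_imp_M[OF A]) auto
qed (use assms in auto)

text \<open>Pythagoras. The event is required at the middle time \<open>b\<close> and not at
  \<open>s\<close>. This admits events of \<open>F a\<close> in the bound for the increment over
  [s,a], and net points that precede the conditioning time.\<close>

lemma energy_add:
  assumes "0 \<le> s" "s \<le> b" "b \<le> c" "c < T" and A: "A \<in> sets (F b)"
  shows "energy X A s c = energy X A s b + energy X A b c"
proof -
  have A': "A \<in> sets M" using assms by (intro sets_F_imp_M[OF A]) auto
  have i: "integrable M (\<lambda>\<omega>. indicator A \<omega> * (X b \<omega> - X s \<omega>) * (X c \<omega> - X b \<omega>))"
    using assms by (intro L2_mult_integrable L2_indicator A' L2_increment) auto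
  have "energy X A s c = (\<integral>\<omega>. (indicator A \<omega> * (X b \<omega> - X s \<omega>)\<^sup>2 + indicator A \<omega> * (X c \<omega> - X b \<omega>)\<^sup>2)
      + 2 * (indicator A \<omega> * (X b \<omega> - X s \<omega>) * (X c \<omega> - X b \<omega>)) \<partial>M)"
    unfolding energy_def by (intro Bochner_Integration.integral_cong) (auto simp: power2_eq_square algebra_simps)
  also have "\<dots> = energy X A s b + energy X A b c"
    using assms i increment_orthogonal[OF assms] A'
    by (simp add: energy_integrable energy_def)
  finally show ?thesis .
qed

lemma energy_mono:
  assumes "0 \<le> p" "p \<le> q" "q \<le> r" "r \<le> u" "u < T" and A: "A \<in> sets (F q)"
  shows "energy X A q r \<le> energy X A p u"
proof -
  have "energy X A p u = energy X A p q + energy X A q u"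
    using assms by (intro energy_add) auto
  moreover have "energy X A q u = energy X A q r + energy X A r u"
    using assms by (intro energy_add) (auto intro: sets_F_le)
  ultimately show ?thesis by simp
qed

text \<open>The part of the second increment that comes after \<open>u\<close> is orthogonal to the
  first factor.\<close>

lemma energy_cross:
  assumes "0 \<le> s" "s \<le> u" "u \<le> v" "v < T" and A: "A \<in> sets (F s)"
  shows "(\<integral>\<omega>. indicator A \<omega> * (X u \<omega> - X s \<omega>) * (X v \<omega> - X s \<omega>) \<partial>M) = energy X A s u"
proof -
  have A': "A \<in> sets M" "A \<in> sets (F u)" using assms by (auto intro: sets_F_imp_M[OF A] sets_F_le[OF A])
  have i: "integrable M (\<lambda>\<omega>. indicator A \<omega> * (X u \<omega> - X s \<omega>) * (X v \<omega> - X u \<omega>))"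
    using assms by (intro L2_mult_integrable L2_indicator A' L2_increment) auto
  have "(\<integral>\<omega>. indicator A \<omega> * (X u \<omega> - X s \<omega>) * (X v \<omega> - X s \<omega>) \<partial>M) =
     (\<integral>\<omega>. indicator A \<omega> * (X u \<omega> - X s \<omega>) * (X v \<omega> - X u \<omega>) + indicator A \<omega> * (X u \<omega> - X s \<omega>)\<^sup>2 \<partial>M)"
    by (intro Bochner_Integration.integral_cong) (auto simp: power2_eq_square algebra_simps)
  also have "\<dots> = energy X A s u"
    using assms i increment_orthogonal[of s u v A] A' by (simp add: energy_integrable energy_def)
  finally show ?thesis .
qed

end

end

section \<open>Joint measurability and Fubini's theorem for time integrals of the martingale\<close>

lemma cadlag_processD: "cadlag_process M T X \<Longrightarrow> \<omega> \<in> space M \<Longrightarrow> cadlag T (\<lambda>u. X u \<omega>)"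
  by (simp add: cadlag_process_def)

lemma borel_measurable_indicator_rl_density:
  "b < T \<Longrightarrow> (\<lambda>u. indicator {a..b} u * rl_density T \<alpha> u) \<in> borel_measurable borel"
  using borel_measurable_continuous_on_indicator[OF _ continuous_on_rl_density[of b T a \<alpha>]] by simp

lemma rl_density_le:
  assumes "b < T" obtains C where "0 \<le> C" "\<And>u. u \<in> {a..b} \<Longrightarrow> \<bar>rl_density T \<alpha> u\<bar> \<le> C"
proof -
  have "bounded (rl_density T \<alpha> ` {a..b})"
    using assms by (intro compact_imp_bounded compact_continuous_image continuous_on_rl_density) auto
  then obtain C where C: "\<forall>u\<in>{a..b}. \<bar>rl_density T \<alpha> u\<bar> \<le> C" by (auto simp: bounded_iff)
  then show thesis by (intro that[of "max C 0"]) (auto simp: le_max_iff_disj)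
qed

context stochastic_basis
begin

context
  fixes X assumes X: "l2_martingale X" and cad: "cadlag_process M T X"
begin

lemma jointly_measurable:
  assumes "0 \<le> t" "t < T" "t \<le> t'" "t' \<le> T"
  shows "(\<lambda>(\<omega>, u). X (clamp_time t u) \<omega>) \<in> borel_measurable (F t' \<Otimes>\<^sub>M lborel)"
    and "(\<lambda>(\<omega>, u). X (clamp_time t u) \<omega>) \<in> borel_measurable (M \<Otimes>\<^sub>M lborel)"
proof -
  have "X u \<in> borel_measurable (F t')" if "u \<in> {0..t}" for u
    using that assms by (auto intro!: measurable_F_mono[OF l2_martingaleD(1)[OF X]])
  then show "(\<lambda>(\<omega>, u). X (clamp_time t u) \<omega>) \<in> borel_measurable (F t' \<Otimes>\<^sub>M lborel)"
    using assms cadlag_processD[OF cad] by (intro cadlag_jointly_measurable[where T=T]) (simp_all add: space_F)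
  have "X u \<in> borel_measurable M" if "u \<in> {0..t}" for u
    using that assms by (auto intro!: measurable_F_imp_M[OF l2_martingaleD(1)[OF X]])
  then show "(\<lambda>(\<omega>, u). X (clamp_time t u) \<omega>) \<in> borel_measurable (M \<Otimes>\<^sub>M lborel)"
    using assms cadlag_processD[OF cad] by (intro cadlag_jointly_measurable[where T=T]) auto
qed

lemma rl_path_adapted:
  assumes t: "0 \<le> t" "t < T"
  shows "(\<lambda>\<omega>. rl_path T \<alpha> (\<lambda>u. X u \<omega>) t) \<in> borel_measurable (F t)"
proof -
  note [measurable] = borel_measurable_indicator_rl_density[OF t(2)] l2_martingaleD(1)[OF X t]
    jointly_measurable(1)[OF t order_refl less_imp_le[OF t(2)]]
  have "(\<lambda>(\<omega>, u). (indicator {0..t} u * rl_density T \<alpha> u) * X (clamp_time t u) \<omega>)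
      \<in> borel_measurable (F t \<Otimes>\<^sub>M lborel)"
    by measurable
  from lborel.borel_measurable_lebesgue_integral[OF this]
  have "(\<lambda>\<omega>. \<integral>u. (indicator {0..t} u * rl_density T \<alpha> u) * X (clamp_time t u) \<omega> \<partial>lborel) \<in> borel_measurable (F t)" .
  also have "(\<lambda>\<omega>. \<integral>u. (indicator {0..t} u * rl_density T \<alpha> u) * X (clamp_time t u) \<omega> \<partial>lborel)
      = (\<lambda>\<omega>. LINT u:{0..t}|lborel. rl_density T \<alpha> u * X u \<omega>)"
    unfolding set_lebesgue_integral_def
    by (intro ext Bochner_Integration.integral_cong) (auto simp: indicator_def clamp_time_id)
  finally show ?thesis unfolding rl_path_def by measurable
qed

text \<open>Absolute integrability comes from \<open>abs_mult_le_squares\<close>: the density is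
  bounded on [b,c] because c < T, and the energy up to \<open>u\<close> is at most the energy up to
  \<open>c\<close>.\<close>

lemma Fubini_increment:
  assumes Z: "L2 Z" and bc: "0 \<le> b" "b \<le> c" "c < T"
  shows "(\<integral>\<omega>. Z \<omega> * (LINT u:{b..c}|lborel. rl_density T \<alpha> u * (X u \<omega> - X b \<omega>)) \<partial>M)
    = (LINT u:{b..c}|lborel. rl_density T \<alpha> u * (\<integral>\<omega>. Z \<omega> * (X u \<omega> - X b \<omega>) \<partial>M))"
proof -
  interpret P: pair_sigma_finite M lborel
    by (intro pair_sigma_finite.intro sigma_finite_measure_axioms lborel.sigma_finite_measure_axioms)
  obtain C where C: "0 \<le> C" "\<And>u. u \<in> {b..c} \<Longrightarrow> \<bar>rl_density T \<alpha> u\<bar> \<le> C"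
    using rl_density_le[OF bc(3)] by metis
  have [simp]: "0 \<le> c" "b < T" using bc by auto
  define H where "H = (\<lambda>\<omega> u. (indicator {b..c} u * rl_density T \<alpha> u) * (Z \<omega> * (X (clamp_time c u) \<omega> - X b \<omega>)))"
  have Xb: "X b \<in> borel_measurable M" using bc by (intro L2_measurable[OF l2_martingaleD(2)[OF X]]) auto
  have Xc: "(\<lambda>(\<omega>, u). X (clamp_time c u) \<omega>) \<in> borel_measurable (M \<Otimes>\<^sub>M lborel)"
    using bc by (intro jointly_measurable(2)[of c T]) auto
  note [measurable] = borel_measurable_indicator_rl_density[OF bc(3)] L2_measurable[OF Z] Xb Xc
  have Hm: "case_prod H \<in> borel_measurable (M \<Otimes>\<^sub>M lborel)"
    unfolding H_def by measurable
  define K where "K = (\<integral>\<omega>. (Z \<omega>)\<^sup>2 \<partial>M) + energy X (space M) b c"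
  have K: "(\<integral>\<^sup>+\<omega>. ennreal (norm (H \<omega> u)) \<partial>M) \<le> ennreal (C * K) * indicator {b..c} u" for u
  proof (cases "u \<in> {b..c}")
    case True
    have iZ: "integrable M (\<lambda>\<omega>. (Z \<omega>)\<^sup>2)" using Z by (simp add: L2_def)
    have iX: "integrable M (\<lambda>\<omega>. indicator (space M) \<omega> * (X u \<omega> - X b \<omega>)\<^sup>2)"
      using True bc by (intro energy_integrable[OF X]) auto
    have "(\<integral>\<^sup>+\<omega>. ennreal (norm (H \<omega> u)) \<partial>M)
        \<le> (\<integral>\<^sup>+\<omega>. ennreal (C * ((Z \<omega>)\<^sup>2 + indicator (space M) \<omega> * (X u \<omega> - X b \<omega>)\<^sup>2)) \<partial>M)"
    proof (intro nn_integral_mono ennreal_leI)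
      fix \<omega> assume "\<omega> \<in> space M"
      have "\<bar>rl_density T \<alpha> u\<bar> * \<bar>Z \<omega> * (X u \<omega> - X b \<omega>)\<bar> \<le> C * ((Z \<omega>)\<^sup>2 + (X u \<omega> - X b \<omega>)\<^sup>2)"
        using C(2)[OF True] C(1) by (intro mult_mono abs_mult_le_squares) auto
      then show "norm (H \<omega> u) \<le> C * ((Z \<omega>)\<^sup>2 + indicator (space M) \<omega> * (X u \<omega> - X b \<omega>)\<^sup>2)"
        using True \<open>\<omega> \<in> space M\<close> bc by (simp add: H_def clamp_time_id abs_mult)
    qed
    also have "\<dots> = ennreal (\<integral>\<omega>. C * ((Z \<omega>)\<^sup>2 + indicator (space M) \<omega> * (X u \<omega> - X b \<omega>)\<^sup>2) \<partial>M)"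
      using C(1) iZ iX by (intro nn_integral_eq_integral integrable_mult_right Bochner_Integration.integrable_add) auto
    also have "\<dots> = ennreal (C * ((\<integral>\<omega>. (Z \<omega>)\<^sup>2 \<partial>M) + energy X (space M) b u))"
      using iZ iX by (simp add: energy_def)
    also have "\<dots> \<le> ennreal (C * K)"
    proof -
      have "energy X (space M) b u \<le> energy X (space M) b c"
        using True bc by (intro energy_mono[OF X]) (auto simp: space_F[of b, symmetric])
      then show ?thesis using C(1) by (intro ennreal_leI mult_left_mono) (auto simp: K_def)
    qed
    finally show ?thesis using True by simp
  qed (simp add: H_def)
  have i: "integrable (M \<Otimes>\<^sub>M lborel) (case_prod H)"
  proof (rule integrableI_bounded[OF Hm])
    have "(\<integral>\<^sup>+x. ennreal (norm (case_prod H x)) \<partial>(M \<Otimes>\<^sub>M lborel))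
        = (\<integral>\<^sup>+u. (\<integral>\<^sup>+\<omega>. ennreal (norm (H \<omega> u)) \<partial>M) \<partial>lborel)"
      using Hm by (subst P.nn_integral_snd[symmetric]) auto
    also have "\<dots> \<le> (\<integral>\<^sup>+u. ennreal (C * K) * indicator {b..c} u \<partial>lborel)"
      by (intro nn_integral_mono K)
    also have "\<dots> < \<infinity>" by (subst nn_integral_cmult_indicator) (auto simp: bc ennreal_mult_less_top)
    finally show "(\<integral>\<^sup>+x. ennreal (norm (case_prod H x)) \<partial>(M \<Otimes>\<^sub>M lborel)) < \<infinity>" .
  qed
  have "(\<integral>\<omega>. Z \<omega> * (LINT u:{b..c}|lborel. rl_density T \<alpha> u * (X u \<omega> - X b \<omega>)) \<partial>M) = (\<integral>\<omega>. (\<integral>u. H \<omega> u \<partial>lborel) \<partial>M)"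
    unfolding set_lebesgue_integral_def integral_mult_right_zero[symmetric] H_def
    using bc by (intro Bochner_Integration.integral_cong refl) (auto simp: indicator_def clamp_time_id)
  also have "\<dots> = (\<integral>u. (\<integral>\<omega>. H \<omega> u \<partial>M) \<partial>lborel)"
    by (rule P.Fubini_integral[OF i, symmetric])
  also have "\<dots> = (LINT u:{b..c}|lborel. rl_density T \<alpha> u * (\<integral>\<omega>. Z \<omega> * (X u \<omega> - X b \<omega>) \<partial>M))"
    unfolding set_lebesgue_integral_def H_def
    using bc by (intro Bochner_Integration.integral_cong refl) (auto simp: indicator_def clamp_time_id)
  finally show ?thesis .
qed

end

end

text \<open>Jensen's inequality for the finite measure with an atom of mass \<open>w\<close> and density \<open>k\<close>, proved by
  integrating the squared distance to the mean.\<close>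
lemma weighted_square_le:
  fixes k f :: "real \<Rightarrow> real"
  assumes w: "0 < w" and K: "0 \<le> K" and k: "\<And>u. 0 \<le> k u"
    and ik: "set_integrable lborel S k" "(LINT u:S|lborel. k u) = K"
    and ikf: "set_integrable lborel S (\<lambda>u. k u * f u)"
    and ikff: "set_integrable lborel S (\<lambda>u. k u * (f u)\<^sup>2)"
  shows "(w * x + (LINT u:S|lborel. k u * f u))\<^sup>2 \<le> (w + K) * (w * x\<^sup>2 + (LINT u:S|lborel. k u * (f u)\<^sup>2))"
proof -
  define J where "J = (LINT u:S|lborel. k u * f u)"
  define Q where "Q = (LINT u:S|lborel. k u * (f u)\<^sup>2)"
  define m where "m = (w * x + J) / (w + K)"
  have "0 \<le> (LINT u:S|lborel. k u * (f u - m)\<^sup>2)"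
    unfolding set_lebesgue_integral_def using k by (intro integral_nonneg_AE AE_I2) (auto simp: indicator_def)
  also have "(LINT u:S|lborel. k u * (f u - m)\<^sup>2)
      = (LINT u:S|lborel. (k u * (f u)\<^sup>2 - (2 * m) * (k u * f u)) + m\<^sup>2 * k u)"
    unfolding set_lebesgue_integral_def
    by (intro Bochner_Integration.integral_cong refl) (simp add: power2_eq_square algebra_simps)
  also have "\<dots> = (LINT u:S|lborel. k u * (f u)\<^sup>2 - (2 * m) * (k u * f u)) + (LINT u:S|lborel. m\<^sup>2 * k u)"
    using ik ikf ikff by (intro set_integral_add set_integral_diff set_integrable_mult_right)
  also have "(LINT u:S|lborel. k u * (f u)\<^sup>2 - (2 * m) * (k u * f u)) = Q - (LINT u:S|lborel. (2 * m) * (k u * f u))"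
    unfolding Q_def using ik ikf ikff by (intro set_integral_diff set_integrable_mult_right)
  also have "Q - (LINT u:S|lborel. (2 * m) * (k u * f u)) + (LINT u:S|lborel. m\<^sup>2 * k u) = Q - 2 * m * J + m\<^sup>2 * K"
    using ik by (simp add: J_def)
  finally have "0 \<le> Q - 2 * m * J + m\<^sup>2 * K" .
  moreover have "0 \<le> w * (x - m)\<^sup>2" using w by simp
  ultimately have "0 \<le> w * x\<^sup>2 + Q - 2 * m * (w * x + J) + m\<^sup>2 * (w + K)"
    by (simp add: power2_eq_square algebra_simps)
  then have "0 \<le> (w + K) * (w * x\<^sup>2 + Q - 2 * m * (w * x + J) + m\<^sup>2 * (w + K))"
    using w K by simp
  also have "\<dots> = (w + K) * (w * x\<^sup>2 + Q) - 2 * (m * (w + K)) * (w * x + J) + (m * (w + K))\<^sup>2"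
    by (simp add: power2_eq_square algebra_simps)
  also have "m * (w + K) = w * x + J" using w K by (simp add: m_def)
  also have "(w + K) * (w * x\<^sup>2 + Q) - 2 * (w * x + J) * (w * x + J) + (w * x + J)\<^sup>2
      = (w + K) * (w * x\<^sup>2 + Q) - (w * x + J)\<^sup>2"
    by (simp add: power2_eq_square algebra_simps)
  finally show ?thesis by (simp add: J_def Q_def)
qed

lemma cadlag_compose:
  assumes f: "cadlag T f" and g: "\<And>x. isCont g x"
  shows "cadlag T (\<lambda>u. g (f u))"
  unfolding cadlag_def
proof (intro conjI ballI)
  fix t assume t: "t \<in> {0<..<T}"
  then obtain l where "(f \<longlongrightarrow> l) (at_left t)" using f unfolding cadlag_def by blast
  then show "\<exists>l. ((\<lambda>u. g (f u)) \<longlongrightarrow> l) (at_left t)"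
    using isCont_tendsto_compose[OF g] by blast
qed (use f in \<open>auto simp: cadlag_def intro: isCont_tendsto_compose[OF g]\<close>)

section \<open>Energy of the Riemann-Liouville transform\<close>

context stochastic_basis
begin

context
  fixes X assumes X: "l2_martingale X" and cad: "cadlag_process M T X"
begin

text \<open>This turns time integrals of squared increments into time integrals of energies. The
  factor \<open>h\<close> is the density of the transform in \<open>R_increment_square_le\<close>
  and 1 in the square error.\<close>

lemma Tonelli_energy:
  assumes [measurable]: "S \<in> sets borel" and S: "S \<subseteq> {0..c}" and c: "0 \<le> c" "c < T"
    and p: "0 \<le> p" "p < T" and A [measurable]: "A \<in> sets M"
    and h: "(\<lambda>u. indicator S u * h u) \<in> borel_measurable borel"
  shows "(\<integral>\<^sup>+\<omega>. indicator A \<omega> * (\<integral>\<^sup>+u. indicator S u * h u * ennreal ((X u \<omega> - X p \<omega>)\<^sup>2) \<partial>lborel) \<partial>M)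
    = (\<integral>\<^sup>+u. indicator S u * h u * ennreal (energy X A p u) \<partial>lborel)"
proof -
  interpret P: pair_sigma_finite M lborel
    by (intro pair_sigma_finite.intro sigma_finite_measure_axioms lborel.sigma_finite_measure_axioms)
  have Xp [measurable]: "X p \<in> borel_measurable M"
    using p by (intro L2_measurable[OF l2_martingaleD(2)[OF X]]) auto
  have Xc [measurable]: "(\<lambda>(\<omega>, u). X (clamp_time c u) \<omega>) \<in> borel_measurable (M \<Otimes>\<^sub>M lborel)"
    using c by (intro jointly_measurable(2)[OF X cad, of c T]) auto
  note [measurable] = h
  define H where "H = (\<lambda>\<omega> u. indicator A \<omega> * ((indicator S u * h u) * ennreal ((X (clamp_time c u) \<omega> - X p \<omega>)\<^sup>2)))"
  have Hm: "case_prod H \<in> borel_measurable (M \<Otimes>\<^sub>M lborel)" unfolding H_def by measurable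
  have H_eq: "H \<omega> u = indicator A \<omega> * (indicator S u * h u * ennreal ((X u \<omega> - X p \<omega>)\<^sup>2))" for \<omega> u
    using S by (cases "u \<in> S") (auto simp: H_def clamp_time_id subset_iff)
  have "(\<integral>\<^sup>+\<omega>. indicator A \<omega> * (\<integral>\<^sup>+u. indicator S u * h u * ennreal ((X u \<omega> - X p \<omega>)\<^sup>2) \<partial>lborel) \<partial>M)
      = (\<integral>\<^sup>+\<omega>. (\<integral>\<^sup>+u. H \<omega> u \<partial>lborel) \<partial>M)"
    unfolding H_eq by (intro nn_integral_cong) (auto simp: indicator_def)
  also have "\<dots> = (\<integral>\<^sup>+u. (\<integral>\<^sup>+\<omega>. H \<omega> u \<partial>M) \<partial>lborel)"
    by (rule P.Fubini'[OF Hm, symmetric])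
  also have "\<dots> = (\<integral>\<^sup>+u. indicator S u * h u * ennreal (energy X A p u) \<partial>lborel)"
  proof (intro nn_integral_cong)
    fix u
    show "(\<integral>\<^sup>+\<omega>. H \<omega> u \<partial>M) = indicator S u * h u * ennreal (energy X A p u)"
    proof (cases "u \<in> S")
      case True
      then have u: "0 \<le> u" "u < T" using S c by auto
      have [measurable]: "X u \<in> borel_measurable M"
        using u by (intro L2_measurable[OF l2_martingaleD(2)[OF X]])
      have "(\<integral>\<^sup>+\<omega>. H \<omega> u \<partial>M) = (\<integral>\<^sup>+\<omega>. h u * (indicator A \<omega> * ennreal ((X u \<omega> - X p \<omega>)\<^sup>2)) \<partial>M)"
        using True by (intro nn_integral_cong) (simp add: H_eq mult_ac)
      also have "\<dots> = h u * (\<integral>\<^sup>+\<omega>. indicator A \<omega> * ennreal ((X u \<omega> - X p \<omega>)\<^sup>2) \<partial>M)"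
        by (rule nn_integral_cmult) measurable
      finally show ?thesis
        using True u p by (simp add: energy_nn_integral[OF X])
    qed (simp add: H_eq)
  qed
  finally show ?thesis .
qed

context
  fixes \<alpha> :: real assumes \<alpha>: "0 \<le> \<alpha>"
begin

private abbreviation (input) "R t \<omega> \<equiv> rl_path T \<alpha> (\<lambda>u. X u \<omega>) t"
private abbreviation (input) "J b c \<omega> \<equiv> (LINT u:{b..c}|lborel. rl_density T \<alpha> u * (X u \<omega> - X b \<omega>))"

lemma R_increment:
  assumes "0 \<le> b" "b \<le> c" "c < T" "\<omega> \<in> space M"
  shows "R c \<omega> - R b \<omega> = rl_weight T \<alpha> c * (X c \<omega> - X b \<omega>) + J b c \<omega>"
  using assms cadlag_processD[OF cad] by (intro rl_path_increment)

lemma rl_weight_mono: "b \<le> c \<Longrightarrow> c < T \<Longrightarrow> rl_weight T \<alpha> c \<le> rl_weight T \<alpha> b"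
  unfolding rl_weight_def using \<alpha> T_pos by (intro divide_right_mono powr_mono2) auto

text \<open>Jensen's inequality on the measure of total mass w(b) from
  \<open>rl_path_increment\<close> gives one factor w(b). All energies up to \<open>u\<close> are at
  most the energy up to \<open>c\<close>, so integrating them over that measure gives the second
  factor. The left side is a nonnegative integral because square integrability of the transform is
  deduced from this estimate.\<close>

lemma R_increment_square_le:
  assumes bc: "0 \<le> b" "b \<le> c" "c < T" and A: "A \<in> sets (F b)"
  shows "(\<integral>\<^sup>+\<omega>. indicator A \<omega> * ennreal ((R c \<omega> - R b \<omega>)\<^sup>2) \<partial>M)
    \<le> ennreal ((rl_weight T \<alpha> b)\<^sup>2 * energy X A b c)"
proof -
  let ?wb = "rl_weight T \<alpha> b" and ?wc = "rl_weight T \<alpha> c" and ?k = "rl_density T \<alpha>"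
  have w: "0 < ?wc" "?wc \<le> ?wb" using bc T_pos rl_weight_mono by (auto intro: rl_weight_pos)
  have A' [measurable]: "A \<in> sets M" using bc by (intro sets_F_imp_M[OF A]) auto
  have [measurable]: "X c \<in> borel_measurable M" "X b \<in> borel_measurable M"
    using bc by (auto intro!: L2_measurable[OF l2_martingaleD(2)[OF X]])
  define Q where "Q = (\<lambda>\<omega>. \<integral>\<^sup>+u. indicator {b..c} u * ennreal (?k u) * ennreal ((X u \<omega> - X b \<omega>)\<^sup>2) \<partial>lborel)"
  have hm: "(\<lambda>u. indicator {b..c} u * ennreal (?k u)) \<in> borel_measurable borel"
  proof -
    have "(\<lambda>u. ennreal (indicator {b..c} u * ?k u)) \<in> borel_measurable borel"
      by (rule measurable_compose[OF borel_measurable_indicator_rl_density[OF bc(3)] measurable_ennreal])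
    also have "(\<lambda>u. ennreal (indicator {b..c} u * ?k u)) = (\<lambda>u. indicator {b..c} u * ennreal (?k u))"
      by (auto simp: indicator_def)
    finally show ?thesis .
  qed
  have ptw: "ennreal ((R c \<omega> - R b \<omega>)\<^sup>2)
      \<le> ennreal ?wb * (ennreal (?wc * (X c \<omega> - X b \<omega>)\<^sup>2) + Q \<omega>)" if \<omega>: "\<omega> \<in> space M" for \<omega>
  proof -
    have cX: "cadlag T (\<lambda>u. X u \<omega> - X b \<omega>)" "cadlag T (\<lambda>u. (X u \<omega> - X b \<omega>)\<^sup>2)"
      by (rule cadlag_compose[OF cadlag_processD[OF cad \<omega>]]; intro continuous_intros)+
    have i: "set_integrable lborel {b..c} ?k"
        "set_integrable lborel {b..c} (\<lambda>u. ?k u * (X u \<omega> - X b \<omega>))"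
        "set_integrable lborel {b..c} (\<lambda>u. ?k u * (X u \<omega> - X b \<omega>)\<^sup>2)"
      using bc by (intro borel_integrable_atLeastAtMost' set_integrable_cadlag[OF cX(1)]
        set_integrable_cadlag[OF cX(2)] continuous_on_rl_density; simp)+
    have "(?wc * (X c \<omega> - X b \<omega>) + J b c \<omega>)\<^sup>2 \<le> (?wc + (?wb - ?wc)) *
       (?wc * (X c \<omega> - X b \<omega>)\<^sup>2 + (LINT u:{b..c}|lborel. ?k u * (X u \<omega> - X b \<omega>)\<^sup>2))"
      using w i bc \<alpha> by (intro weighted_square_le set_integral_rl_density rl_density_nonneg) auto
    then have "(R c \<omega> - R b \<omega>)\<^sup>2 \<le> ?wb *
       (?wc * (X c \<omega> - X b \<omega>)\<^sup>2 + (LINT u:{b..c}|lborel. ?k u * (X u \<omega> - X b \<omega>)\<^sup>2))"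
      using bc \<omega> by (simp add: R_increment)
    moreover have "Q \<omega> = ennreal (LINT u:{b..c}|lborel. ?k u * (X u \<omega> - X b \<omega>)\<^sup>2)"
      unfolding Q_def set_lebesgue_integral_def
      using i(3) \<alpha> unfolding set_integrable_def
      by (subst nn_integral_eq_integral[symmetric])
         (auto intro!: nn_integral_cong simp: rl_density_nonneg indicator_def ennreal_mult)
    moreover have "0 \<le> (LINT u:{b..c}|lborel. ?k u * (X u \<omega> - X b \<omega>)\<^sup>2)"
      unfolding set_lebesgue_integral_def using \<alpha>
      by (intro integral_nonneg_AE AE_I2) (auto simp: indicator_def rl_density_nonneg)
    ultimately show ?thesis
      using w by (simp add: ennreal_mult[symmetric] ennreal_plus[symmetric] ennreal_leI del: ennreal_plus)
  qed
  have Qm: "(\<integral>\<^sup>+\<omega>. indicator A \<omega> * Q \<omega> \<partial>M) = (\<integral>\<^sup>+u. indicator {b..c} u * ennreal (?k u) * ennreal (energy X A b u) \<partial>lborel)"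
    unfolding Q_def using bc by (intro Tonelli_energy[of _ c] hm) auto
  also have "\<dots> \<le> (\<integral>\<^sup>+u. ennreal (energy X A b c) * ennreal (indicator {b..c} u * ?k u) \<partial>lborel)"
  proof (intro nn_integral_mono)
    fix u
    show "indicator {b..c} u * ennreal (?k u) * ennreal (energy X A b u)
        \<le> ennreal (energy X A b c) * ennreal (indicator {b..c} u * ?k u)"
    proof (cases "u \<in> {b..c}")
      case True
      then have "energy X A b u \<le> energy X A b c" using bc A by (intro energy_mono[OF X]) auto
      then show ?thesis using True by (auto simp: mult.commute intro!: mult_left_mono ennreal_leI)
    qed simp
  qed
  also have "\<dots> = ennreal (energy X A b c) * (\<integral>\<^sup>+u. ennreal (indicator {b..c} u * ?k u) \<partial>lborel)"
    using measurable_compose[OF borel_measurable_indicator_rl_density[OF bc(3)] measurable_ennreal]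
    by (intro nn_integral_cmult) simp
  also have "(\<integral>\<^sup>+u. ennreal (indicator {b..c} u * ?k u) \<partial>lborel) = ennreal (?wb - ?wc)"
  proof -
    have "set_integrable lborel {b..c} ?k"
      using bc by (auto intro!: borel_integrable_atLeastAtMost' continuous_on_rl_density)
    then have "(\<integral>\<^sup>+u. ennreal (indicator {b..c} u * ?k u) \<partial>lborel) = ennreal (LINT u:{b..c}|lborel. ?k u)"
      unfolding set_integrable_def set_lebesgue_integral_def real_scaleR_def
      using \<alpha> by (intro nn_integral_eq_integral) (auto simp: rl_density_nonneg indicator_def)
    then show ?thesis using bc by (simp add: set_integral_rl_density)
  qed
  finally have Q: "(\<integral>\<^sup>+\<omega>. indicator A \<omega> * Q \<omega> \<partial>M) \<le> ennreal (energy X A b c * (?wb - ?wc))"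
    using w by (simp add: ennreal_mult)
  have [measurable]: "Q \<in> borel_measurable M"
  proof -
    have Xc [measurable]: "(\<lambda>(\<omega>, u). X (clamp_time c u) \<omega>) \<in> borel_measurable (M \<Otimes>\<^sub>M lborel)"
      using bc by (intro jointly_measurable(2)[OF X cad, of c T]) auto
    note [measurable] = hm
    have "(\<lambda>(\<omega>, u). indicator {b..c} u * ennreal (?k u) * ennreal ((X (clamp_time c u) \<omega> - X b \<omega>)\<^sup>2))
        \<in> borel_measurable (M \<Otimes>\<^sub>M lborel)" by measurable
    from lborel.borel_measurable_nn_integral_fst[OF this]
    have "(\<lambda>\<omega>. \<integral>\<^sup>+u. indicator {b..c} u * ennreal (?k u) * ennreal ((X (clamp_time c u) \<omega> - X b \<omega>)\<^sup>2) \<partial>lborel)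
        \<in> borel_measurable M" by simp
    also have "(\<lambda>\<omega>. \<integral>\<^sup>+u. indicator {b..c} u * ennreal (?k u) * ennreal ((X (clamp_time c u) \<omega> - X b \<omega>)\<^sup>2) \<partial>lborel) = Q"
      unfolding Q_def using bc by (intro ext nn_integral_cong) (auto simp: indicator_def clamp_time_id)
    finally show ?thesis .
  qed
  have "(\<integral>\<^sup>+\<omega>. indicator A \<omega> * ennreal ((R c \<omega> - R b \<omega>)\<^sup>2) \<partial>M)
      \<le> (\<integral>\<^sup>+\<omega>. ennreal ?wb * (ennreal ?wc * (indicator A \<omega> * ennreal ((X c \<omega> - X b \<omega>)\<^sup>2)) + indicator A \<omega> * Q \<omega>) \<partial>M)"
    using ptw w by (intro nn_integral_mono) (auto simp: indicator_def ennreal_mult mult.assoc)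
  also have "\<dots> = ennreal ?wb * (ennreal ?wc * (\<integral>\<^sup>+\<omega>. indicator A \<omega> * ennreal ((X c \<omega> - X b \<omega>)\<^sup>2) \<partial>M)
      + (\<integral>\<^sup>+\<omega>. indicator A \<omega> * Q \<omega> \<partial>M))"
    by (subst nn_integral_cmult, measurable, subst nn_integral_add, measurable, subst nn_integral_cmult, measurable)
  also have "\<dots> \<le> ennreal ?wb * (ennreal ?wc * ennreal (energy X A b c) + ennreal (energy X A b c * (?wb - ?wc)))"
    using bc by (intro mult_left_mono add_mono Q) (auto simp: energy_nn_integral[OF X])
  also have "\<dots> = ennreal (?wb * (?wc * energy X A b c + energy X A b c * (?wb - ?wc)))"
    using w by (simp add: ennreal_mult[symmetric] ennreal_plus[symmetric] del: ennreal_plus)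
  also have "?wb * (?wc * energy X A b c + energy X A b c * (?wb - ?wc)) = ?wb\<^sup>2 * energy X A b c"
    by (simp add: power2_eq_square algebra_simps)
  finally show ?thesis .
qed

lemma R_measurable: "0 \<le> t \<Longrightarrow> t < T \<Longrightarrow> R t \<in> borel_measurable (F t)"
  by (rule rl_path_adapted[OF X cad])

lemma R_increment_L2:
  assumes bc: "0 \<le> b" "b \<le> c" "c < T"
  shows "L2 (\<lambda>\<omega>. R c \<omega> - R b \<omega>)"
  unfolding L2_def
proof
  have "R c \<in> borel_measurable M" "R b \<in> borel_measurable M"
    using bc by (auto intro!: measurable_F_imp_M[OF R_measurable])
  then show m [measurable]: "(\<lambda>\<omega>. R c \<omega> - R b \<omega>) \<in> borel_measurable M" by measurable
  have "(\<integral>\<^sup>+\<omega>. ennreal (norm ((R c \<omega> - R b \<omega>)\<^sup>2)) \<partial>M)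
      = (\<integral>\<^sup>+\<omega>. indicator (space M) \<omega> * ennreal ((R c \<omega> - R b \<omega>)\<^sup>2) \<partial>M)"
    by (intro nn_integral_cong) simp
  also have "\<dots> \<le> ennreal ((rl_weight T \<alpha> b)\<^sup>2 * energy X (space M) b c)"
    using bc by (intro R_increment_square_le) (auto simp: space_F[of b, symmetric])
  finally show "integrable M (\<lambda>\<omega>. (R c \<omega> - R b \<omega>)\<^sup>2)"
    by (intro integrableI_bounded) (auto intro: le_less_trans)
qed

text \<open>Against a test variable known at \<open>s\<close>, the integral part of the increment
  vanishes by Fubini's theorem, since the increment of \<open>X\<close> over [s,u] is orthogonal to
  it for every \<open>u\<close>.\<close>

lemma l2_martingale_R: "l2_martingale (\<lambda>t \<omega>. R t \<omega>)"
proof -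
  have R0: "R 0 \<omega> = X 0 \<omega>" for \<omega> by (rule rl_path_0[OF T_pos])
  have L2R: "L2 (\<lambda>\<omega>. R t \<omega>)" if "0 \<le> t" "t < T" for t
    using L2_add[OF R_increment_L2[of 0 t] l2_martingaleD(2)[OF X, of 0]] that R0 T_pos by simp
  have "(\<integral>\<omega>. Z \<omega> * (R t \<omega> - R s \<omega>) \<partial>M) = 0"
    if st: "0 \<le> s" "s \<le> t" "t < T" and Z: "Z \<in> borel_measurable (F s)" "L2 Z" for s t Z
  proof -
    have i: "integrable M (\<lambda>\<omega>. Z \<omega> * (R t \<omega> - R s \<omega>))" "integrable M (\<lambda>\<omega>. Z \<omega> * (X t \<omega> - X s \<omega>))"
      using st Z by (auto intro!: L2_mult_integrable R_increment_L2 L2_increment[OF X])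
    have "(\<integral>\<omega>. Z \<omega> * (X u \<omega> - X s \<omega>) \<partial>M) = 0" if "u \<in> {s..t}" for u
      using that st Z by (intro l2_martingaleD(3)[OF X]) auto
    then have "(\<integral>\<omega>. Z \<omega> * J s t \<omega> \<partial>M) = (LINT u:{s..t}|lborel. 0)"
      unfolding Fubini_increment[OF X cad Z(2) st] by (intro set_lebesgue_integral_cong) auto
    then have "(\<integral>\<omega>. Z \<omega> * J s t \<omega> \<partial>M) = 0" by simp
    moreover have "(\<integral>\<omega>. Z \<omega> * J s t \<omega> \<partial>M)
        = (\<integral>\<omega>. Z \<omega> * (R t \<omega> - R s \<omega>) - rl_weight T \<alpha> t * (Z \<omega> * (X t \<omega> - X s \<omega>)) \<partial>M)"
      by (intro Bochner_Integration.integral_cong refl) (simp add: R_increment[OF st] algebra_simps)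
    ultimately show ?thesis
      using i l2_martingaleD(3)[OF X st Z] by simp
  qed
  then show ?thesis using L2R R_measurable by (auto simp: l2_martingale_def)
qed

lemma energy_R_le:
  assumes bc: "0 \<le> b" "b \<le> c" "c < T" and A: "A \<in> sets (F b)"
  shows "energy (\<lambda>t \<omega>. R t \<omega>) A b c \<le> (rl_weight T \<alpha> b)\<^sup>2 * energy X A b c"
proof -
  have "A \<in> sets M" using bc by (intro sets_F_imp_M[OF A]) auto
  then show ?thesis
    using R_increment_square_le[OF assms] energy_nn_integral[OF l2_martingale_R, of A b c] bc by simp
qed

text \<open>The integral part of the increment of the transform is nonnegatively correlated with the
  increment of \<open>X\<close>, because by \<open>energy_cross\<close> the correlation is an
  integral of energies. So the mixed term is at least w(c) times the energy of \<open>X\<close>.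
  Expanding the square of the increment of the transform minus w(c) times that of \<open>X\<close>
  then leaves 2 w(c)^2 - w(c)^2 = w(c)^2.\<close>

lemma energy_R_ge:
  assumes bc: "0 \<le> b" "b \<le> c" "c < T" and A: "A \<in> sets (F b)"
  shows "(rl_weight T \<alpha> c)\<^sup>2 * energy X A b c \<le> energy (\<lambda>t \<omega>. R t \<omega>) A b c"
proof -
  let ?w = "rl_weight T \<alpha> c"
  have A': "A \<in> sets M" using bc by (intro sets_F_imp_M[OF A]) auto
  define Z where "Z = (\<lambda>\<omega>. indicator A \<omega> * (X c \<omega> - X b \<omega>))"
  have Z: "L2 Z" unfolding Z_def using bc A' by (intro L2_indicator L2_increment[OF X]) auto
  have iR: "integrable M (\<lambda>\<omega>. Z \<omega> * (R c \<omega> - R b \<omega>))" and iX: "integrable M (\<lambda>\<omega>. Z \<omega> * (X c \<omega> - X b \<omega>))"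
    using bc Z by (auto intro!: L2_mult_integrable R_increment_L2 L2_increment[OF X])
  have "(\<integral>\<omega>. Z \<omega> * J b c \<omega> \<partial>M) = (LINT u:{b..c}|lborel. rl_density T \<alpha> u * energy X A b u)"
    unfolding Fubini_increment[OF X cad Z bc]
  proof (intro set_lebesgue_integral_cong allI impI)
    fix u assume u: "u \<in> {b..c}"
    have "(\<integral>\<omega>. Z \<omega> * (X u \<omega> - X b \<omega>) \<partial>M) = (\<integral>\<omega>. indicator A \<omega> * (X u \<omega> - X b \<omega>) * (X c \<omega> - X b \<omega>) \<partial>M)"
      by (simp add: Z_def mult_ac)
    also have "\<dots> = energy X A b u" using u bc A by (intro energy_cross[OF X]) auto
    finally show "rl_density T \<alpha> u * (\<integral>\<omega>. Z \<omega> * (X u \<omega> - X b \<omega>) \<partial>M) = rl_density T \<alpha> u * energy X A b u" by simp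
  qed simp
  also have "\<dots> \<ge> 0"
    unfolding set_lebesgue_integral_def using \<alpha>
    by (intro integral_nonneg_AE AE_I2) (auto simp: indicator_def rl_density_nonneg)
  finally have J: "0 \<le> (\<integral>\<omega>. Z \<omega> * J b c \<omega> \<partial>M)" .
  have "(\<integral>\<omega>. Z \<omega> * J b c \<omega> \<partial>M) = (\<integral>\<omega>. Z \<omega> * (R c \<omega> - R b \<omega>) - ?w * (Z \<omega> * (X c \<omega> - X b \<omega>)) \<partial>M)"
    by (intro Bochner_Integration.integral_cong refl) (simp add: R_increment[OF bc] algebra_simps)
  then have ZR: "?w * energy X A b c \<le> (\<integral>\<omega>. Z \<omega> * (R c \<omega> - R b \<omega>) \<partial>M)"
    using J iR iX by (simp add: Z_def energy_def power2_eq_square mult.assoc)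
  have iRR: "integrable M (\<lambda>\<omega>. indicator A \<omega> * (R c \<omega> - R b \<omega>)\<^sup>2)" and iXX: "integrable M (\<lambda>\<omega>. indicator A \<omega> * (X c \<omega> - X b \<omega>)\<^sup>2)"
    using bc A' by (auto intro!: energy_integrable[OF l2_martingale_R] energy_integrable[OF X])
  have "0 \<le> (\<integral>\<omega>. indicator A \<omega> * ((R c \<omega> - R b \<omega>) - ?w * (X c \<omega> - X b \<omega>))\<^sup>2 \<partial>M)" by simp
  also have "\<dots> = (\<integral>\<omega>. (indicator A \<omega> * (R c \<omega> - R b \<omega>)\<^sup>2 - (2 * ?w) * (Z \<omega> * (R c \<omega> - R b \<omega>)))
      + ?w\<^sup>2 * (indicator A \<omega> * (X c \<omega> - X b \<omega>)\<^sup>2) \<partial>M)"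
    by (intro Bochner_Integration.integral_cong refl) (simp add: Z_def power2_eq_square algebra_simps)
  also have "\<dots> = energy (\<lambda>t \<omega>. R t \<omega>) A b c - (2 * ?w) * (\<integral>\<omega>. Z \<omega> * (R c \<omega> - R b \<omega>) \<partial>M) + ?w\<^sup>2 * energy X A b c"
    using iR iRR iXX by (simp add: energy_def)
  finally have "(2 * ?w) * (\<integral>\<omega>. Z \<omega> * (R c \<omega> - R b \<omega>) \<partial>M) - ?w\<^sup>2 * energy X A b c \<le> energy (\<lambda>t \<omega>. R t \<omega>) A b c"
    by simp
  moreover have "(2 * ?w) * (?w * energy X A b c) \<le> (2 * ?w) * (\<integral>\<omega>. Z \<omega> * (R c \<omega> - R b \<omega>) \<partial>M)"
    using ZR bc T_pos rl_weight_pos[of T c \<alpha>] by (intro mult_left_mono) auto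
  ultimately show ?thesis by (simp add: power2_eq_square)
qed

end

end

section \<open>Stopping times versus deterministic times\<close>

lemma sigma_finite_subalgebraI: "subalgebra M G \<Longrightarrow> sigma_finite_subalgebra M G"
  by (intro finite_measure_subalgebra_is_sigma_finite finite_measure_subalgebra.intro
      finite_measure_subalgebra_axioms.intro finite_measure_axioms)

lemma AE_le_of_nn_integral_le:
  assumes G: "subalgebra M G" and g: "g \<in> borel_measurable G"
    and le: "\<And>A. A \<in> sets G \<Longrightarrow> (\<integral>\<^sup>+\<omega>. indicator A \<omega> * g \<omega> \<partial>M) \<le> ennreal K * emeasure M A"
  shows "AE \<omega> in M. g \<omega> \<le> ennreal K"
proof -
  have sp: "space G = space M" using G by (simp add: subalgebra_def)
  define A where "A = {\<omega> \<in> space M. ennreal K < g \<omega>}"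
  have AG: "A \<in> sets G" unfolding A_def sp[symmetric] using g by measurable
  then have AM [measurable]: "A \<in> sets M" using G by (auto simp: subalgebra_def)
  have gM [measurable]: "g \<in> borel_measurable M" by (rule measurable_from_subalg[OF G g])
  have "(\<integral>\<^sup>+\<omega>. indicator A \<omega> * (g \<omega> - ennreal K) \<partial>M) + ennreal K * emeasure M A
      = (\<integral>\<^sup>+\<omega>. indicator A \<omega> * (g \<omega> - ennreal K) + ennreal K * indicator A \<omega> \<partial>M)"
    by (simp add: nn_integral_add nn_integral_cmult_indicator)
  also have "\<dots> = (\<integral>\<^sup>+\<omega>. indicator A \<omega> * g \<omega> \<partial>M)"
    by (intro nn_integral_cong) (auto simp: indicator_def A_def diff_add_cancel_ennreal)
  also have "\<dots> \<le> ennreal K * emeasure M A" by (rule le[OF AG])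
  \<comment> \<open>The common term can be cancelled in the extended reals because
    \<open>ennreal K * emeasure M A\<close> is finite; \<open>g\<close> itself may be
    infinite.\<close>
  finally have "(\<integral>\<^sup>+\<omega>. indicator A \<omega> * (g \<omega> - ennreal K) \<partial>M) = 0"
    using ennreal_add_left_cancel_le[of "ennreal K * emeasure M A" "\<integral>\<^sup>+\<omega>. indicator A \<omega> * (g \<omega> - ennreal K) \<partial>M" 0]
    by (simp add: add.commute ennreal_mult_eq_top_iff)
  then have "AE \<omega> in M. indicator A \<omega> * (g \<omega> - ennreal K) = 0"
    by (subst (asm) nn_integral_0_iff_AE) measurable
  with AE_space show ?thesis
  proof eventually_elim
    case (elim \<omega>)
    show ?case
    proof (rule ccontr)
      assume *: "\<not> g \<omega> \<le> ennreal K"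
      with elim have "g \<omega> - ennreal K = 0" by (simp add: A_def)
      with * show False by (simp add: diff_eq_0_iff_ennreal)
    qed
  qed
qed

lemma nn_cond_exp_leI:
  assumes G: "subalgebra M G"
    and le: "\<And>A. A \<in> sets G \<Longrightarrow> (\<integral>\<^sup>+\<omega>. indicator A \<omega> * f \<omega> \<partial>M) \<le> ennreal K * emeasure M A"
  shows "AE \<omega> in M. nn_cond_exp M G f \<omega> \<le> ennreal K"
proof (cases "f \<in> borel_measurable M")
  case True
  interpret sigma_finite_subalgebra M G by (rule sigma_finite_subalgebraI[OF G])
  show ?thesis
    by (rule AE_le_of_nn_integral_le[OF G]) (simp_all add: True nn_cond_exp_intg le)
\<comment> \<open>By its definition \<open>nn_cond_exp\<close> is 0 for a nonmeasurable function.
  Upper bounds thus hold without a proof that \<open>Y\<close> evaluated at a stopping time is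
  measurable.\<close>
qed (simp add: nn_cond_exp_def)

lemma nn_cond_exp_leD:
  assumes G: "subalgebra M G" and f [measurable]: "f \<in> borel_measurable M"
    and le: "AE \<omega> in M. nn_cond_exp M G f \<omega> \<le> ennreal K" and A: "A \<in> sets G"
  shows "(\<integral>\<^sup>+\<omega>. indicator A \<omega> * f \<omega> \<partial>M) \<le> ennreal K * emeasure M A"
proof -
  interpret sigma_finite_subalgebra M G by (rule sigma_finite_subalgebraI[OF G])
  have AM: "A \<in> sets M" using A G by (auto simp: subalgebra_def)
  have "(\<integral>\<^sup>+\<omega>. indicator A \<omega> * f \<omega> \<partial>M) = (\<integral>\<^sup>+\<omega>. indicator A \<omega> * nn_cond_exp M G f \<omega> \<partial>M)"
    using A by (simp add: nn_cond_exp_intg)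
  also have "\<dots> \<le> (\<integral>\<^sup>+\<omega>. ennreal K * indicator A \<omega> \<partial>M)"
    using le by (intro nn_integral_mono_AE) (auto elim!: eventually_mono simp: indicator_def)
  finally show ?thesis using AM by (simp add: nn_integral_cmult_indicator)
qed

text \<open>Members of the filtration beyond \<open>T\<close> are not assumed to lie in
  \<open>M\<close>. As the values of \<rho> stay below \<open>T\<close>, intersecting an event with
  \<rho> \<le> T changes nothing and puts it into \<open>F T\<close>, which has the events of
  \<open>M\<close>.\<close>

lemma subalgebra_pre_sigma:
  assumes \<rho>: "stopping_time F \<rho>" "\<rho> \<in> space M \<rightarrow> {0..t}" "t < T"
  shows "subalgebra M (pre_sigma \<rho>)"
  unfolding subalgebra_def
proof (intro conjI subsetI)
  fix A assume A: "A \<in> sets (pre_sigma \<rho>)"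
  have "{\<omega> \<in> A. \<rho> \<omega> \<le> T} = A"
    using sets.sets_into_space[OF A] \<rho>(2,3) by (force simp: space_pre_sigma)
  then show "A \<in> sets M" using sets_pre_sigmaD[OF \<rho>(1) A, of T] sets_F_T by simp
qed (simp add: space_pre_sigma)

definition deterministic_bound :: "(real \<Rightarrow> 'a \<Rightarrow> real) \<Rightarrow> real \<Rightarrow> real \<Rightarrow> bool" where
  "deterministic_bound Y p K \<longleftrightarrow> (\<forall>s t A. 0 \<le> s \<longrightarrow> s \<le> t \<longrightarrow> t < T \<longrightarrow> A \<in> sets (F s) \<longrightarrow>
    (\<integral>\<^sup>+\<omega>. indicator A \<omega> * ennreal (\<bar>Y t \<omega> - Y s \<omega>\<bar> powr p) \<partial>M) \<le> ennreal K * emeasure M A)"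

text \<open>A stopping time is approximated from the right by stopping times with finitely many values;
  on each level set the bound at a deterministic time applies, and Fatou's lemma gives the limit.\<close>
lemma stopping_time_bound:
  assumes Y: "\<And>t. 0 \<le> t \<Longrightarrow> t < T \<Longrightarrow> Y t \<in> borel_measurable M"
    and right: "\<And>t \<omega>. 0 \<le> t \<Longrightarrow> t < T \<Longrightarrow> \<omega> \<in> space M \<Longrightarrow> ((\<lambda>u. Y u \<omega>) \<longlongrightarrow> Y t \<omega>) (at_right t)"
    and p: "0 < p" and bound: "deterministic_bound Y p K"
    and \<rho>: "stopping_time F \<rho>" "\<rho> \<in> space M \<rightarrow> {0..t}" and t: "0 \<le> t" "t < T"
    and A: "A \<in> sets (pre_sigma \<rho>)"
  shows "(\<integral>\<^sup>+\<omega>. indicator A \<omega> * ennreal (\<bar>Y t \<omega> - Y (\<rho> \<omega>) \<omega>\<bar> powr p) \<partial>M) \<le> ennreal K * emeasure M A"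
proof -
  have sub: "subalgebra M (pre_sigma \<rho>)" using \<rho> t by (intro subalgebra_pre_sigma)
  have AM: "A \<in> sets M" using A sub by (auto simp: subalgebra_def)
  define grid where "grid = (\<lambda>n (i::int). clamp_time t ((real_of_int i + 1) / real (Suc n)))"
  define ix where "ix = (\<lambda>n \<omega>. \<lfloor>real (Suc n) * \<rho> \<omega>\<rfloor>)"
  define I where "I = (\<lambda>n. {0..\<lfloor>real (Suc n) * t\<rfloor>})"
  define B where "B = (\<lambda>n i. {\<omega> \<in> A. ix n \<omega> = i})"
  define h where "h = (\<lambda>n \<omega>. indicator A \<omega> * ennreal (\<bar>Y t \<omega> - Y (grid n (ix n \<omega>)) \<omega>\<bar> powr p))"
  have grid: "0 \<le> grid n i" "grid n i \<le> t" for n i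
    using clamp_time_in[OF t(1)] by (auto simp: grid_def)
  have ixI: "ix n \<omega> \<in> I n" if "\<omega> \<in> space M" for n \<omega>
  proof -
    have "\<rho> \<omega> \<in> {0..t}" using \<rho>(2) that by blast
    then have "0 \<le> real (Suc n) * \<rho> \<omega>" "real (Suc n) * \<rho> \<omega> \<le> real (Suc n) * t"
      by (auto intro!: mult_left_mono simp del: of_nat_Suc)
    then show ?thesis unfolding ix_def I_def by (simp add: floor_mono del: of_nat_Suc)
  qed
  have le_grid: "\<rho> \<omega> \<le> grid n (ix n \<omega>)" "(\<lambda>n. grid n (ix n \<omega>)) \<longlonglongrightarrow> \<rho> \<omega>" if "\<omega> \<in> space M" for n \<omega>
    using clamp_time_tendsto_right[OF t(1), of "\<rho> \<omega>"] clamp_time_id[of "\<rho> \<omega>" t] \<rho>(2) that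
    by (auto simp: grid_def ix_def Pi_iff)
  \<comment> \<open>The level set is known at time \<rho>, and on it \<rho> does not exceed the grid
    point; hence it is known at the grid point, where the deterministic bound applies.\<close>
  have B: "B n i \<in> sets (F (grid n i))" for n i
  proof -
    have "\<rho> \<in> borel_measurable (pre_sigma \<rho>)" by (rule measurable_stopping_time_pre_sigma[OF \<rho>(1)])
    then have "(\<lambda>\<omega>. ix n \<omega>) \<in> measurable (pre_sigma \<rho>) (count_space UNIV)"
      unfolding ix_def by measurable
    then have "{\<omega> \<in> space (pre_sigma \<rho>). ix n \<omega> = i} \<in> sets (pre_sigma \<rho>)" by measurable
    with A have "A \<inter> {\<omega> \<in> space (pre_sigma \<rho>). ix n \<omega> = i} \<in> sets (pre_sigma \<rho>)" by (rule sets.Int)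
    then have "{\<omega> \<in> A \<inter> {\<omega> \<in> space (pre_sigma \<rho>). ix n \<omega> = i}. \<rho> \<omega> \<le> grid n i} \<in> sets (F (grid n i))"
      by (rule sets_pre_sigmaD[OF \<rho>(1)])
    also have "{\<omega> \<in> A \<inter> {\<omega> \<in> space (pre_sigma \<rho>). ix n \<omega> = i}. \<rho> \<omega> \<le> grid n i} = B n i"
      using sets.sets_into_space[OF AM] le_grid(1) by (auto simp: B_def space_pre_sigma)
    finally show ?thesis .
  qed
  have BM [measurable]: "B n i \<in> sets M" for n i
    using B grid[of n i] t by (intro sets_F_imp_M[OF B]) auto
  have Ym [measurable]: "Y t \<in> borel_measurable M" "Y (grid n i) \<in> borel_measurable M" for n i
    using grid[of n i] t by (auto intro!: Y)
  have split: "(\<Sum>i\<in>I n. indicator (B n i) \<omega> * g i) = indicator A \<omega> * g (ix n \<omega>)"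
    if "\<omega> \<in> space M" for n \<omega> and g :: "int \<Rightarrow> ennreal"
  proof -
    have "(\<Sum>i\<in>I n. indicator (B n i) \<omega> * g i) = (\<Sum>i\<in>I n. if ix n \<omega> = i then indicator A \<omega> * g i else 0)"
      by (intro sum.cong) (auto simp: B_def indicator_def)
    also have "\<dots> = indicator A \<omega> * g (ix n \<omega>)" using ixI[OF that, of n] by (subst sum.delta') (auto simp: I_def)
    finally show ?thesis .
  qed
  have h_eq: "h n \<omega> = (\<Sum>i\<in>I n. indicator (B n i) \<omega> * ennreal (\<bar>Y t \<omega> - Y (grid n i) \<omega>\<bar> powr p))"
    if "\<omega> \<in> space M" for n \<omega>
    unfolding h_def by (rule split[OF that, symmetric])
  have hm: "h n \<in> borel_measurable M" for n
    by (subst measurable_cong[OF h_eq]) measurable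
  have h_le: "(\<integral>\<^sup>+\<omega>. h n \<omega> \<partial>M) \<le> ennreal K * emeasure M A" for n
  proof -
    have "(\<integral>\<^sup>+\<omega>. h n \<omega> \<partial>M)
        = (\<integral>\<^sup>+\<omega>. (\<Sum>i\<in>I n. indicator (B n i) \<omega> * ennreal (\<bar>Y t \<omega> - Y (grid n i) \<omega>\<bar> powr p)) \<partial>M)"
      by (intro nn_integral_cong h_eq)
    also have "\<dots> = (\<Sum>i\<in>I n. \<integral>\<^sup>+\<omega>. indicator (B n i) \<omega> * ennreal (\<bar>Y t \<omega> - Y (grid n i) \<omega>\<bar> powr p) \<partial>M)"
      by (rule nn_integral_sum) measurable
    also have "\<dots> \<le> (\<Sum>i\<in>I n. ennreal K * emeasure M (B n i))"
      by (intro sum_mono bound[unfolded deterministic_bound_def, rule_format] B grid t)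
    also have "\<dots> = ennreal K * (\<integral>\<^sup>+\<omega>. (\<Sum>i\<in>I n. indicator (B n i) \<omega> * 1) \<partial>M)"
      by (simp add: sum_distrib_left nn_integral_sum)
    also have "(\<integral>\<^sup>+\<omega>. (\<Sum>i\<in>I n. indicator (B n i) \<omega> * 1) \<partial>M) = (\<integral>\<^sup>+\<omega>. indicator A \<omega> \<partial>M)"
      by (intro nn_integral_cong) (subst split; simp)
    finally show ?thesis using AM by simp
  qed
  have "(\<integral>\<^sup>+\<omega>. indicator A \<omega> * ennreal (\<bar>Y t \<omega> - Y (\<rho> \<omega>) \<omega>\<bar> powr p) \<partial>M) = (\<integral>\<^sup>+\<omega>. liminf (\<lambda>n. h n \<omega>) \<partial>M)"
  proof (intro nn_integral_cong)
    fix \<omega> assume \<omega>: "\<omega> \<in> space M"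
    then have \<rho>t: "\<rho> \<omega> \<in> {0..t}" using \<rho>(2) by auto
    have "continuous (at (\<rho> \<omega>) within {\<rho> \<omega>..}) (\<lambda>u. Y u \<omega>)"
      unfolding continuous_within at_within_Ici_at_right using \<rho>t t \<omega> by (intro right) auto
    then have "(\<lambda>n. Y (grid n (ix n \<omega>)) \<omega>) \<longlonglongrightarrow> Y (\<rho> \<omega>) \<omega>"
      by (rule continuous_within_tendsto_compose) (use le_grid[OF \<omega>] in auto)
    then have "(\<lambda>n. \<bar>Y t \<omega> - Y (grid n (ix n \<omega>)) \<omega>\<bar> powr p) \<longlonglongrightarrow> \<bar>Y t \<omega> - Y (\<rho> \<omega>) \<omega>\<bar> powr p"
      using p by (intro tendsto_powr' tendsto_intros) auto
    then have "(\<lambda>n. h n \<omega>) \<longlonglongrightarrow> indicator A \<omega> * ennreal (\<bar>Y t \<omega> - Y (\<rho> \<omega>) \<omega>\<bar> powr p)"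
      unfolding h_def by (intro tendsto_mult_ennreal tendsto_const tendsto_ennrealI) (auto simp: indicator_def)
    then show "indicator A \<omega> * ennreal (\<bar>Y t \<omega> - Y (\<rho> \<omega>) \<omega>\<bar> powr p) = liminf (\<lambda>n. h n \<omega>)"
      by (intro lim_imp_Liminf[symmetric]) auto
  qed
  also have "\<dots> \<le> liminf (\<lambda>n. \<integral>\<^sup>+\<omega>. h n \<omega> \<partial>M)" by (rule nn_integral_liminf[OF hm])
  also have "\<dots> \<le> ennreal K * emeasure M A"
    by (rule Liminf_le) (auto simp: h_le)
  finally show ?thesis .
qed

text \<open>The square error is continuous in time. Hence the left limits in \<open>BMO_norm\<close>
  are values, and the same deterministic bound describes BMO and bmo conditions; at 0 the convention
  of \<open>left_limit\<close> gives the value.\<close>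

lemma left_limit_eq:
  assumes "0 < u \<Longrightarrow> (f \<longlongrightarrow> f u) (at_left u)" "0 \<le> u"
  shows "left_limit f u = f u"
  using assms tendsto_Lim[of "at_left u" f "f u"] by (auto simp: left_limit_def)

lemma bmo_norm_leI:
  assumes Y: "\<And>t. 0 \<le> t \<Longrightarrow> t < T \<Longrightarrow> Y t \<in> borel_measurable M"
    and right: "\<And>t \<omega>. 0 \<le> t \<Longrightarrow> t < T \<Longrightarrow> \<omega> \<in> space M \<Longrightarrow> ((\<lambda>u. Y u \<omega>) \<longlongrightarrow> Y t \<omega>) (at_right t)"
    and p: "0 < p" and c: "0 \<le> c" and bound: "deterministic_bound Y p (c powr p)"
  shows "bmo_norm M F T p Y \<le> ennreal c"
  unfolding bmo_norm_def
proof (rule Inf_lower, intro CollectI exI conjI ballI allI impI)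
  fix t \<rho> assume t: "t \<in> {0..<T}" and \<rho>: "stopping_time F \<rho> \<and> \<rho> \<in> space M \<rightarrow> {0..t}"
  show "AE \<omega> in M. nn_cond_exp M (pre_sigma \<rho>) (\<lambda>\<omega>. ennreal (\<bar>Y t \<omega> - Y (\<rho> \<omega>) \<omega>\<bar> powr p)) \<omega> \<le> ennreal (c powr p)"
    using t \<rho> by (intro nn_cond_exp_leI subalgebra_pre_sigma[of \<rho> t] stopping_time_bound[OF Y right p bound]) auto
qed (use c in auto)

lemma BMO_norm_leI:
  assumes Y: "\<And>t. 0 \<le> t \<Longrightarrow> t < T \<Longrightarrow> Y t \<in> borel_measurable M"
    and right: "\<And>t \<omega>. 0 \<le> t \<Longrightarrow> t < T \<Longrightarrow> \<omega> \<in> space M \<Longrightarrow> ((\<lambda>u. Y u \<omega>) \<longlongrightarrow> Y t \<omega>) (at_right t)"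
    and left: "\<And>t \<omega>. 0 < t \<Longrightarrow> t < T \<Longrightarrow> \<omega> \<in> space M \<Longrightarrow> ((\<lambda>u. Y u \<omega>) \<longlongrightarrow> Y t \<omega>) (at_left t)"
    and p: "0 < p" and c: "0 \<le> c" and bound: "deterministic_bound Y p (c powr p)"
  shows "BMO_norm M F T p Y \<le> ennreal c"
  unfolding BMO_norm_def
proof (rule Inf_lower, intro CollectI exI conjI ballI allI impI)
  fix t \<rho> assume t: "t \<in> {0..<T}" and \<rho>: "stopping_time F \<rho> \<and> \<rho> \<in> space M \<rightarrow> {0..t}"
  show "AE \<omega> in M. nn_cond_exp M (pre_sigma \<rho>)
      (\<lambda>\<omega>. ennreal (\<bar>Y t \<omega> - left_limit (\<lambda>s. Y s \<omega>) (\<rho> \<omega>)\<bar> powr p)) \<omega> \<le> ennreal (c powr p)"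
  proof (intro nn_cond_exp_leI subalgebra_pre_sigma[of \<rho> t])
    fix A assume A: "A \<in> sets (pre_sigma \<rho>)"
    have "left_limit (\<lambda>s. Y s \<omega>) (\<rho> \<omega>) = Y (\<rho> \<omega>) \<omega>" if "\<omega> \<in> space M" for \<omega>
    proof -
      have "\<rho> \<omega> \<in> {0..t}" using \<rho> that by auto
      then show ?thesis using left[of "\<rho> \<omega>" \<omega>] t that by (intro left_limit_eq) auto
    qed
    then have "(\<integral>\<^sup>+\<omega>. indicator A \<omega> * ennreal (\<bar>Y t \<omega> - left_limit (\<lambda>s. Y s \<omega>) (\<rho> \<omega>)\<bar> powr p) \<partial>M)
        = (\<integral>\<^sup>+\<omega>. indicator A \<omega> * ennreal (\<bar>Y t \<omega> - Y (\<rho> \<omega>) \<omega>\<bar> powr p) \<partial>M)"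
      by (intro nn_integral_cong) simp
    also have "\<dots> \<le> ennreal (c powr p) * emeasure M A"
      using t \<rho> A by (intro stopping_time_bound[OF Y right p bound]) auto
    finally show "(\<integral>\<^sup>+\<omega>. indicator A \<omega> * ennreal (\<bar>Y t \<omega> - left_limit (\<lambda>s. Y s \<omega>) (\<rho> \<omega>)\<bar> powr p) \<partial>M)
       \<le> ennreal (c powr p) * emeasure M A" .
  qed (use t \<rho> in auto)
qed (use c in auto)

lemma sets_pre_sigma_const:
  assumes "A \<in> sets (F s)" shows "A \<in> sets (pre_sigma (\<lambda>_. s))"
proof (rule sets_pre_sigmaI)
  fix t
  show "{\<omega> \<in> A. s \<le> t} \<in> sets (F t)" using sets_F_le[OF assms, of t] by (cases "s \<le> t") auto
qed (rule stopping_time_const)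

text \<open>The strict inequality provides an admissible constant below \<open>c\<close> without
  asking whether the infimum is attained. Constant stopping times then suffice.\<close>

lemma bmo_norm_lessD:
  assumes Y: "\<And>t. 0 \<le> t \<Longrightarrow> t < T \<Longrightarrow> Y t \<in> borel_measurable M"
    and p: "0 < p" and less: "bmo_norm M F T p Y < ennreal c"
  shows "deterministic_bound Y p (c powr p)"
  unfolding deterministic_bound_def
proof (intro allI impI)
  fix s t A assume st: "0 \<le> s" "s \<le> t" "t < T" and A: "A \<in> sets (F s)"
  obtain c' where c': "0 \<le> c'" "ennreal c' < ennreal c" and
    *: "\<And>t \<rho>. t \<in> {0..<T} \<Longrightarrow> stopping_time F \<rho> \<and> \<rho> \<in> space M \<rightarrow> {0..t} \<Longrightarrow>
      AE \<omega> in M. nn_cond_exp M (pre_sigma \<rho>) (\<lambda>\<omega>. ennreal (\<bar>Y t \<omega> - Y (\<rho> \<omega>) \<omega>\<bar> powr p)) \<omega> \<le> ennreal (c' powr p)"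
    using less unfolding bmo_norm_def Inf_less_iff by blast
  have [measurable]: "Y t \<in> borel_measurable M" "Y s \<in> borel_measurable M" using st by (auto intro: Y)
  have "(\<integral>\<^sup>+\<omega>. indicator A \<omega> * ennreal (\<bar>Y t \<omega> - Y s \<omega>\<bar> powr p) \<partial>M) \<le> ennreal (c' powr p) * emeasure M A"
  proof (rule nn_cond_exp_leD[where G="pre_sigma (\<lambda>_. s)"])
    show "subalgebra M (pre_sigma (\<lambda>_. s))"
      using st by (intro subalgebra_pre_sigma[of _ t] stopping_time_const) auto
    show "AE \<omega> in M. nn_cond_exp M (pre_sigma (\<lambda>_. s)) (\<lambda>\<omega>. ennreal (\<bar>Y t \<omega> - Y s \<omega>\<bar> powr p)) \<omega> \<le> ennreal (c' powr p)"
      using st by (intro *[of t "\<lambda>_. s"]) (auto intro: stopping_time_const)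
  qed (use A in \<open>auto intro: sets_pre_sigma_const\<close>)
  also have "\<dots> \<le> ennreal (c powr p) * emeasure M A"
    using c' p by (intro mult_right_mono ennreal_leI powr_mono2) (auto simp: ennreal_less_iff)
  finally show "(\<integral>\<^sup>+\<omega>. indicator A \<omega> * ennreal (\<bar>Y t \<omega> - Y s \<omega>\<bar> powr p) \<partial>M) \<le> ennreal (c powr p) * emeasure M A" .
qed

lemma BMO_norm_lessD:
  assumes Y: "\<And>t. 0 \<le> t \<Longrightarrow> t < T \<Longrightarrow> Y t \<in> borel_measurable M"
    and left: "\<And>t \<omega>. 0 < t \<Longrightarrow> t < T \<Longrightarrow> \<omega> \<in> space M \<Longrightarrow> ((\<lambda>u. Y u \<omega>) \<longlongrightarrow> Y t \<omega>) (at_left t)"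
    and p: "0 < p" and less: "BMO_norm M F T p Y < ennreal c"
  shows "deterministic_bound Y p (c powr p)"
  unfolding deterministic_bound_def
proof (intro allI impI)
  fix s t A assume st: "0 \<le> s" "s \<le> t" "t < T" and A: "A \<in> sets (F s)"
  obtain c' where c': "0 \<le> c'" "ennreal c' < ennreal c" and
    *: "\<And>t \<rho>. t \<in> {0..<T} \<Longrightarrow> stopping_time F \<rho> \<and> \<rho> \<in> space M \<rightarrow> {0..t} \<Longrightarrow>
      AE \<omega> in M. nn_cond_exp M (pre_sigma \<rho>) (\<lambda>\<omega>. ennreal (\<bar>Y t \<omega> - left_limit (\<lambda>s. Y s \<omega>) (\<rho> \<omega>)\<bar> powr p)) \<omega>
        \<le> ennreal (c' powr p)"
    using less unfolding BMO_norm_def Inf_less_iff by blast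
  have [measurable]: "Y t \<in> borel_measurable M" "Y s \<in> borel_measurable M" using st by (auto intro: Y)
  have ll: "left_limit (\<lambda>s. Y s \<omega>) s = Y s \<omega>" if "\<omega> \<in> space M" for \<omega>
    using left[of s \<omega>] st that by (intro left_limit_eq) auto
  have "(\<integral>\<^sup>+\<omega>. indicator A \<omega> * ennreal (\<bar>Y t \<omega> - Y s \<omega>\<bar> powr p) \<partial>M)
      = (\<integral>\<^sup>+\<omega>. indicator A \<omega> * ennreal (\<bar>Y t \<omega> - left_limit (\<lambda>s. Y s \<omega>) s\<bar> powr p) \<partial>M)"
    by (intro nn_integral_cong) (simp add: ll)
  also have "\<dots> \<le> ennreal (c' powr p) * emeasure M A"
  proof (rule nn_cond_exp_leD[where G="pre_sigma (\<lambda>_. s)"])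
    show "subalgebra M (pre_sigma (\<lambda>_. s))"
      using st by (intro subalgebra_pre_sigma[of _ t] stopping_time_const) auto
    show "AE \<omega> in M. nn_cond_exp M (pre_sigma (\<lambda>_. s))
        (\<lambda>\<omega>. ennreal (\<bar>Y t \<omega> - left_limit (\<lambda>s. Y s \<omega>) s\<bar> powr p)) \<omega> \<le> ennreal (c' powr p)"
      using st by (intro *[of t "\<lambda>_. s"]) (auto intro: stopping_time_const)
    have "(\<lambda>\<omega>. ennreal (\<bar>Y t \<omega> - Y s \<omega>\<bar> powr p)) \<in> borel_measurable M" by measurable
    then show "(\<lambda>\<omega>. ennreal (\<bar>Y t \<omega> - left_limit (\<lambda>s. Y s \<omega>) s\<bar> powr p)) \<in> borel_measurable M"
      by (rule measurable_cong[THEN iffD1, rotated]) (simp add: ll)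
  qed (use A in \<open>auto intro: sets_pre_sigma_const\<close>)
  also have "\<dots> \<le> ennreal (c powr p) * emeasure M A"
    using c' p by (intro mult_right_mono ennreal_leI powr_mono2) (auto simp: ennreal_less_iff)
  finally show "(\<integral>\<^sup>+\<omega>. indicator A \<omega> * ennreal (\<bar>Y t \<omega> - Y s \<omega>\<bar> powr p) \<partial>M) \<le> ennreal (c powr p) * emeasure M A" .
qed

end

section \<open>Time-nets and the square error\<close>

abbreviation net_cell :: "(nat \<Rightarrow> real) \<Rightarrow> nat \<Rightarrow> real set" where
  "net_cell t i \<equiv> {t (i - 1)<..t i}"

lemma time_nets_strict_mono:
  assumes net: "(n, t) \<in> time_nets T" and "i < j" "j \<le> n"
  shows "t i < t j"
  using \<open>i < j\<close> \<open>j \<le> n\<close>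
proof (induction j)
  case (Suc j)
  have "t j < t (Suc j)" using net Suc.prems by (force simp: time_nets_def)
  then show ?case using Suc by (cases "i = j") auto
qed simp

lemma time_nets_bounds:
  assumes net: "(n, t) \<in> time_nets T" and i: "i \<in> {1..n}"
  shows "0 \<le> t (i - 1)" "t (i - 1) < t i" "t i \<le> T" "t (i - 1) < T"
proof -
  have tt: "t 0 = 0" "t n = T" using net by (auto simp: time_nets_def)
  have "i - 1 \<le> n" using i by auto
  then show "0 \<le> t (i - 1)" using time_nets_strict_mono[OF net, of 0 "i - 1"] i tt by (cases "i = 1") auto
  show 1: "t (i - 1) < t i" using time_nets_strict_mono[OF net, of "i - 1" i] i by auto
  show 2: "t i \<le> T" using time_nets_strict_mono[OF net, of i n] i tt by (cases "i = n") auto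
  show "t (i - 1) < T" using 1 2 by simp
qed

lemma time_nets_cell:
  assumes net: "(n, t) \<in> time_nets T" and u: "0 < u" "u \<le> T"
  obtains i where "i \<in> {1..n}" "u \<in> net_cell t i" "\<And>j. j \<in> {1..n} \<Longrightarrow> u \<in> net_cell t j \<longleftrightarrow> j = i"
proof -
  have tt: "t 0 = 0" "t n = T" using net by (auto simp: time_nets_def)
  define i where "i = (LEAST i. u \<le> t i)"
  have le: "u \<le> t i" "i \<le> n" unfolding i_def using u tt by (auto intro: LeastI2 Least_le LeastI[of _ n])
  have i0: "i \<noteq> 0" using le tt u by (cases "i = 0") auto
  have "\<not> u \<le> t (i - 1)" using not_less_Least[of "i - 1" "\<lambda>i. u \<le> t i"] i0 by (simp add: i_def)
  then have u_in: "u \<in> net_cell t i" using le by auto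
  have "j = i" if j: "j \<in> {1..n}" "u \<in> net_cell t j" for j
  proof (rule ccontr)
    assume "j \<noteq> i"
    then consider "j \<le> i - 1" | "i \<le> j - 1" "i < j" using i0 by linarith
    then show False
    proof cases
      case 1
      moreover have "i - 1 \<le> n" using le by auto
      ultimately have "t j \<le> t (i - 1)"
        using time_nets_strict_mono[OF net, of j "i - 1"] by (cases "j = i - 1") auto
      then show False using u_in j by auto
    next
      case 2
      moreover have "j - 1 \<le> n" using j by auto
      ultimately have "t i \<le> t (j - 1)"
        using time_nets_strict_mono[OF net, of i "j - 1"] by (cases "i = j - 1") auto
      then show False using u_in j by auto
    qed
  qed
  then show thesis using that[of i] le i0 u_in by auto
qed

lemma sum_net_cell:
  fixes g :: "nat \<Rightarrow> 'b::comm_semiring_1"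
  assumes i: "i \<in> {1..n}" "\<And>j. j \<in> {1..n} \<Longrightarrow> u \<in> net_cell t j \<longleftrightarrow> j = i"
  shows "(\<Sum>j=1..n. g j * indicator (net_cell t j) u) = g i"
proof -
  have "(\<Sum>j=1..n. g j * indicator (net_cell t j) u) = (\<Sum>j=1..n. if j = i then g j else 0)"
    using i(2) by (intro sum.cong refl) (auto simp: indicator_def)
  then show ?thesis using i(1) by simp
qed

lemma net_size_upper:
  assumes "i \<in> {1..n}"
  shows "(t i - t (i - 1)) / (T - t (i - 1)) powr (1 - \<theta>) \<le> net_size T \<theta> (n, t)"
  unfolding net_size_def prod.case using assms by (intro cSUP_upper bdd_above_finite) auto

lemma net_size_le:
  assumes "(n, t) \<in> time_nets T"
    "\<And>i. i \<in> {1..n} \<Longrightarrow> (t i - t (i - 1)) / (T - t (i - 1)) powr (1 - \<theta>) \<le> K"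
  shows "net_size T \<theta> (n, t) \<le> K"
  unfolding net_size_def prod.case using assms by (intro cSUP_least) (auto simp: time_nets_def)

lemma net_size_pos:
  assumes net: "(n, t) \<in> time_nets T" shows "0 < net_size T \<theta> (n, t)"
proof -
  have 1: "1 \<in> {1..n}" using net by (auto simp: time_nets_def)
  have "0 < (t 1 - t (1 - 1)) / (T - t (1 - 1)) powr (1 - \<theta>)"
    using time_nets_bounds[OF net 1] by (intro divide_pos_pos) auto
  also have "\<dots> \<le> net_size T \<theta> (n, t)" by (rule net_size_upper[OF 1])
  finally show ?thesis .
qed

lemma set_integrable_square_error:
  assumes f: "cadlag T f" and b: "b < T"
  shows "set_integrable lborel {0..b} (\<lambda>u. \<bar>f u - (\<Sum>i=1..n. f (t (i - 1)) * indicator (net_cell t i) u)\<bar>\<^sup>2)"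
proof (cases "0 \<le> b")
  case True
  obtain B where B: "\<And>u. u \<in> {0..b} \<Longrightarrow> \<bar>f u\<bar> \<le> B" using cadlag_bounded[OF f True b] by blast
  define g where "g = (\<lambda>u. (\<Sum>i=1..n. f (t (i - 1)) * indicator (net_cell t i) u))"
  have g [measurable]: "g \<in> borel_measurable borel" unfolding g_def by measurable
  have gB: "\<bar>g u\<bar> \<le> (\<Sum>i=1..n. \<bar>f (t (i - 1))\<bar>)" for u
    unfolding g_def by (intro order_trans[OF sum_abs] sum_mono) (auto simp: indicator_def)
  have [measurable]: "(\<lambda>u. f (clamp_time b u)) \<in> borel_measurable borel"
    by (rule cadlag_borel_measurable_clamp[OF f True b])
  have "set_integrable lborel {0..b} (\<lambda>u. \<bar>f (clamp_time b u) - g u\<bar>\<^sup>2)"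
  proof (rule set_integrable_bounded_Icc)
    fix u assume u: "u \<in> {0..b}"
    have "\<bar>f (clamp_time b u) - g u\<bar> \<le> B + (\<Sum>i=1..n. \<bar>f (t (i - 1))\<bar>)"
      using B[of u] gB[of u] u by (simp add: clamp_time_id)
    then have "\<bar>f (clamp_time b u) - g u\<bar>\<^sup>2 \<le> (B + (\<Sum>i=1..n. \<bar>f (t (i - 1))\<bar>))\<^sup>2"
      by (intro power_mono) auto
    then show "\<bar>\<bar>f (clamp_time b u) - g u\<bar>\<^sup>2\<bar> \<le> (B + (\<Sum>i=1..n. \<bar>f (t (i - 1))\<bar>))\<^sup>2" by simp
  qed measurable
  then show ?thesis
    by (rule iffD1[OF set_integrable_cong, rotated 3]) (auto simp: clamp_time_id g_def)
qed (simp add: set_integrable_def)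

context stochastic_basis
begin

context
  fixes X assumes X: "l2_martingale X" and cad: "cadlag_process M T X"
  fixes n t assumes net: "(n, t) \<in> time_nets T"
begin

lemma square_error_path:
  "square_error X (n, t) a \<omega> = (LINT u:{0..a}|lborel. \<bar>X u \<omega> - (\<Sum>i=1..n. X (t (i - 1)) \<omega> * indicator (net_cell t i) u)\<bar>\<^sup>2)"
  by (simp add: square_error_def)

lemma square_error_tendsto:
  assumes "\<omega> \<in> space M" "0 \<le> a" "a < T"
  shows "((\<lambda>s. square_error X (n, t) s \<omega>) \<longlongrightarrow> square_error X (n, t) a \<omega>) (at_right a)"
    and "0 < a \<Longrightarrow> ((\<lambda>s. square_error X (n, t) s \<omega>) \<longlongrightarrow> square_error X (n, t) a \<omega>) (at_left a)"
  unfolding square_error_path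
  using indefinite_set_integral_continuous[of T, OF set_integrable_square_error[OF cadlag_processD[OF cad assms(1)]] assms(2,3)]
  by blast+

lemma square_error_measurable:
  assumes a: "0 \<le> a" "a < T"
  shows "square_error X (n, t) a \<in> borel_measurable M"
proof -
  have Xt: "X (t (i - 1)) \<in> borel_measurable M" if "i \<in> {1..n}" for i
    using time_nets_bounds[OF net that] by (intro L2_measurable[OF l2_martingaleD(2)[OF X]])
  have [measurable]: "(\<lambda>(\<omega>, u). X (clamp_time a u) \<omega>) \<in> borel_measurable (M \<Otimes>\<^sub>M lborel)"
    using a by (intro jointly_measurable(2)[OF X cad, of a T]) auto
  have "(\<lambda>x. (\<Sum>i=1..n. X (t (i - 1)) (fst x) * indicator (net_cell t i) (snd x))) \<in> borel_measurable (M \<Otimes>\<^sub>M lborel)"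
    by (intro borel_measurable_sum borel_measurable_times measurable_compose[OF measurable_fst Xt]
      measurable_compose[OF measurable_snd borel_measurable_indicator]) simp_all
  then have [measurable]: "(\<lambda>(\<omega>, u). (\<Sum>i=1..n. X (t (i - 1)) \<omega> * indicator (net_cell t i) u)) \<in> borel_measurable (M \<Otimes>\<^sub>M lborel)"
    by (simp add: case_prod_beta)
  have "(\<lambda>(\<omega>, u). indicator {0..a} u * \<bar>X (clamp_time a u) \<omega> - (\<Sum>i=1..n. X (t (i - 1)) \<omega> * indicator (net_cell t i) u)\<bar>\<^sup>2)
      \<in> borel_measurable (M \<Otimes>\<^sub>M lborel)"
    by measurable
  from lborel.borel_measurable_lebesgue_integral[OF this]
  have "(\<lambda>\<omega>. \<integral>u. indicator {0..a} u * \<bar>X (clamp_time a u) \<omega> - (\<Sum>i=1..n. X (t (i - 1)) \<omega> * indicator (net_cell t i) u)\<bar>\<^sup>2 \<partial>lborel)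
      \<in> borel_measurable M" .
  also have "(\<lambda>\<omega>. \<integral>u. indicator {0..a} u * \<bar>X (clamp_time a u) \<omega> - (\<Sum>i=1..n. X (t (i - 1)) \<omega> * indicator (net_cell t i) u)\<bar>\<^sup>2 \<partial>lborel)
    = square_error X (n, t) a"
    unfolding square_error_path set_lebesgue_integral_def
    by (intro ext Bochner_Integration.integral_cong) (auto simp: indicator_def clamp_time_id)
  finally show ?thesis .
qed

text \<open>Almost every time in [s,a] lies in exactly one cell, where the error is the increment of
  \<open>X\<close> since the left end of the cell. Tonelli's theorem then leaves only energies, and
  all later estimates start from this sum over cells.\<close>

lemma square_error_energy:
  assumes s: "0 \<le> s" "s \<le> a" "a < T" and A: "A \<in> sets M"
  shows "(\<integral>\<^sup>+\<omega>. indicator A \<omega> * ennreal (\<bar>square_error X (n, t) a \<omega> - square_error X (n, t) s \<omega>\<bar> powr 1) \<partial>M)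
    = (\<Sum>i=1..n. \<integral>\<^sup>+u. indicator (net_cell t i \<inter> {s<..a}) u * ennreal (energy X A (t (i - 1)) u) \<partial>lborel)"
proof -
  let ?S = "\<lambda>i. net_cell t i \<inter> {s<..a}"
  let ?e = "\<lambda>\<omega> u. \<bar>X u \<omega> - (\<Sum>i=1..n. X (t (i - 1)) \<omega> * indicator (net_cell t i) u)\<bar>\<^sup>2"
  let ?Q = "\<lambda>i \<omega>. \<integral>\<^sup>+u. indicator (?S i) u * ennreal ((X u \<omega> - X (t (i - 1)) \<omega>)\<^sup>2) \<partial>lborel"
  have ptw: "ennreal (\<bar>square_error X (n, t) a \<omega> - square_error X (n, t) s \<omega>\<bar> powr 1) = (\<Sum>i=1..n. ?Q i \<omega>)"
    if \<omega>: "\<omega> \<in> space M" for \<omega>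
  proof -
    have i0: "set_integrable lborel {0..a} (?e \<omega>)"
      using set_integrable_square_error[OF cadlag_processD[OF cad \<omega>] s(3)] .
    then have i: "set_integrable lborel {s..a} (?e \<omega>)" by (rule set_integrable_subset) (use s in auto)
    have "square_error X (n, t) a \<omega> - square_error X (n, t) s \<omega> = (LINT u:{s..a}|lborel. ?e \<omega> u)"
      unfolding square_error_path using set_integral_Icc_combine[OF s(1,2) i0] by simp
    moreover have "0 \<le> (LINT u:{s..a}|lborel. ?e \<omega> u)"
      unfolding set_lebesgue_integral_def by (intro integral_nonneg_AE AE_I2) (auto simp: indicator_def)
    ultimately have "ennreal (\<bar>square_error X (n, t) a \<omega> - square_error X (n, t) s \<omega>\<bar> powr 1)
        = ennreal (LINT u:{s..a}|lborel. ?e \<omega> u)" by simp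
    also have "\<dots> = (\<integral>\<^sup>+u. ennreal (indicator {s..a} u *\<^sub>R ?e \<omega> u) \<partial>lborel)"
      using i unfolding set_integrable_def set_lebesgue_integral_def
      by (intro nn_integral_eq_integral[symmetric]) (auto simp: indicator_def)
    also have "\<dots> = (\<integral>\<^sup>+u. (\<Sum>i=1..n. indicator (?S i) u * ennreal ((X u \<omega> - X (t (i - 1)) \<omega>)\<^sup>2)) \<partial>lborel)"
    \<comment> \<open>The point \<open>s\<close> is discarded because the cells are open on the
      left: for s = 0 it lies in no cell.\<close>
    proof (intro nn_integral_cong_AE eventually_mono[OF AE_lborel_singleton[of s]])
      fix u assume "u \<noteq> s"
      show "ennreal (indicator {s..a} u *\<^sub>R ?e \<omega> u) = (\<Sum>i=1..n. indicator (?S i) u * ennreal ((X u \<omega> - X (t (i - 1)) \<omega>)\<^sup>2))"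
      proof (cases "u \<in> {s..a}")
        case True
        then have u: "0 < u" "u \<le> T" using s \<open>u \<noteq> s\<close> by auto
        obtain i where i: "i \<in> {1..n}" "\<And>j. j \<in> {1..n} \<Longrightarrow> u \<in> net_cell t j \<longleftrightarrow> j = i"
          using time_nets_cell[OF net u] by blast
        have "(\<Sum>j=1..n. indicator (?S j) u * ennreal ((X u \<omega> - X (t (j - 1)) \<omega>)\<^sup>2))
            = (\<Sum>j=1..n. ennreal ((X u \<omega> - X (t (j - 1)) \<omega>)\<^sup>2) * indicator (net_cell t j) u)"
          using True \<open>u \<noteq> s\<close> by (intro sum.cong) (auto simp: indicator_def)
        also have "\<dots> = ennreal ((X u \<omega> - X (t (i - 1)) \<omega>)\<^sup>2)" by (rule sum_net_cell[OF i])
        finally show ?thesis using True sum_net_cell[OF i, of "\<lambda>j. X (t (j - 1)) \<omega>"] by simp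
      next
        case False
        then have "indicator (?S j) u = (0::ennreal)" for j by (auto simp: indicator_def)
        then show ?thesis using False by simp
      qed
    qed
    also have "\<dots> = (\<Sum>i=1..n. ?Q i \<omega>)"
    proof (rule nn_integral_sum)
      fix i
      have [measurable]: "(\<lambda>u. X (clamp_time a u) \<omega>) \<in> borel_measurable borel"
        using s by (intro cadlag_borel_measurable_clamp[OF cadlag_processD[OF cad \<omega>]]) auto
      have "(\<lambda>u. indicator (?S i) u * ennreal ((X (clamp_time a u) \<omega> - X (t (i - 1)) \<omega>)\<^sup>2)) \<in> borel_measurable lborel"
        by measurable
      also have "(\<lambda>u. indicator (?S i) u * ennreal ((X (clamp_time a u) \<omega> - X (t (i - 1)) \<omega>)\<^sup>2))
          = (\<lambda>u. indicator (?S i) u * ennreal ((X u \<omega> - X (t (i - 1)) \<omega>)\<^sup>2))"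
        using s by (intro ext) (auto simp: indicator_def clamp_time_id)
      finally show "(\<lambda>u. indicator (?S i) u * ennreal ((X u \<omega> - X (t (i - 1)) \<omega>)\<^sup>2)) \<in> borel_measurable lborel" .
    qed
    finally show ?thesis .
  qed
  have Qm: "(\<lambda>\<omega>. indicator A \<omega> * ?Q i \<omega>) \<in> borel_measurable M" if i: "i \<in> {1..n}" for i
  proof -
    have [measurable]: "X (t (i - 1)) \<in> borel_measurable M"
      using time_nets_bounds[OF net i] by (intro L2_measurable[OF l2_martingaleD(2)[OF X]])
    have [measurable]: "(\<lambda>(\<omega>, u). X (clamp_time a u) \<omega>) \<in> borel_measurable (M \<Otimes>\<^sub>M lborel)"
      using s by (intro jointly_measurable(2)[OF X cad, of a T]) auto
    have "(\<lambda>(\<omega>, u). indicator (?S i) u * ennreal ((X (clamp_time a u) \<omega> - X (t (i - 1)) \<omega>)\<^sup>2)) \<in> borel_measurable (M \<Otimes>\<^sub>M lborel)"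
      by measurable
    from lborel.borel_measurable_nn_integral_fst[OF this]
    have "(\<lambda>\<omega>. \<integral>\<^sup>+u. indicator (?S i) u * ennreal ((X (clamp_time a u) \<omega> - X (t (i - 1)) \<omega>)\<^sup>2) \<partial>lborel) \<in> borel_measurable M"
      by simp
    also have "(\<lambda>\<omega>. \<integral>\<^sup>+u. indicator (?S i) u * ennreal ((X (clamp_time a u) \<omega> - X (t (i - 1)) \<omega>)\<^sup>2) \<partial>lborel) = ?Q i"
      using s by (intro ext nn_integral_cong) (auto simp: indicator_def clamp_time_id)
    finally show ?thesis using A by measurable
  qed
  have "(\<integral>\<^sup>+\<omega>. indicator A \<omega> * ennreal (\<bar>square_error X (n, t) a \<omega> - square_error X (n, t) s \<omega>\<bar> powr 1) \<partial>M)
     = (\<integral>\<^sup>+\<omega>. (\<Sum>i=1..n. indicator A \<omega> * ?Q i \<omega>) \<partial>M)"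
    using ptw by (intro nn_integral_cong) (simp add: sum_distrib_left)
  also have "\<dots> = (\<Sum>i=1..n. \<integral>\<^sup>+\<omega>. indicator A \<omega> * ?Q i \<omega> \<partial>M)"
    by (rule nn_integral_sum[OF Qm])
  also have "\<dots> = (\<Sum>i=1..n. \<integral>\<^sup>+u. indicator (?S i) u * ennreal (energy X A (t (i - 1)) u) \<partial>lborel)"
  proof (intro sum.cong refl)
    fix i assume i: "i \<in> {1..n}"
    show "(\<integral>\<^sup>+\<omega>. indicator A \<omega> * ?Q i \<omega> \<partial>M) = (\<integral>\<^sup>+u. indicator (?S i) u * ennreal (energy X A (t (i - 1)) u) \<partial>lborel)"
      using Tonelli_energy[OF X cad, of "?S i" a "t (i - 1)" A "\<lambda>_. 1"] time_nets_bounds[OF net i] s A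
      by (simp add: subset_iff)
  qed
  finally show ?thesis .
qed

end

end

section \<open>From the bmo condition and the increment bound to the square error\<close>

lemma relative_length_mono:
  fixes T :: real
  assumes "p \<le> q" "q < T" "r \<le> r'" "r' \<le> T"
  shows "(r - q) / (T - q) \<le> (r' - p) / (T - p)"
proof -
  have "(r - q) / (T - q) \<le> (r' - q) / (T - q)" using assms by (intro divide_right_mono) auto
  \<comment> \<open>In this form the relative length visibly increases when the left end moves away
    from \<open>T\<close>. The lemma passes the net-size bound from a cell to the part of it cut out
    by \<open>s\<close> and \<open>a\<close>.\<close>
  also have "\<dots> = 1 - (T - r') / (T - q)" using assms by (simp add: field_simps)
  also have "\<dots> \<le> 1 - (T - r') / (T - p)"
    using assms by (intro diff_left_mono divide_left_mono) auto
  also have "\<dots> = (r' - p) / (T - p)" using assms by (simp add: field_simps)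
  finally show ?thesis .
qed

lemma powr_scaled_length:
  fixes T :: real
  assumes "p < T" shows "x / (T - p) powr (1 - \<theta>) = x / (T - p) * (T - p) powr \<theta>"
  using assms by (simp add: powr_diff)

text \<open>The power on the right is taken at the larger point \<open>x\<close>. The mean value
  theorem would give a power of \<open>y\<close>, which for \<theta> < 1 is unbounded as
  \<open>y\<close> tends to 0, that is, for a cell that reaches up to \<open>T\<close>.\<close>

lemma powr_diff_le:
  fixes x y :: real
  assumes "0 < y" "y \<le> x" "\<theta> \<le> 1"
  shows "x powr \<theta> - y powr \<theta> \<le> (x - y) / x * x powr \<theta>"
proof -
  have "y * x powr (\<theta> - 1) \<le> y * y powr (\<theta> - 1)"
    using assms by (intro mult_left_mono powr_mono2') auto
  then have "y * (x powr \<theta> / x) \<le> y powr \<theta>" using assms by (simp add: powr_diff)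
  then show ?thesis using assms by (simp add: field_simps)
qed

lemma nn_integral_powr_le:
  fixes T :: real
  assumes "q \<le> r" "r < T" "0 < \<theta>" "\<theta> \<le> 1"
  shows "(\<integral>\<^sup>+u. indicator {q<..r} u * ennreal ((T - u) powr (\<theta> - 1)) \<partial>lborel)
    \<le> ennreal ((r - q) / (T - q) * (T - q) powr \<theta> / \<theta>)"
proof -
  have i: "set_integrable lborel {q..r} (\<lambda>u. (T - u) powr (\<theta> - 1))"
    using assms by (intro borel_integrable_atLeastAtMost' continuous_on_powr_diff)
  have "\<theta> * (LINT u:{q..r}|lborel. (T - u) powr (\<theta> - 1)) = (T - q) powr \<theta> - (T - r) powr \<theta>"
    using set_integral_powr_diff[of q r T \<theta>] assms by simp
  then have *: "(LINT u:{q..r}|lborel. (T - u) powr (\<theta> - 1)) = ((T - q) powr \<theta> - (T - r) powr \<theta>) / \<theta>"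
    using assms by (simp add: field_simps)
  have "(\<integral>\<^sup>+u. indicator {q<..r} u * ennreal ((T - u) powr (\<theta> - 1)) \<partial>lborel)
      \<le> (\<integral>\<^sup>+u. ennreal (indicator {q..r} u *\<^sub>R (T - u) powr (\<theta> - 1)) \<partial>lborel)"
    by (intro nn_integral_mono) (auto simp: indicator_def)
  also have "\<dots> = ennreal (LINT u:{q..r}|lborel. (T - u) powr (\<theta> - 1))"
    using i unfolding set_integrable_def set_lebesgue_integral_def
    by (intro nn_integral_eq_integral) auto
  also have "\<dots> \<le> ennreal ((r - q) / (T - q) * (T - q) powr \<theta> / \<theta>)"
    unfolding * using powr_diff_le[of "T - r" "T - q" \<theta>] assms by (intro ennreal_leI divide_right_mono) auto
  finally show ?thesis .
qed

lemma rl_weight_square: "(rl_weight T ((1 - \<theta>) / 2) u)\<^sup>2 = (T - u) powr (1 - \<theta>) / T powr (1 - \<theta>)"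
  by (simp only: rl_weight_def power_divide power2_eq_square powr_add[symmetric] field_sum_of_halves times_divide_times_eq)

context stochastic_basis
begin

abbreviation rl_energy :: "real \<Rightarrow> (real \<Rightarrow> 'a \<Rightarrow> real) \<Rightarrow> 'a set \<Rightarrow> real \<Rightarrow> real \<Rightarrow> real" where
  "rl_energy \<theta> X \<equiv> energy (\<lambda>t \<omega>. rl_path T ((1 - \<theta>) / 2) (\<lambda>u. X u \<omega>) t)"

context
  fixes X and \<theta> :: real assumes X: "l2_martingale X" and cad: "cadlag_process M T X"
    and \<theta>: "0 < \<theta>" "\<theta> \<le> 1"
begin

lemma l2_martingale_rl: "l2_martingale (\<lambda>t \<omega>. rl_path T ((1 - \<theta>) / 2) (\<lambda>u. X u \<omega>) t)"
  using \<theta> by (intro l2_martingale_R[OF X cad]) auto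

text \<open>The lower energy estimate on [q,u] is divided by the squared weight. The energy of the
  transform is then enlarged to [q,r], so that \<open>u\<close> is left only in a power that can be
  integrated explicitly.\<close>

lemma energy_le_rl_energy:
  assumes "0 \<le> q" "q \<le> u" "u \<le> r" "r < T" and A: "A \<in> sets (F q)"
  shows "energy X A q u \<le> T powr (1 - \<theta>) * (T - u) powr (\<theta> - 1) * rl_energy \<theta> X A q r"
proof -
  have "(T - u) powr (1 - \<theta>) / T powr (1 - \<theta>) * energy X A q u \<le> rl_energy \<theta> X A q u"
    using energy_R_ge[OF X cad, of "(1 - \<theta>) / 2" q u A] assms \<theta> T_pos by (simp add: rl_weight_square)
  also have "\<dots> \<le> rl_energy \<theta> X A q r"
    using assms by (intro energy_mono[OF l2_martingale_rl]) auto
  finally have "(T - u) powr (1 - \<theta>) * energy X A q u \<le> T powr (1 - \<theta>) * rl_energy \<theta> X A q r"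
    using T_pos by (simp add: field_simps)
  then have "(T - u) powr (\<theta> - 1) * ((T - u) powr (1 - \<theta>) * energy X A q u)
      \<le> (T - u) powr (\<theta> - 1) * (T powr (1 - \<theta>) * rl_energy \<theta> X A q r)"
    by (rule mult_left_mono) simp
  moreover have "(T - u) powr (\<theta> - 1) * ((T - u) powr (1 - \<theta>) * energy X A q u) = energy X A q u"
    using assms by (simp add: mult.assoc[symmetric] powr_add[symmetric])
  ultimately show ?thesis by (simp only: mult.assoc mult.left_commute)
qed

text \<open>On the cell containing \<open>s\<close> the net point lies before \<open>s\<close>, which costs the extra increment over
  \<open>[p, s]\<close>; everywhere else the error is dominated by the increment of the Riemann-Liouville process.\<close>
lemma cell_error_le:
  assumes DL: "\<And>p s A. 0 \<le> p \<Longrightarrow> p < s \<Longrightarrow> s < T \<Longrightarrow> A \<in> sets (F s) \<Longrightarrow>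
      energy X A p s \<le> K * ((T - p) powr \<theta> / (T - s)) * prob A"
    and K: "0 \<le> K" and s: "0 \<le> s" and r: "r < T" and A: "A \<in> sets (F s)"
    and p: "0 \<le> p" and q: "q = max s p" "q \<le> r" "r \<le> p'" "p' \<le> T"
    and N: "(p' - p) / (T - p) powr (1 - \<theta>) \<le> N"
  shows "(\<integral>\<^sup>+u. indicator {q<..r} u * ennreal (energy X A p u) \<partial>lborel)
    \<le> ennreal (T powr (1 - \<theta>) / \<theta> * N * rl_energy \<theta> X A q r + K * N * prob A * (if p < s then 1 else 0))"
proof -
  define D where "D = rl_energy \<theta> X A q r"
  define E where "E = energy X A p q"
  have D: "0 \<le> D" and E: "0 \<le> E" by (auto simp: D_def E_def)
  have qs: "0 \<le> q" "p \<le> q" "q < T" "s \<le> q" using s r q by auto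
  have Aq: "A \<in> sets (F q)" using sets_F_le[OF A qs(4)] .
  have len: "(r - q) / (T - q) \<le> (p' - p) / (T - p)"
    using qs q r by (intro relative_length_mono) auto
  have N': "(p' - p) / (T - p) * (T - p) powr \<theta> \<le> N"
    using N powr_scaled_length[of p T "p' - p" \<theta>] qs by simp
  have ptw: "energy X A p u \<le> T powr (1 - \<theta>) * D * (T - u) powr (\<theta> - 1) + E" if "u \<in> {q<..r}" for u
  proof -
    have "energy X A p u = energy X A p q + energy X A q u"
      using that qs p r by (intro energy_add[OF X] Aq) auto
    moreover have "energy X A q u \<le> T powr (1 - \<theta>) * (T - u) powr (\<theta> - 1) * rl_energy \<theta> X A q r"
      using that qs r by (intro energy_le_rl_energy Aq) auto
    ultimately show ?thesis by (simp add: D_def E_def mult_ac)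
  qed
  have "(\<integral>\<^sup>+u. indicator {q<..r} u * ennreal (energy X A p u) \<partial>lborel)
      \<le> (\<integral>\<^sup>+u. ennreal (T powr (1 - \<theta>) * D) * (indicator {q<..r} u * ennreal ((T - u) powr (\<theta> - 1)))
          + ennreal E * indicator {q<..r} u \<partial>lborel)"
  proof (intro nn_integral_mono)
    fix u
    show "indicator {q<..r} u * ennreal (energy X A p u)
      \<le> ennreal (T powr (1 - \<theta>) * D) * (indicator {q<..r} u * ennreal ((T - u) powr (\<theta> - 1))) + ennreal E * indicator {q<..r} u"
      using ennreal_leI[OF ptw, of u] D E
      by (cases "u \<in> {q<..r}") (auto simp: ennreal_mult ennreal_plus)
  qed
  also have "\<dots> = ennreal (T powr (1 - \<theta>) * D) * (\<integral>\<^sup>+u. indicator {q<..r} u * ennreal ((T - u) powr (\<theta> - 1)) \<partial>lborel)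
      + ennreal E * ennreal (r - q)"
    using q by (subst nn_integral_add) (auto simp: nn_integral_cmult nn_integral_cmult_indicator)
  also have "\<dots> \<le> ennreal (T powr (1 - \<theta>) * D) * ennreal ((r - q) / (T - q) * (T - q) powr \<theta> / \<theta>) + ennreal E * ennreal (r - q)"
    using q r \<theta> by (intro add_right_mono mult_left_mono nn_integral_powr_le) auto
  also have "\<dots> = ennreal (T powr (1 - \<theta>) * D * ((r - q) / (T - q) * (T - q) powr \<theta> / \<theta>) + E * (r - q))"
    using D E q qs \<theta> by (simp add: ennreal_mult[symmetric] ennreal_plus[symmetric] del: ennreal_plus)
  also have "\<dots> \<le> ennreal (T powr (1 - \<theta>) / \<theta> * N * D + K * N * prob A * (if p < s then 1 else 0))"
  proof (intro ennreal_leI add_mono)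
    have "(r - q) / (T - q) * (T - q) powr \<theta> \<le> (p' - p) / (T - p) * (T - p) powr \<theta>"
      using len qs q \<theta> by (intro mult_mono powr_mono2) auto
    with N' have "(r - q) / (T - q) * (T - q) powr \<theta> \<le> N" by simp
    then have "T powr (1 - \<theta>) * D * ((r - q) / (T - q) * (T - q) powr \<theta> / \<theta>) \<le> T powr (1 - \<theta>) * D * (N / \<theta>)"
      using D \<theta> by (intro mult_left_mono divide_right_mono) auto
    then show "T powr (1 - \<theta>) * D * ((r - q) / (T - q) * (T - q) powr \<theta> / \<theta>) \<le> T powr (1 - \<theta>) / \<theta> * N * D"
      by (simp add: mult_ac)
    show "E * (r - q) \<le> K * N * prob A * (if p < s then 1 else 0)"
    proof (cases "p < s")
      case True
      then have qs': "q = s" using q by simp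
      \<comment> \<open>Here q = s, so the denominator T - s of the hypothesis turns r - q into a
        relative length. That is at most the relative length of the whole cell, and with the factor
        (T - p) powr \<theta> it is bounded by the net size.\<close>
      have "E * (r - q) \<le> K * ((T - p) powr \<theta> / (T - s)) * prob A * (r - q)"
        unfolding E_def qs' using True p qs A q by (intro mult_right_mono DL) (auto simp: qs')
      also have "\<dots> = K * prob A * ((r - q) / (T - q) * (T - p) powr \<theta>)" by (simp add: qs')
      also have "\<dots> \<le> K * prob A * ((p' - p) / (T - p) * (T - p) powr \<theta>)"
        using K len by (intro mult_left_mono mult_right_mono) auto
      also have "\<dots> \<le> K * prob A * N" using K N' by (intro mult_left_mono) auto
      finally show ?thesis using True by (simp add: mult_ac)
    next
      case False
      then have "q = p" using q by simp
      then show ?thesis using False by (simp add: E_def)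
    qed
  qed
  finally show ?thesis by (simp add: D_def)
qed

lemma square_error_bound:
  assumes DR: "\<And>s a A. 0 \<le> s \<Longrightarrow> s \<le> a \<Longrightarrow> a < T \<Longrightarrow> A \<in> sets (F s) \<Longrightarrow> rl_energy \<theta> X A s a \<le> K' * prob A"
    and DL: "\<And>p s A. 0 \<le> p \<Longrightarrow> p < s \<Longrightarrow> s < T \<Longrightarrow> A \<in> sets (F s) \<Longrightarrow>
      energy X A p s \<le> K * ((T - p) powr \<theta> / (T - s)) * prob A"
    and K: "0 \<le> K" and net: "(n, t) \<in> time_nets T"
  shows "deterministic_bound (square_error X (n, t)) 1 ((T powr (1 - \<theta>) / \<theta> * K' + K) * net_size T \<theta> (n, t))"
  unfolding deterministic_bound_def
proof (intro allI impI)
  fix s a A assume s: "0 \<le> s" "s \<le> a" "a < T" and A: "A \<in> sets (F s)"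
  have AM: "A \<in> sets M" using s by (intro sets_F_imp_M[OF A]) auto
  define N where "N = net_size T \<theta> (n, t)"
  have N: "0 < N" unfolding N_def by (rule net_size_pos[OF net])
  define c where "c = (\<lambda>i. max s (min a (t i)))"
  have c: "s \<le> c i" "c i < T" for i using s by (auto simp: c_def)
  \<comment> \<open>\<open>V i\<close> accumulates the error bound up to the net point
    \<open>t i\<close>. Its second term jumps only over the cell with t (i - 1) \<le> s < t i, so
    the extra increment before \<open>s\<close> is paid for once and the sum over cells
    telescopes.\<close>
  define V where "V = (\<lambda>i. T powr (1 - \<theta>) / \<theta> * N * rl_energy \<theta> X A s (c i) + K * N * prob A * (if s < t i then 1 else 0))"
  have V_mono: "V (i - 1) \<le> V i" if i: "i \<in> {1..n}" for i
  proof -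
    have "t (i - 1) < t i" by (rule time_nets_bounds(2)[OF net i])
    then have "rl_energy \<theta> X A s (c (i - 1)) \<le> rl_energy \<theta> X A s (c i)"
      using c s A by (intro energy_mono[OF l2_martingale_rl]) (auto simp: c_def)
    then show ?thesis unfolding V_def using \<theta> N K \<open>t (i - 1) < t i\<close>
      by (intro add_mono mult_left_mono) auto
  qed
  have cell: "(\<integral>\<^sup>+u. indicator (net_cell t i \<inter> {s<..a}) u * ennreal (energy X A (t (i - 1)) u) \<partial>lborel) \<le> ennreal (V i - V (i - 1))"
    if i: "i \<in> {1..n}" for i
  proof -
    define p q r where "p = t (i - 1)" and "q = max s p" and "r = min a (t i)"
    note b = time_nets_bounds[OF net i, folded p_def]
    have S: "net_cell t i \<inter> {s<..a} = {q<..r}" by (auto simp: p_def q_def r_def)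
    show ?thesis
    proof (cases "q < r")
      case False
      then have "{q<..r} = {}" by auto
      then show ?thesis unfolding S by simp
    next
      case True
      then have cc: "c (i - 1) = q" "c i = r" using s b by (auto simp: c_def p_def q_def r_def)
      have "(\<integral>\<^sup>+u. indicator {q<..r} u * ennreal (energy X A p u) \<partial>lborel)
        \<le> ennreal (T powr (1 - \<theta>) / \<theta> * N * rl_energy \<theta> X A q r + K * N * prob A * (if p < s then 1 else 0))"
      proof (rule cell_error_le[OF DL K s(1) _ A b(1), where p'="t i"])
        show "(t i - p) / (T - p) powr (1 - \<theta>) \<le> N"
          unfolding N_def p_def by (rule net_size_upper[OF i])
      qed (use True s b in \<open>auto simp: q_def r_def\<close>)
      also have "\<dots> \<le> ennreal (V i - V (i - 1))"
      proof (intro ennreal_leI)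
        have "rl_energy \<theta> X A s r = rl_energy \<theta> X A s q + rl_energy \<theta> X A q r"
          using True s by (intro energy_add[OF l2_martingale_rl] sets_F_le[OF A]) (auto simp: q_def r_def)
        moreover have "K * N * prob A * (if p < s then 1 else 0)
            \<le> K * N * prob A * ((if s < t i then 1 else 0) - (if s < p then 1 else 0))"
          using True K N by (intro mult_left_mono) (auto simp: q_def r_def)
        ultimately show "T powr (1 - \<theta>) / \<theta> * N * rl_energy \<theta> X A q r + K * N * prob A * (if p < s then 1 else 0) \<le> V i - V (i - 1)"
          unfolding V_def cc p_def[symmetric] by (simp only: right_diff_distrib distrib_left)
      qed
      finally show ?thesis unfolding S p_def .
    qed
  qed
  have "(\<integral>\<^sup>+\<omega>. indicator A \<omega> * ennreal (\<bar>square_error X (n, t) a \<omega> - square_error X (n, t) s \<omega>\<bar> powr 1) \<partial>M)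
      \<le> (\<Sum>i=1..n. ennreal (V i - V (i - 1)))"
    unfolding square_error_energy[OF X cad net s AM] by (intro sum_mono cell)
  also have "\<dots> = ennreal (\<Sum>i=1..n. V i - V (i - 1))"
    using V_mono by (intro sum_ennreal) auto
  also have "(\<Sum>i=1..n. V i - V (i - 1)) = V n - V 0"
    using sum_telescope''[of 0 n V] by simp
  also have "ennreal (V n - V 0) \<le> ennreal ((T powr (1 - \<theta>) / \<theta> * K' + K) * N * prob A)"
  proof (intro ennreal_leI)
    have "0 \<le> V 0" unfolding V_def using N K \<theta> by (intro add_nonneg_nonneg mult_nonneg_nonneg) auto
    moreover have "V n \<le> T powr (1 - \<theta>) / \<theta> * N * (K' * prob A) + K * N * prob A * 1"
      unfolding V_def using N K \<theta> c s A by (intro add_mono mult_left_mono DR) auto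
    ultimately show "V n - V 0 \<le> (T powr (1 - \<theta>) / \<theta> * K' + K) * N * prob A"
      by (simp add: algebra_simps)
  qed
  also have "\<dots> \<le> ennreal ((T powr (1 - \<theta>) / \<theta> * K' + K) * N) * emeasure M A"
    by (cases "0 \<le> (T powr (1 - \<theta>) / \<theta> * K' + K) * N")
       (auto simp: emeasure_eq_measure ennreal_mult ennreal_neg mult_nonpos_nonneg)
  finally show "(\<integral>\<^sup>+\<omega>. indicator A \<omega> * ennreal (\<bar>square_error X (n, t) a \<omega> - square_error X (n, t) s \<omega>\<bar> powr 1) \<partial>M)
      \<le> ennreal ((T powr (1 - \<theta>) / \<theta> * K' + K) * net_size T \<theta> (n, t)) * emeasure M A"
    by (simp add: N_def)
qed

end

end

section \<open>Interlaced nets\<close>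

lemma powr_diff_upper:
  fixes y z p :: real
  assumes "0 \<le> z" "z \<le> y" "1 \<le> p"
  shows "y powr p - z powr p \<le> p * y powr (p - 1) * (y - z)"
proof (cases "z < y")
  case True
  have "continuous_on {z..y} (\<lambda>x. x powr p)"
    using assms by (intro continuous_on_powr' continuous_intros) auto
  moreover have D: "DERIV (\<lambda>x. x powr p) x :> p * x powr (p - 1)" if "z < x" for x
    using assms that by (intro has_real_derivative_powr) auto
  then have "(\<lambda>x. x powr p) differentiable (at x)" if "z < x" for x
    using that by (auto simp: real_differentiable_def)
  ultimately obtain l x where x: "z < x" "x < y" "DERIV (\<lambda>x. x powr p) x :> l"
      "y powr p - z powr p = (y - z) * l"
    using MVT[OF True, of "\<lambda>x. x powr p"] by blast
  have "l = p * x powr (p - 1)" using DERIV_unique[OF x(3) D[OF x(1)]] .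
  also have "\<dots> \<le> p * y powr (p - 1)"
    using x assms by (intro mult_left_mono powr_mono2) auto
  finally show ?thesis unfolding x(4) using True by (simp add: mult.commute)
qed (use assms in simp)

text \<open>The estimate follows from comparing z powr (p - 1) with y powr (p - 1). The power is
  again at the larger point; the mean value theorem would give a power of \<open>z\<close>, and
  \<open>z\<close> may be 0.\<close>

lemma powr_diff_lower:
  fixes y z p :: real
  assumes "0 \<le> z" "z \<le> y" "1 \<le> p"
  shows "y powr (p - 1) * (y - z) \<le> y powr p - z powr p"
proof (cases "z = 0")
  case True
  then show ?thesis using assms by (cases "y = 0") (auto simp: powr_diff)
next
  case False
  then have "z powr p = z powr (p - 1) * z" using assms by (simp add: powr_diff)
  also have "\<dots> \<le> y powr (p - 1) * z" using assms by (intro mult_right_mono powr_mono2) auto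
  finally have "z powr p \<le> y powr (p - 1) * z" .
  moreover have "y powr p = y powr (p - 1) * y" using assms False by (simp add: powr_diff)
  ultimately show ?thesis by (simp add: right_diff_distrib)
qed

text \<open>The exponent is chosen so that the step after \<open>t\<close> is comparable to \<open>(T - t) powr (1 - \<theta>) / N\<close>.\<close>
definition power_grid :: "real \<Rightarrow> real \<Rightarrow> nat \<Rightarrow> nat \<Rightarrow> real" where
  "power_grid T \<theta> N j = T - T * (1 - real j / real N) powr (1 / \<theta>)"

text \<open>For \<open>e = 0\<close> and \<open>e = 1\<close> these are the even and the odd grid points, with both end points added.\<close>
definition coarse_index :: "nat \<Rightarrow> nat \<Rightarrow> nat \<Rightarrow> nat" where
  "coarse_index N e i = min N (2 * i - e)"

context
  fixes T \<theta> :: real and N :: nat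
  assumes T: "0 < T" and \<theta>: "0 < \<theta>" "\<theta> \<le> 1" and N: "0 < N"
begin

lemma power_grid_0: "power_grid T \<theta> N 0 = 0"
  by (simp add: power_grid_def)

lemma power_grid_end: "power_grid T \<theta> N N = T"
  using N by (simp add: power_grid_def)

lemma power_grid_strict_mono:
  assumes "i < j" "j \<le> N" shows "power_grid T \<theta> N i < power_grid T \<theta> N j"
proof -
  have "0 \<le> 1 - real j / real N" "1 - real j / real N < 1 - real i / real N"
    using assms N by (auto simp: divide_strict_right_mono)
  then show ?thesis unfolding power_grid_def using T \<theta> by (simp add: powr_less_mono2)
qed

lemma power_grid_remaining:
  assumes "j < N"
  shows "(T - power_grid T \<theta> N j) powr (1 - \<theta>) = T powr (1 - \<theta>) * (1 - real j / real N) powr (1 / \<theta> - 1)"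
proof -
  have "1 / \<theta> * (1 - \<theta>) = 1 / \<theta> - 1" using \<theta> by (simp add: field_simps)
  then show ?thesis using T by (simp add: power_grid_def powr_mult powr_powr)
qed

lemma power_grid_step_le:
  assumes "j < j'" "j' \<le> j + 2" "j' \<le> N"
  shows "(power_grid T \<theta> N j' - power_grid T \<theta> N j) / (T - power_grid T \<theta> N j) powr (1 - \<theta>)
    \<le> 2 / \<theta> * T powr \<theta> / real N"
proof -
  let ?y = "1 - real j / real N" and ?z = "1 - real j' / real N"
  have y: "0 < ?y" and z: "0 \<le> ?z" "?z \<le> ?y" using assms N by (auto simp: field_simps)
  have "?y - ?z = (real j' - real j) / real N" by (simp add: diff_divide_distrib)
  also have "\<dots> \<le> 2 / real N" using assms by (intro divide_right_mono) auto
  finally have yz: "?y - ?z \<le> 2 / real N" .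
  have "?y powr (1 / \<theta>) - ?z powr (1 / \<theta>) \<le> 1 / \<theta> * ?y powr (1 / \<theta> - 1) * (?y - ?z)"
    using y z \<theta> by (intro powr_diff_upper) auto
  also have "\<dots> \<le> 1 / \<theta> * ?y powr (1 / \<theta> - 1) * (2 / real N)"
    using yz \<theta> by (intro mult_left_mono) auto
  finally have "T * (?y powr (1 / \<theta>) - ?z powr (1 / \<theta>)) \<le> T * (1 / \<theta> * ?y powr (1 / \<theta> - 1) * (2 / real N))"
    using T by (intro mult_left_mono) auto
  also have "T * (1 / \<theta> * ?y powr (1 / \<theta> - 1) * (2 / real N))
      = (2 / \<theta> * T powr \<theta> / real N) * (T powr (1 - \<theta>) * ?y powr (1 / \<theta> - 1))"
    using T by (simp add: powr_diff mult_ac)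
  finally have "power_grid T \<theta> N j' - power_grid T \<theta> N j
      \<le> (2 / \<theta> * T powr \<theta> / real N) * (T powr (1 - \<theta>) * ?y powr (1 / \<theta> - 1))"
    by (simp add: power_grid_def right_diff_distrib)
  then show ?thesis using assms T y by (simp only: power_grid_remaining) (simp add: pos_divide_le_eq)
qed

text \<open>An energy increment right after the grid point \<open>j\<close> carries the weight at
  \<open>j\<close> but is observed on the interval from \<open>j + 1\<close> to
  \<open>j + 2\<close>, so these two are compared. Since a step is left after \<open>j + 1\<close>,
  the remaining fraction at most halves from \<open>j\<close> to \<open>j + 1\<close>; this is the
  origin of the factor 2 powr (1 / \<theta> - 1).\<close>

lemma power_grid_step_ge:
  assumes "j + 2 \<le> N"
  shows "(T - power_grid T \<theta> N j) powr (1 - \<theta>)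
    \<le> 2 powr (1 / \<theta> - 1) / T powr \<theta> * real N * (power_grid T \<theta> N (j + 2) - power_grid T \<theta> N (j + 1))"
proof -
  let ?y = "1 - real j / real N" and ?y1 = "1 - real (j + 1) / real N" and ?y2 = "1 - real (j + 2) / real N"
  have y: "0 \<le> ?y" "0 \<le> ?y2" "?y2 \<le> ?y1" "?y \<le> 2 * ?y1" "?y1 - ?y2 = 1 / real N"
  proof -
    define x d where "x = real j / real N" and "d = 1 / real N"
    have e: "real (j + 1) / real N = x + d" "real (j + 2) / real N = x + 2 * d"
      by (simp_all add: x_def d_def add_divide_distrib)
    have "real (j + 2) / real N \<le> 1" using assms N by simp
    then have "x + 2 * d \<le> 1" "0 \<le> d" unfolding e by (auto simp: d_def)
    then show "0 \<le> ?y" "0 \<le> ?y2" "?y2 \<le> ?y1" "?y \<le> 2 * ?y1" "?y1 - ?y2 = 1 / real N"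
      unfolding e x_def[symmetric] d_def[symmetric] by simp_all
  qed
  have "?y powr (1 / \<theta> - 1) \<le> (2 * ?y1) powr (1 / \<theta> - 1)"
    using y \<theta> by (intro powr_mono2) auto
  also have "\<dots> = 2 powr (1 / \<theta> - 1) * ?y1 powr (1 / \<theta> - 1)"
    using y by (intro powr_mult)
  also have "\<dots> = 2 powr (1 / \<theta> - 1) * real N * (?y1 powr (1 / \<theta> - 1) * (?y1 - ?y2))"
    using N unfolding y(5) by simp
  also have "\<dots> \<le> 2 powr (1 / \<theta> - 1) * real N * (?y1 powr (1 / \<theta>) - ?y2 powr (1 / \<theta>))"
    using y \<theta> by (intro mult_left_mono powr_diff_lower) auto
  finally have "T powr (1 - \<theta>) * ?y powr (1 / \<theta> - 1)
      \<le> T powr (1 - \<theta>) * (2 powr (1 / \<theta> - 1) * real N * (?y1 powr (1 / \<theta>) - ?y2 powr (1 / \<theta>)))"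
    by (intro mult_left_mono) auto
  also have "\<dots> = 2 powr (1 / \<theta> - 1) / T powr \<theta> * real N * (T * (?y1 powr (1 / \<theta>) - ?y2 powr (1 / \<theta>)))"
    using T by (simp add: powr_diff mult_ac)
  also have "T * (?y1 powr (1 / \<theta>) - ?y2 powr (1 / \<theta>)) = power_grid T \<theta> N (j + 2) - power_grid T \<theta> N (j + 1)"
    by (simp add: power_grid_def right_diff_distrib)
  finally show ?thesis using assms by (simp only: power_grid_remaining)
qed

lemma coarse_net:
  assumes m: "N = 2 * m" and e: "e \<le> 1"
  shows "(m + e, power_grid T \<theta> N \<circ> coarse_index N e) \<in> time_nets T"
    and "net_size T \<theta> (m + e, power_grid T \<theta> N \<circ> coarse_index N e) \<le> 2 / \<theta> * T powr \<theta> / real N"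
proof -
  \<comment> \<open>Truncated subtraction and \<open>min\<close> produce the end points: for
    \<open>e = 1\<close> the first and the last cell consist of one grid interval, and all other
    cells of two.\<close>
  have step: "coarse_index N e (i - 1) < coarse_index N e i" "coarse_index N e i \<le> coarse_index N e (i - 1) + 2"
      "coarse_index N e i \<le> N" if "i \<in> {1..m + e}" for i
    using that m e N by (auto simp: coarse_index_def)
  have ends: "coarse_index N e 0 = 0" "coarse_index N e (m + e) = N"
    using m e by (auto simp: coarse_index_def)
  show net: "(m + e, power_grid T \<theta> N \<circ> coarse_index N e) \<in> time_nets T"
    unfolding time_nets_def
  proof (clarsimp, intro conjI ballI)
    show "Suc 0 \<le> m + e" using N m by simp
    show "power_grid T \<theta> N (coarse_index N e 0) = 0" "power_grid T \<theta> N (coarse_index N e (m + e)) = T"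
      unfolding ends by (rule power_grid_0 power_grid_end)+
    fix i assume "i \<in> {Suc 0..m + e}"
    then show "power_grid T \<theta> N (coarse_index N e (i - Suc 0)) < power_grid T \<theta> N (coarse_index N e i)"
      using step[of i] by (intro power_grid_strict_mono) auto
  qed
  show "net_size T \<theta> (m + e, power_grid T \<theta> N \<circ> coarse_index N e) \<le> 2 / \<theta> * T powr \<theta> / real N"
    by (rule net_size_le[OF net]) (unfold o_def, intro power_grid_step_le step)
qed

lemma coarse_cell:
  assumes "even (j + e)" "j + 2 \<le> N" "e \<le> 1"
  shows "coarse_index N e ((j + e) div 2 + 1) = j + 2" "coarse_index N e ((j + e) div 2) = j"
  using assms by (auto simp: coarse_index_def elim!: evenE)

end

text \<open>Keeping \<open>a\<close> below the last two grid steps ensures that every grid interval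
  starting before \<open>a\<close> is followed by another one that ends before \<open>T\<close>. The
  number of steps is even, as \<open>coarse_net\<close> requires.\<close>

lemma exists_power_grid:
  assumes T: "0 < T" and \<theta>: "0 < \<theta>" and a: "a < T"
  obtains N m where "0 < N" "N = 2 * m" "2 \<le> N" "a \<le> power_grid T \<theta> N (N - 2)"
proof -
  have "((\<lambda>n. T - T * (inverse (real (Suc n))) powr (1 / \<theta>)) \<longlongrightarrow> T - T * 0 powr (1 / \<theta>)) sequentially"
    using \<theta> by (intro tendsto_intros tendsto_powr' LIMSEQ_inverse_real_of_nat) auto
  then have "((\<lambda>n. T - T * (inverse (real (Suc n))) powr (1 / \<theta>)) \<longlongrightarrow> T) sequentially" by simp
  then have "\<forall>\<^sub>F n in sequentially. a < T - T * (inverse (real (Suc n))) powr (1 / \<theta>)"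
    by (rule order_tendstoD(1)) (use a in simp)
  then obtain n where n: "a < T - T * (inverse (real (Suc n))) powr (1 / \<theta>)"
    by (auto simp: eventually_sequentially)
  have "1 - real (2 * Suc n - 2) / real (2 * Suc n) = inverse (real (Suc n))"
    by (simp add: field_simps)
  then have "a \<le> power_grid T \<theta> (2 * Suc n) (2 * Suc n - 2)" using n by (simp only: power_grid_def)
  then show thesis by (intro that[of "2 * Suc n" "Suc n"]) auto
qed

text \<open>The last cell (s,T] alone contributes (T - s) powr \<theta> to the net size. Equal cells
  on [0,s] of length at most T - s do not exceed this: their numerators are no larger and their
  denominators no smaller.\<close>

lemma uniform_net:
  assumes T: "0 < T" and s: "0 \<le> s" "s < T" and \<theta>: "0 < \<theta>" "\<theta> \<le> 1"
  obtains n t where "(Suc n, t) \<in> time_nets T" "t n = s" "t (Suc n) = T" "net_size T \<theta> (Suc n, t) \<le> (T - s) powr \<theta>"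
proof (cases "s = 0")
  case True
  define t :: "nat \<Rightarrow> real" where "t = (\<lambda>i. if i = 0 then 0 else T)"
  have net: "(Suc 0, t) \<in> time_nets T" using T by (auto simp: time_nets_def t_def)
  have "net_size T \<theta> (Suc 0, t) \<le> (T - s) powr \<theta>"
    by (rule net_size_le[OF net]) (use T True in \<open>auto simp: t_def powr_diff\<close>)
  with net show thesis using True by (intro that[of 0 t]) (auto simp: t_def)
next
  case False
  with s have s0: "0 < s" by simp
  obtain n :: nat where n: "s / (T - s) < real n" using reals_Archimedean2 by blast
  then have n0: "0 < real n" using s0 s by (meson divide_pos_pos diff_gt_0_iff_gt less_trans)
  have sn: "s / real n \<le> T - s" using n n0 s by (simp add: field_simps)
  define t where "t = (\<lambda>i. if i \<le> n then real i * (s / real n) else T)"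
  have tn: "t n = s" "t (Suc n) = T" "t 0 = 0" using n0 by (auto simp: t_def)
  have ts: "t (i - 1) \<le> s" "t i - t (i - 1) \<le> T - s" "t (i - 1) < t i" if i: "i \<in> {1..Suc n}" for i
  proof -
    have "real (i - 1) * (s / real n) \<le> real n * (s / real n)"
      using i s0 by (intro mult_right_mono) auto
    then show 1: "t (i - 1) \<le> s" using i n0 by (auto simp: t_def)
    show "t i - t (i - 1) \<le> T - s" "t (i - 1) < t i"
    proof -
      consider "i \<le> n" | "i = Suc n" using i by fastforce
      then have "t i - t (i - 1) \<le> T - s \<and> t (i - 1) < t i"
      proof cases
        case 1
        then have "t i = real i * (s / real n)" "t (i - 1) = (real i - 1) * (s / real n)"
          using i by (auto simp: t_def of_nat_diff)
        then have "t i - t (i - 1) = s / real n" by (simp only: left_diff_distrib[symmetric]) simp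
        moreover have "0 < s / real n" using s0 n0 by simp
        ultimately show ?thesis using sn by linarith
      qed (use tn s in simp)
      then show "t i - t (i - 1) \<le> T - s" "t (i - 1) < t i" by auto
    qed
  qed
  have net: "(Suc n, t) \<in> time_nets T" using ts(3) tn by (auto simp: time_nets_def)
  have "net_size T \<theta> (Suc n, t) \<le> (T - s) powr \<theta>"
  proof (rule net_size_le[OF net])
    fix i assume i: "i \<in> {1..Suc n}"
    have "(t i - t (i - 1)) / (T - t (i - 1)) powr (1 - \<theta>) \<le> (T - s) / (T - s) powr (1 - \<theta>)"
      using ts[OF i] s \<theta> by (intro frac_le powr_mono2) auto
    then show "(t i - t (i - 1)) / (T - t (i - 1)) powr (1 - \<theta>) \<le> (T - s) powr \<theta>"
      using s by (simp add: powr_diff)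
  qed
  with net tn show thesis by (intro that[of n t]) auto
qed

section \<open>From the square error to the increment bound and to the bmo condition\<close>

context stochastic_basis
begin

context
  fixes X and \<theta> :: real assumes X: "l2_martingale X" and cad: "cadlag_process M T X"
    and \<theta>: "0 < \<theta>" "\<theta> \<le> 1"
  fixes K :: real assumes K: "0 \<le> K"
    and bound: "\<And>n t. (n, t) \<in> time_nets T \<Longrightarrow>
      deterministic_bound (square_error X (n, t)) 1 (K * net_size T \<theta> (n, t))"
begin

lemma cell_sum_le:
  assumes net: "(n, t) \<in> time_nets T" and s: "0 \<le> s" "s \<le> a" "a < T" and A: "A \<in> sets (F s)"
  shows "(\<Sum>i=1..n. \<integral>\<^sup>+u. indicator (net_cell t i \<inter> {s<..a}) u * ennreal (energy X A (t (i - 1)) u) \<partial>lborel)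
    \<le> ennreal (K * net_size T \<theta> (n, t) * prob A)"
proof -
  have AM: "A \<in> sets M" using s by (intro sets_F_imp_M[OF A]) auto
  have "0 \<le> K * net_size T \<theta> (n, t)" using K net_size_pos[OF net, of \<theta>] by simp
  then have "ennreal (K * net_size T \<theta> (n, t)) * emeasure M A = ennreal (K * net_size T \<theta> (n, t) * prob A)"
    unfolding emeasure_eq_measure by (intro ennreal_mult[symmetric]) auto
  with bound[OF net, unfolded deterministic_bound_def, rule_format, OF s A] show ?thesis
    unfolding square_error_energy[OF X cad net s AM] by (simp only:)
qed

text \<open>The square error is conditioned at \<open>a\<close>, although the last net point
  \<open>s\<close> is earlier: throughout (a,T) the error contains the increment over [s,a]. Events
  of \<open>F a\<close>, and not merely of \<open>F s\<close>, are what makes a pointwise bound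
  possible.\<close>

lemma increment_energy_le:
  assumes s: "0 \<le> s" "s < a" "a < T" and A: "A \<in> sets (F a)"
  shows "energy X A s a \<le> 2 * K * ((T - s) powr \<theta> / (T - a)) * prob A"
proof -
  obtain n t where net: "(Suc n, t) \<in> time_nets T" and t: "t n = s" "t (Suc n) = T"
    and size: "net_size T \<theta> (Suc n, t) \<le> (T - s) powr \<theta>"
    using uniform_net[OF T_pos s(1) _ \<theta>] s by (metis less_trans)
  \<comment> \<open>The midpoint leaves an interval of length (T - a) / 2 for the time integral,
    which accounts for the factor 2 in the bound.\<close>
  define b where "b = (a + T) / 2"
  have b: "a < b" "b < T" using s by (auto simp: b_def)
  have cell: "net_cell t (Suc n) \<inter> {a<..b} = {a<..b}" using t s b by auto
  have "ennreal (energy X A s a * (b - a)) = (\<integral>\<^sup>+u. ennreal (energy X A s a) * indicator {a<..b} u \<partial>lborel)"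
    using b by (subst nn_integral_cmult_indicator) (auto simp: ennreal_mult)
  also have "\<dots> \<le> (\<integral>\<^sup>+u. indicator {a<..b} u * ennreal (energy X A s u) \<partial>lborel)"
  proof (intro nn_integral_mono)
    fix u
    show "ennreal (energy X A s a) * indicator {a<..b} u \<le> indicator {a<..b} u * ennreal (energy X A s u)"
    proof (cases "u \<in> {a<..b}")
      case True
      then have "energy X A s u = energy X A s a + energy X A a u"
        using s b A by (intro energy_add[OF X]) auto
      then show ?thesis using True by (auto intro!: ennreal_leI)
    qed simp
  qed
  \<comment> \<open>Only the last cell, which starts at \<open>s\<close>, is needed from the sum; it
    contains all of (a,b].\<close>
  also have "\<dots> \<le> (\<Sum>i=1..Suc n. \<integral>\<^sup>+u. indicator (net_cell t i \<inter> {a<..b}) u * ennreal (energy X A (t (i - 1)) u) \<partial>lborel)"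
    using cell t member_le_sum[of "Suc n" "{1..Suc n}"
      "\<lambda>i. \<integral>\<^sup>+u. indicator (net_cell t i \<inter> {a<..b}) u * ennreal (energy X A (t (i - 1)) u) \<partial>lborel"] by simp
  also have "\<dots> \<le> ennreal (K * net_size T \<theta> (Suc n, t) * prob A)"
    using s b A by (intro cell_sum_le[OF net]) auto
  also have "\<dots> \<le> ennreal (K * (T - s) powr \<theta> * prob A)"
    using size K by (intro ennreal_leI mult_right_mono mult_left_mono) auto
  finally have "energy X A s a * (b - a) \<le> K * (T - s) powr \<theta> * prob A"
    using K by (subst (asm) ennreal_le_iff) auto
  moreover have "b - a = (T - a) / 2" by (simp add: b_def)
  ultimately show ?thesis using s by (simp add: field_simps)
qed

text \<open>The squared increment is itself \<open>F a\<close>-measurable, so bounds for its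
  integrals over the events of \<open>F a\<close> become an almost sure bound.\<close>

lemma increment_bound:
  assumes s: "0 \<le> s" "s < a" "a < T"
  shows "AE \<omega> in M. \<bar>X a \<omega> - X s \<omega>\<bar> \<le> sqrt (2 * K) * ((T - s) powr (\<theta> / 2) / (T - a) powr (1 / 2))"
proof -
  have Xm: "X a \<in> borel_measurable (F a)" "X s \<in> borel_measurable (F a)"
    using s by (auto intro!: measurable_F_mono[OF l2_martingaleD(1)[OF X]])
  let ?B = "2 * K * ((T - s) powr \<theta> / (T - a))"
  have "AE \<omega> in M. ennreal ((X a \<omega> - X s \<omega>)\<^sup>2) \<le> ennreal ?B"
  proof (rule AE_le_of_nn_integral_le[OF subalgebra_F[of a]])
    show "(\<lambda>\<omega>. ennreal ((X a \<omega> - X s \<omega>)\<^sup>2)) \<in> borel_measurable (F a)" using Xm by measurable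
    fix A assume A: "A \<in> sets (F a)"
    then have "A \<in> sets M" using s by (intro sets_F_imp_M[of _ a]) auto
    then have "(\<integral>\<^sup>+\<omega>. indicator A \<omega> * ennreal ((X a \<omega> - X s \<omega>)\<^sup>2) \<partial>M) = ennreal (energy X A s a)"
      using s by (intro energy_nn_integral[OF X]) auto
    also have "\<dots> \<le> ennreal (?B * prob A)" by (intro ennreal_leI increment_energy_le s A)
    also have "\<dots> = ennreal ?B * emeasure M A"
      unfolding emeasure_eq_measure using K s by (intro ennreal_mult) auto
    finally show "(\<integral>\<^sup>+\<omega>. indicator A \<omega> * ennreal ((X a \<omega> - X s \<omega>)\<^sup>2) \<partial>M) \<le> ennreal ?B * emeasure M A" .
  qed (use s in simp)
  then show ?thesis
  proof eventually_elim
    case (elim \<omega>)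
    have "0 \<le> ?B" using K s by simp
    then have "(X a \<omega> - X s \<omega>)\<^sup>2 \<le> ?B" using elim by (subst (asm) ennreal_le_iff) auto
    then have "\<bar>X a \<omega> - X s \<omega>\<bar> \<le> sqrt ?B" by (metis real_sqrt_abs real_sqrt_le_mono)
    also have "\<dots> = sqrt (2 * K) * (sqrt ((T - s) powr \<theta>) / sqrt (T - a))"
      by (simp add: real_sqrt_mult real_sqrt_divide)
    also have "sqrt ((T - s) powr \<theta>) = (T - s) powr (\<theta> / 2)"
      using s by (simp add: powr_half_sqrt[symmetric] powr_powr)
    also have "sqrt (T - a) = (T - a) powr (1 / 2)" using s by (simp add: powr_half_sqrt)
    finally show ?case .
  qed
qed

text \<open>A jump of the energy over \<open>[\<sigma> j, \<sigma> (j+1)]\<close> is seen on all of \<open>[\<sigma> (j+1), \<sigma> (j+2)]\<close> by the coarse net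
  that does not contain \<open>\<sigma> (j+1)\<close>; the two nets together see all jumps.\<close>
lemma rl_energy_le:
  assumes s: "0 \<le> s" "s \<le> a" "a < T" and A: "A \<in> sets (F s)"
  shows "rl_energy \<theta> X A s a \<le> 4 * 2 powr (1 / \<theta> - 1) * K / (\<theta> * T powr (1 - \<theta>)) * prob A"
proof -
  obtain N m where N: "0 < N" "N = 2 * m" "2 \<le> N" "a \<le> power_grid T \<theta> N (N - 2)"
    using exists_power_grid[OF T_pos \<theta>(1) s(3)] .
  note grid = power_grid_0[OF T_pos \<theta> N(1)] power_grid_end[OF T_pos \<theta> N(1)]
  define \<sigma> where "\<sigma> = power_grid T \<theta> N"
  have \<sigma>_less: "\<sigma> i < \<sigma> j" if "i < j" "j \<le> N" for i j
    unfolding \<sigma>_def using power_grid_strict_mono[OF T_pos \<theta> N(1) that] .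
  have \<sigma>_le: "\<sigma> i \<le> \<sigma> j" if "i \<le> j" "j \<le> N" for i j
    using \<sigma>_less[of i j] that by (cases "i = j") auto
  have \<sigma>_bounds: "0 \<le> \<sigma> j" if "j \<le> N" for j using \<sigma>_le[of 0 j] that grid by (simp add: \<sigma>_def)
  have \<sigma>_lt: "\<sigma> j < T" if "j < N" for j using \<sigma>_less[of j N] that grid by (simp add: \<sigma>_def)
  define c where "c = (\<lambda>j. max s (min a (\<sigma> j)))"
  define E where "E = (\<lambda>j. energy X A (c j) (c (Suc j)))"
  \<comment> \<open>\<open>C\<close> comes from \<open>power_grid_step_ge\<close> and
    \<open>H\<close> from the net size in \<open>coarse_net\<close>. The product
    \<open>C * H\<close> does not contain \<open>N\<close>, so the dependence of the grid on
    \<open>a\<close> disappears from the final constant.\<close>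
  define C where "C = 2 powr (1 / \<theta> - 1) / T powr \<theta> * real N"
  define H where "H = 2 / \<theta> * T powr \<theta> / real N"
  have c: "s \<le> c j" "c j \<le> a" "c j < T" "0 \<le> c j" for j using s by (auto simp: c_def)
  have c_mono: "c j \<le> c (Suc j)" if "j < N" for j using \<sigma>_le[of j "Suc j"] that by (auto simp: c_def)
  have c_ends: "c 0 = s" "c N = a" using s grid by (auto simp: c_def \<sigma>_def)
  have Ac: "A \<in> sets (F (c j))" for j using sets_F_le[OF A c(1)] .
  \<comment> \<open>After clipping to [s,a], the only increments that can be nonzero belong to grid
    intervals meeting [s,a]. By the choice of \<open>N\<close>, the statement \<open>active\<close>
    below places the grid interval that follows each of them before \<open>T\<close>.\<close>
  have E0: "0 \<le> E j" for j by (simp add: E_def)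
  have active: "j + 2 < N" "\<sigma> j \<le> c j" "s < \<sigma> (j + 1)" "c (Suc j) \<le> \<sigma> (j + 1)"
    if j: "j < N" "c j \<noteq> c (Suc j)" for j
  proof -
    have "c j < c (Suc j)" using c_mono[OF j(1)] j(2) by simp
    then have *: "\<sigma> j < a" "s < \<sigma> (Suc j)" by (auto simp: c_def max_def min_def split: if_splits)
    show "j + 2 < N"
    proof (rule ccontr)
      assume "\<not> j + 2 < N"
      then have "\<sigma> (N - 2) \<le> \<sigma> j" using j(1) by (intro \<sigma>_le) auto
      with *(1) N(4) show False by (simp add: \<sigma>_def)
    qed
    show "\<sigma> j \<le> c j" "s < \<sigma> (j + 1)" "c (Suc j) \<le> \<sigma> (j + 1)" using * by (auto simp: c_def)
  qed
  have G: "(\<Sum>j\<in>{j. j + 2 < N \<and> even (j + e)}. (\<sigma> (j + 2) - \<sigma> (j + 1)) * E j) \<le> K * H * prob A"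
    if e: "e \<le> 1" for e
  proof -
    let ?S = "{j. j + 2 < N \<and> even (j + e)}"
    define t where "t = \<sigma> \<circ> coarse_index N e"
    \<comment> \<open>An increment is observed on the grid interval after it, which may extend
      beyond \<open>a\<close>. The time \<open>b\<close> is late enough for all these intervals and
      still before \<open>T\<close>.\<close>
    define b where "b = \<sigma> (N - 1)"
    have net: "(m + e, t) \<in> time_nets T" and size: "net_size T \<theta> (m + e, t) \<le> H"
      unfolding t_def \<sigma>_def H_def using coarse_net[OF T_pos \<theta> N(1,2) e] by auto
    have "a \<le> \<sigma> (N - 2)" using N(4) by (simp add: \<sigma>_def)
    also have "\<dots> \<le> b" unfolding b_def by (intro \<sigma>_le) auto
    finally have b: "a \<le> b" "b < T" using N(1) \<sigma>_lt[of "N - 1"] by (auto simp: b_def)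
    let ?Q = "\<lambda>i. \<integral>\<^sup>+u. indicator (net_cell t i \<inter> {s<..b}) u * ennreal (energy X A (t (i - 1)) u) \<partial>lborel"
    have fin: "finite ?S" by (rule finite_subset[of _ "{..N}"]) auto
    have cell_le: "ennreal ((\<sigma> (j + 2) - \<sigma> (j + 1)) * E j) \<le> ?Q ((j + e) div 2 + 1)" if j: "j \<in> ?S" for j
    proof (cases "c j = c (Suc j)")
      case True
      then show ?thesis by (simp add: E_def)
    next
      case False
      have jN: "j < N" "j + 2 \<le> N" using j by auto
      note act = active[OF jN(1) False]
      have "coarse_index N e ((j + e) div 2 + 1) = j + 2" "coarse_index N e ((j + e) div 2) = j"
        using coarse_cell[OF T_pos \<theta> N(1), of j e] j e by auto
      then have tt: "t ((j + e) div 2 + 1) = \<sigma> (j + 2)" "t ((j + e) div 2 + 1 - 1) = \<sigma> j"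
        by (auto simp: t_def)
      have le: "\<sigma> j < \<sigma> (j + 1)" "\<sigma> (j + 1) < \<sigma> (j + 2)" "\<sigma> (j + 2) \<le> b"
        unfolding b_def using j by (auto intro!: \<sigma>_less \<sigma>_le)
      have "ennreal ((\<sigma> (j + 2) - \<sigma> (j + 1)) * E j) = (\<integral>\<^sup>+u. ennreal (E j) * indicator {\<sigma> (j + 1)<..\<sigma> (j + 2)} u \<partial>lborel)"
        using le E0[of j] by (subst nn_integral_cmult_indicator) (auto simp: ennreal_mult mult.commute)
      also have "\<dots> \<le> ?Q ((j + e) div 2 + 1)"
        unfolding tt
      proof (intro nn_integral_mono)
        fix u
        show "ennreal (E j) * indicator {\<sigma> (j + 1)<..\<sigma> (j + 2)} u
          \<le> indicator ({\<sigma> j<..\<sigma> (j + 2)} \<inter> {s<..b}) u * ennreal (energy X A (\<sigma> j) u)"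
        proof (cases "u \<in> {\<sigma> (j + 1)<..\<sigma> (j + 2)}")
          case True
          have "E j \<le> energy X A (\<sigma> j) u"
            unfolding E_def using True act le b c_mono[OF jN(1)] \<sigma>_bounds[of j] jN Ac
            by (intro energy_mono[OF X]) auto
          then show ?thesis using True act le by (auto intro!: ennreal_leI)
        qed simp
      qed
      finally show ?thesis .
    qed
    have inj: "inj_on (\<lambda>j. (j + e) div 2 + 1) ?S"
    proof (rule inj_onI)
      fix x y assume xy: "x \<in> ?S" "y \<in> ?S" "(x + e) div 2 + 1 = (y + e) div 2 + 1"
      then have "even (x + e)" "even (y + e)" by blast+
      then have "2 * ((x + e) div 2) = x + e" "2 * ((y + e) div 2) = y + e"
        by (metis dvd_mult_div_cancel)+
      then show "x = y" using xy(3) by linarith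
    qed
    have sub: "(\<lambda>j. (j + e) div 2 + 1) ` ?S \<subseteq> {1..m + e}" using N(2) by auto
    have "ennreal (\<Sum>j\<in>?S. (\<sigma> (j + 2) - \<sigma> (j + 1)) * E j) = (\<Sum>j\<in>?S. ennreal ((\<sigma> (j + 2) - \<sigma> (j + 1)) * E j))"
      using \<sigma>_le E0 by (intro sum_ennreal[symmetric] mult_nonneg_nonneg) auto
    also have "\<dots> \<le> (\<Sum>j\<in>?S. ?Q ((j + e) div 2 + 1))" by (intro sum_mono cell_le)
    also have "\<dots> = (\<Sum>i\<in>(\<lambda>j. (j + e) div 2 + 1) ` ?S. ?Q i)" by (subst sum.reindex[OF inj]) simp
    also have "\<dots> \<le> (\<Sum>i=1..m + e. ?Q i)" by (intro sum_mono2 sub) auto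
    also have "\<dots> \<le> ennreal (K * net_size T \<theta> (m + e, t) * prob A)"
      using s b A by (intro cell_sum_le[OF net]) auto
    also have "\<dots> \<le> ennreal (K * H * prob A)"
      using size K by (intro ennreal_leI mult_right_mono mult_left_mono) auto
    finally show ?thesis using K \<theta> by (subst (asm) ennreal_le_iff) (auto simp: H_def)
  qed
  have step_le: "rl_energy \<theta> X A s (c (Suc j)) - rl_energy \<theta> X A s (c j)
      \<le> C / T powr (1 - \<theta>) * (if j + 2 < N then (\<sigma> (j + 2) - \<sigma> (j + 1)) * E j else 0)" if j: "j < N" for j
  proof (cases "c j = c (Suc j)")
    case True
    then show ?thesis by (simp add: E_def)
  next
    case False
    note act = active[OF j False]
    have "rl_energy \<theta> X A s (c (Suc j)) = rl_energy \<theta> X A s (c j) + rl_energy \<theta> X A (c j) (c (Suc j))"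
      using s c c_mono[OF j] Ac by (intro energy_add[OF l2_martingale_rl[OF X cad \<theta>]]) auto
    moreover have "rl_energy \<theta> X A (c j) (c (Suc j)) \<le> (T - c j) powr (1 - \<theta>) / T powr (1 - \<theta>) * E j"
      using energy_R_le[OF X cad, of "(1 - \<theta>) / 2" "c j" "c (Suc j)" A] \<theta> c c_mono[OF j] Ac T_pos
      by (simp add: rl_weight_square E_def)
    \<comment> \<open>The weight is moved back from the clipped time to the grid point, where it can
      be compared with the length of the following grid interval.\<close>
    moreover have "(T - c j) powr (1 - \<theta>) / T powr (1 - \<theta>) * E j \<le> (T - \<sigma> j) powr (1 - \<theta>) / T powr (1 - \<theta>) * E j"
      using act c[of j] \<theta> E0 by (intro mult_right_mono divide_right_mono powr_mono2) auto
    moreover have "(T - \<sigma> j) powr (1 - \<theta>) / T powr (1 - \<theta>) * E j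
        \<le> C * (\<sigma> (j + 2) - \<sigma> (j + 1)) / T powr (1 - \<theta>) * E j"
      unfolding C_def \<sigma>_def using act E0
      by (intro mult_right_mono divide_right_mono power_grid_step_ge[OF T_pos \<theta> N(1)]) auto
    ultimately show ?thesis using act by (simp add: mult_ac)
  qed
  have "rl_energy \<theta> X A s a = (\<Sum>j<N. rl_energy \<theta> X A s (c (Suc j)) - rl_energy \<theta> X A s (c j))"
    using sum_lessThan_telescope[of "\<lambda>j. rl_energy \<theta> X A s (c j)" N] by (simp add: c_ends)
  also have "\<dots> \<le> (\<Sum>j<N. C / T powr (1 - \<theta>) * (if j + 2 < N then (\<sigma> (j + 2) - \<sigma> (j + 1)) * E j else 0))"
    by (intro sum_mono step_le) auto
  also have "\<dots> = C / T powr (1 - \<theta>) * (\<Sum>j\<in>{j. j + 2 < N}. (\<sigma> (j + 2) - \<sigma> (j + 1)) * E j)"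
    unfolding sum_distrib_left[symmetric] by (intro arg_cong2[where f="(*)"] refl sum.mono_neutral_cong_right) auto
  also have "(\<Sum>j\<in>{j. j + 2 < N}. (\<sigma> (j + 2) - \<sigma> (j + 1)) * E j)
      = (\<Sum>j\<in>{j. j + 2 < N \<and> even (j + 0)}. (\<sigma> (j + 2) - \<sigma> (j + 1)) * E j)
        + (\<Sum>j\<in>{j. j + 2 < N \<and> even (j + 1)}. (\<sigma> (j + 2) - \<sigma> (j + 1)) * E j)"
  proof -
    have "finite {j. j + 2 < N}" by (rule finite_subset[of _ "{..N}"]) auto
    then show ?thesis by (subst sum.union_disjoint[symmetric]) (auto intro!: sum.cong)
  qed
  also have "C / T powr (1 - \<theta>) * \<dots> \<le> C / T powr (1 - \<theta>) * (K * H * prob A + K * H * prob A)"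
    by (intro mult_left_mono add_mono G) (auto simp: C_def)
  also have "\<dots> = 4 * 2 powr (1 / \<theta> - 1) * K / (\<theta> * T powr (1 - \<theta>)) * prob A"
    using N(1) T_pos \<theta> by (simp add: C_def H_def field_simps)
  finally show ?thesis .
qed

end

end

section \<open>The two assertions in terms of energies, and the equivalence\<close>

lemma cadlag_cong:
  assumes f: "cadlag T f" and eq: "\<And>t. 0 \<le> t \<Longrightarrow> t < T \<Longrightarrow> f t = g t"
  shows "cadlag T g"
  unfolding cadlag_def
proof (intro conjI ballI)
  fix t assume t: "t \<in> {0..<T}"
  have "\<forall>\<^sub>F u in at_right t. f u = g u"
    unfolding eventually_at_right_field using t eq by (intro exI[of _ T]) auto
  moreover have "(f \<longlongrightarrow> f t) (at_right t)" using f t by (auto simp: cadlag_def)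
  ultimately show "(g \<longlongrightarrow> g t) (at_right t)" using eq[of t] t by (simp add: tendsto_cong)
next
  fix t assume t: "t \<in> {0<..<T}"
  have "\<forall>\<^sub>F u in at_left t. f u = g u"
    unfolding eventually_at_left_field using t eq by (intro exI[of _ 0]) auto
  moreover obtain l where "(f \<longlongrightarrow> l) (at_left t)" using f t unfolding cadlag_def by blast
  ultimately show "\<exists>l. (g \<longlongrightarrow> l) (at_left t)" using tendsto_cong by blast
qed

context stochastic_basis
begin

context
  fixes X and \<theta> :: real assumes X: "l2_martingale X" and cad: "cadlag_process M T X"
    and \<theta>: "0 < \<theta>" "\<theta> \<le> 1"
begin

private definition Y :: "real \<Rightarrow> 'a \<Rightarrow> real" where
  "Y = (\<lambda>t \<omega>. riemann_liouville T ((1 - \<theta>) / 2) (\<lambda>u. X u \<omega>) t - X 0 \<omega>)"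

private lemma Y_eq:
  assumes "\<omega> \<in> space M" "0 \<le> t" "t < T"
  shows "Y t \<omega> = rl_path T ((1 - \<theta>) / 2) (\<lambda>u. X u \<omega>) t - X 0 \<omega>"
  unfolding Y_def using assms cadlag_processD[OF cad] \<theta> by (subst riemann_liouville_eq_rl_path) auto

private lemma Y_measurable_F:
  assumes t: "0 \<le> t" "t < T" shows "Y t \<in> borel_measurable (F t)"
proof -
  have [measurable]: "X 0 \<in> borel_measurable (F t)"
    using t T_pos by (intro measurable_F_mono[OF l2_martingaleD(1)[OF X]]) auto
  have [measurable]: "(\<lambda>\<omega>. rl_path T ((1 - \<theta>) / 2) (\<lambda>u. X u \<omega>) t) \<in> borel_measurable (F t)"
    by (rule rl_path_adapted[OF X cad t])
  have "(\<lambda>\<omega>. rl_path T ((1 - \<theta>) / 2) (\<lambda>u. X u \<omega>) t - X 0 \<omega>) \<in> borel_measurable (F t)" by measurable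
  then show ?thesis by (rule measurable_cong[THEN iffD1, rotated]) (simp add: Y_eq space_F t)
qed

private lemma Y_measurable: "0 \<le> t \<Longrightarrow> t < T \<Longrightarrow> Y t \<in> borel_measurable M"
  by (rule measurable_F_imp_M[OF Y_measurable_F]) auto

private lemma Y_cadlag: "\<omega> \<in> space M \<Longrightarrow> cadlag T (\<lambda>t. Y t \<omega>)"
  by (rule cadlag_cong[OF cadlag_compose[where g="\<lambda>x. x - X 0 \<omega>", OF cadlag_rl_path[OF cadlag_processD[OF cad]]]])
     (auto simp: Y_eq)

private lemma Y_0: "\<omega> \<in> space M \<Longrightarrow> Y 0 \<omega> = 0"
  using T_pos by (simp add: Y_eq rl_path_0)

private lemma Y_bound_iff:
  assumes "0 \<le> K"
  shows "deterministic_bound Y 2 K \<longleftrightarrow>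
    (\<forall>s t A. 0 \<le> s \<longrightarrow> s \<le> t \<longrightarrow> t < T \<longrightarrow> A \<in> sets (F s) \<longrightarrow> rl_energy \<theta> X A s t \<le> K * prob A)"
proof -
  have "(\<integral>\<^sup>+\<omega>. indicator A \<omega> * ennreal (\<bar>Y t \<omega> - Y s \<omega>\<bar> powr 2) \<partial>M) \<le> ennreal K * emeasure M A
      \<longleftrightarrow> rl_energy \<theta> X A s t \<le> K * prob A"
    if st: "0 \<le> s" "s \<le> t" "t < T" "A \<in> sets (F s)" for s t A
  proof -
    have A: "A \<in> sets M" using st by (intro sets_F_imp_M[of A s]) auto
    have "(\<integral>\<^sup>+\<omega>. indicator A \<omega> * ennreal (\<bar>Y t \<omega> - Y s \<omega>\<bar> powr 2) \<partial>M)
        = (\<integral>\<^sup>+\<omega>. indicator A \<omega> * ennreal ((rl_path T ((1 - \<theta>) / 2) (\<lambda>u. X u \<omega>) t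
            - rl_path T ((1 - \<theta>) / 2) (\<lambda>u. X u \<omega>) s)\<^sup>2) \<partial>M)"
      using st by (intro nn_integral_cong) (simp add: Y_eq)
    also have "\<dots> = ennreal (rl_energy \<theta> X A s t)"
      using st A by (intro energy_nn_integral[OF l2_martingale_rl[OF X cad \<theta>]]) auto
    finally show ?thesis
      using assms by (simp add: emeasure_eq_measure ennreal_mult[symmetric])
  qed
  then show ?thesis unfolding deterministic_bound_def by blast
qed

private lemma Y_bmo_iff: "Y \<in> bmo M F T 2 \<longleftrightarrow>
    (\<exists>K\<ge>0. \<forall>s t A. 0 \<le> s \<longrightarrow> s \<le> t \<longrightarrow> t < T \<longrightarrow> A \<in> sets (F s) \<longrightarrow> rl_energy \<theta> X A s t \<le> K * prob A)"
proof
  assume "Y \<in> bmo M F T 2"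
  then have "bmo_norm M F T 2 Y < \<infinity>" by (simp add: bmo_def)
  then obtain c where c: "0 \<le> c" "bmo_norm M F T 2 Y = ennreal c"
    by (cases "bmo_norm M F T 2 Y") auto
  \<comment> \<open>The added 1 makes the inequality strict, as \<open>bmo_norm_lessD\<close>
    requires; only finiteness is at stake.\<close>
  then have "bmo_norm M F T 2 Y < ennreal (c + 1)" by (simp add: ennreal_less_iff)
  then have "deterministic_bound Y 2 ((c + 1) powr 2)"
    by (intro bmo_norm_lessD Y_measurable) auto
  then show "\<exists>K\<ge>0. \<forall>s t A. 0 \<le> s \<longrightarrow> s \<le> t \<longrightarrow> t < T \<longrightarrow> A \<in> sets (F s) \<longrightarrow> rl_energy \<theta> X A s t \<le> K * prob A"
    using Y_bound_iff[of "(c + 1) powr 2"] by (intro exI[of _ "(c + 1) powr 2"]) auto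
next
  assume "\<exists>K\<ge>0. \<forall>s t A. 0 \<le> s \<longrightarrow> s \<le> t \<longrightarrow> t < T \<longrightarrow> A \<in> sets (F s) \<longrightarrow> rl_energy \<theta> X A s t \<le> K * prob A"
  then obtain K where K: "0 \<le> K" "deterministic_bound Y 2 K" using Y_bound_iff by blast
  moreover have "K = sqrt K powr 2" using K by simp
  ultimately have "deterministic_bound Y 2 (sqrt K powr 2)" by simp
  then have "bmo_norm M F T 2 Y \<le> ennreal (sqrt K)"
    using K Y_cadlag by (intro bmo_norm_leI Y_measurable) (auto simp: cadlag_def)
  then have "bmo_norm M F T 2 Y < \<infinity>" by (rule le_less_trans) simp
  then show "Y \<in> bmo M F T 2"
    using Y_measurable_F Y_cadlag Y_0 by (simp add: bmo_def adapted_def cadlag_process_def)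
qed

lemmas riemann_liouville_bmo_iff = Y_bmo_iff[unfolded Y_def]

lemma square_error_BMO_iff:
  "(SUP \<tau>\<in>time_nets T. inverse (ennreal (net_size T \<theta> \<tau>)) * BMO_norm M F T 1 (square_error X \<tau>)) < \<infinity> \<longleftrightarrow>
   (\<exists>K\<ge>0. \<forall>n t. (n, t) \<in> time_nets T \<longrightarrow> deterministic_bound (square_error X (n, t)) 1 (K * net_size T \<theta> (n, t)))"
  (is "?S < \<infinity> \<longleftrightarrow> ?R")
proof
  assume "?S < \<infinity>"
  then obtain K where K: "0 \<le> K" "?S = ennreal K" by (cases ?S) auto
  \<comment> \<open>Since net sizes are positive, \<open>K + 1\<close> times the net size lies
    strictly above the norm, and the same constant works for every net.\<close>
  have "deterministic_bound (square_error X (n, t)) 1 ((K + 1) * net_size T \<theta> (n, t))"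
    if net: "(n, t) \<in> time_nets T" for n t
  proof -
    let ?N = "net_size T \<theta> (n, t)" and ?B = "BMO_norm M F T 1 (square_error X (n, t))"
    have N: "0 < ?N" by (rule net_size_pos[OF net])
    have "inverse (ennreal ?N) * ?B \<le> ennreal K"
      unfolding K(2)[symmetric] using SUP_upper[OF net, of "\<lambda>\<tau>. inverse (ennreal (net_size T \<theta> \<tau>)) * BMO_norm M F T 1 (square_error X \<tau>)"] .
    then have "ennreal ?N * (inverse (ennreal ?N) * ?B) \<le> ennreal ?N * ennreal K" by (rule mult_left_mono) simp
    moreover have "ennreal ?N * inverse (ennreal ?N) = 1"
      using N by (simp add: inverse_ennreal ennreal_mult[symmetric])
    ultimately have "?B \<le> ennreal (?N * K)"
      using N K(1) by (simp add: mult.assoc[symmetric] ennreal_mult)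
    also have "\<dots> < ennreal ((K + 1) * ?N)" using N K(1) by (simp add: ennreal_less_iff algebra_simps)
    finally have "deterministic_bound (square_error X (n, t)) 1 (((K + 1) * ?N) powr 1)"
      by (intro BMO_norm_lessD square_error_measurable[OF X cad net] square_error_tendsto(2)[OF X cad net]) auto
    then show ?thesis using K(1) N by simp
  qed
  then show ?R using K(1) by (intro exI[of _ "K + 1"]) auto
next
  assume ?R
  then obtain K where K: "0 \<le> K"
    "\<And>n t. (n, t) \<in> time_nets T \<Longrightarrow> deterministic_bound (square_error X (n, t)) 1 (K * net_size T \<theta> (n, t))" by blast
  have "?S \<le> ennreal K"
  proof (rule SUP_least)
    fix \<tau> assume \<tau>: "\<tau> \<in> time_nets T"
    obtain n t where nt: "\<tau> = (n, t)" by (cases \<tau>)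
    note net = \<tau>[unfolded nt]
    let ?N = "net_size T \<theta> (n, t)"
    have N: "0 < ?N" by (rule net_size_pos[OF net])
    have "deterministic_bound (square_error X (n, t)) 1 ((K * ?N) powr 1)" using K N net by simp
    then have "BMO_norm M F T 1 (square_error X (n, t)) \<le> ennreal (K * ?N)"
      using K N by (intro BMO_norm_leI square_error_measurable[OF X cad net] square_error_tendsto[OF X cad net]) auto
    then have "inverse (ennreal ?N) * BMO_norm M F T 1 (square_error X (n, t)) \<le> inverse (ennreal ?N) * ennreal (K * ?N)"
      by (rule mult_left_mono) simp
    also have "\<dots> = ennreal K" using N K by (simp add: inverse_ennreal ennreal_mult[symmetric])
    finally show "inverse (ennreal (net_size T \<theta> \<tau>)) * BMO_norm M F T 1 (square_error X \<tau>) \<le> ennreal K"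
      by (simp add: nt)
  qed
  then show "?S < \<infinity>" by (rule le_less_trans) simp
qed

lemma increment_energy_of_AE:
  assumes ps: "0 \<le> p" "p < s" "s < T" and A: "A \<in> sets (F s)"
    and AE: "AE \<omega> in M. \<bar>X s \<omega> - X p \<omega>\<bar> \<le> c * ((T - p) powr (\<theta> / 2) / (T - s) powr (1 / 2))"
  shows "energy X A p s \<le> c\<^sup>2 * ((T - p) powr \<theta> / (T - s)) * prob A"
proof -
  have AM: "A \<in> sets M" using ps by (intro sets_F_imp_M[OF A]) auto
  let ?B = "c\<^sup>2 * ((T - p) powr \<theta> / (T - s))"
  have sq: "(c * ((T - p) powr (\<theta> / 2) / (T - s) powr (1 / 2)))\<^sup>2 = ?B"
  proof -
    have "((T - p) powr (\<theta> / 2))\<^sup>2 = (T - p) powr \<theta>" "((T - s) powr (1 / 2))\<^sup>2 = T - s"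
      using ps by (simp_all add: power2_eq_square powr_add[symmetric])
    then show ?thesis by (simp only: power_mult_distrib power_divide)
  qed
  have "energy X A p s \<le> (\<integral>\<omega>. ?B * indicator A \<omega> \<partial>M)"
    unfolding energy_def
  proof (rule integral_mono_AE)
    show "integrable M (\<lambda>\<omega>. indicator A \<omega> * (X s \<omega> - X p \<omega>)\<^sup>2)"
      using ps AM by (intro energy_integrable[OF X]) auto
    show "integrable M (\<lambda>\<omega>. ?B * indicator A \<omega>)"
      using AM by (intro integrable_mult_right integrable_real_indicator) (auto simp: emeasure_eq_measure)
    show "AE \<omega> in M. indicator A \<omega> * (X s \<omega> - X p \<omega>)\<^sup>2 \<le> ?B * indicator A \<omega>"
      using AE
    proof eventually_elim
      case (elim \<omega>)
      then have "(X s \<omega> - X p \<omega>)\<^sup>2 \<le> ?B" unfolding sq[symmetric] by (rule power2_le_iff_abs_le[THEN iffD2, rotated]) (use elim abs_ge_zero order_trans in blast)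
      then show ?case by (auto simp: indicator_def)
    qed
  qed
  also have "\<dots> = ?B * prob A" using AM by simp
  finally show ?thesis .
qed

end

end

theorem theorem1:
  fixes M :: "'a measure" and F :: "real \<Rightarrow> 'a measure" and T \<theta> :: real
    and L :: "real \<Rightarrow> 'a \<Rightarrow> real"
  assumes basis: "stochastic_basis M F T"
    and martingale: "martingale M F T L"
    and cadlag: "cadlag_process M T L"
    and square_integrable: "\<And>t. 0 \<le> t \<Longrightarrow> t < T \<Longrightarrow> integrable M (\<lambda>\<omega>. (L t \<omega>)\<^sup>2)"
    and theta: "0 < \<theta>" "\<theta> \<le> 1"
  shows "(SUP \<tau>\<in>time_nets T.
            inverse (ennreal (net_size T \<theta> \<tau>)) * BMO_norm M F T 1 (square_error L \<tau>)) < \<infinity>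
     \<longleftrightarrow>
     (\<lambda>t \<omega>. riemann_liouville T ((1 - \<theta>) / 2) (\<lambda>u. L u \<omega>) t - L 0 \<omega>) \<in> bmo M F T 2 \<and>
     (\<exists>c>0. \<forall>s a. 0 \<le> s \<longrightarrow> s < a \<longrightarrow> a < T \<longrightarrow>
        (AE \<omega> in M. \<bar>L a \<omega> - L s \<omega>\<bar> \<le> c * ((T - s) powr (\<theta> / 2) / (T - a) powr (1 / 2))))"
proof -
  interpret stochastic_basis M F T by (rule basis)
  have L: "l2_martingale L" by (rule martingale_imp_l2_martingale[OF martingale square_integrable])
  show ?thesis
    unfolding square_error_BMO_iff[OF L cadlag theta] riemann_liouville_bmo_iff[OF L cadlag theta]
  proof (intro iffI conjI)
    assume "\<exists>K\<ge>0. \<forall>n t. (n, t) \<in> time_nets T \<longrightarrow> deterministic_bound (square_error L (n, t)) 1 (K * net_size T \<theta> (n, t))"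
    then obtain K where K: "0 \<le> K" "\<And>n t. (n, t) \<in> time_nets T \<Longrightarrow>
        deterministic_bound (square_error L (n, t)) 1 (K * net_size T \<theta> (n, t))" by blast
    show "\<exists>K\<ge>0. \<forall>s t A. 0 \<le> s \<longrightarrow> s \<le> t \<longrightarrow> t < T \<longrightarrow> A \<in> sets (F s) \<longrightarrow> rl_energy \<theta> L A s t \<le> K * prob A"
      using rl_energy_le[OF L cadlag theta K] K(1) theta T_pos
      by (intro exI[of _ "4 * 2 powr (1 / \<theta> - 1) * K / (\<theta> * T powr (1 - \<theta>))"]) auto
    \<comment> \<open>The assertion asks for a positive constant; the added 1 provides it when
      \<open>K = 0\<close>.\<close>
    have "AE \<omega> in M. \<bar>L a \<omega> - L s \<omega>\<bar> \<le> (sqrt (2 * K) + 1) * ((T - s) powr (\<theta> / 2) / (T - a) powr (1 / 2))"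
      if "0 \<le> s" "s < a" "a < T" for s a
    proof -
      have "AE \<omega> in M. \<bar>L a \<omega> - L s \<omega>\<bar> \<le> sqrt (2 * K) * ((T - s) powr (\<theta> / 2) / (T - a) powr (1 / 2))"
        by (rule increment_bound[OF L cadlag theta K(1) _ that]) (rule K(2))
      then show ?thesis
      proof eventually_elim
        case (elim \<omega>)
        also have "sqrt (2 * K) * ((T - s) powr (\<theta> / 2) / (T - a) powr (1 / 2))
            \<le> (sqrt (2 * K) + 1) * ((T - s) powr (\<theta> / 2) / (T - a) powr (1 / 2))"
          by (intro mult_right_mono) auto
        finally show ?case .
      qed
    qed
    moreover have "0 < sqrt (2 * K) + 1" using K(1) by (simp add: add_nonneg_pos)
    ultimately show "\<exists>c>0. \<forall>s a. 0 \<le> s \<longrightarrow> s < a \<longrightarrow> a < T \<longrightarrow>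
        (AE \<omega> in M. \<bar>L a \<omega> - L s \<omega>\<bar> \<le> c * ((T - s) powr (\<theta> / 2) / (T - a) powr (1 / 2)))" by blast
  next
    assume *: "(\<exists>K\<ge>0. \<forall>s t A. 0 \<le> s \<longrightarrow> s \<le> t \<longrightarrow> t < T \<longrightarrow> A \<in> sets (F s) \<longrightarrow> rl_energy \<theta> L A s t \<le> K * prob A) \<and>
      (\<exists>c>0. \<forall>s a. 0 \<le> s \<longrightarrow> s < a \<longrightarrow> a < T \<longrightarrow>
        (AE \<omega> in M. \<bar>L a \<omega> - L s \<omega>\<bar> \<le> c * ((T - s) powr (\<theta> / 2) / (T - a) powr (1 / 2))))"
    then obtain K where K: "0 \<le> K"
      "\<And>s t A. 0 \<le> s \<Longrightarrow> s \<le> t \<Longrightarrow> t < T \<Longrightarrow> A \<in> sets (F s) \<Longrightarrow> rl_energy \<theta> L A s t \<le> K * prob A" by blast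
    from * obtain c where c: "\<And>s a. 0 \<le> s \<Longrightarrow> s < a \<Longrightarrow> a < T \<Longrightarrow>
        AE \<omega> in M. \<bar>L a \<omega> - L s \<omega>\<bar> \<le> c * ((T - s) powr (\<theta> / 2) / (T - a) powr (1 / 2))" by blast
    have "deterministic_bound (square_error L (n, t)) 1 ((T powr (1 - \<theta>) / \<theta> * K + c\<^sup>2) * net_size T \<theta> (n, t))"
      if "(n, t) \<in> time_nets T" for n t
    proof (rule square_error_bound[OF L cadlag theta K(2) _ _ that])
      show "energy L A p s \<le> c\<^sup>2 * ((T - p) powr \<theta> / (T - s)) * prob A"
        if "0 \<le> p" "p < s" "s < T" "A \<in> sets (F s)" for p s A
        using that by (intro increment_energy_of_AE[OF L cadlag theta] c)
    qed auto
    moreover have "0 \<le> T powr (1 - \<theta>) / \<theta> * K + c\<^sup>2" using K(1) theta by simp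
    ultimately show "\<exists>K\<ge>0. \<forall>n t. (n, t) \<in> time_nets T \<longrightarrow>
        deterministic_bound (square_error L (n, t)) 1 (K * net_size T \<theta> (n, t))" by blast
  qed
qed

end
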